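(* Let $D\subset\mathbb{C}^n$ be a bounded pseudoconvex domain with coordinates $z=(z_1,\dots,z_n)$, let $\omega=\sqrt{-1}\,\partial\overline{\partial}|z|^2$ be the standard Kähler metric on $D$, and let $c\ge0$ be a constant. Let $E\to D$ be a holomorphic vector bundle and $h$ a smooth Hermitian metric on $E$. Assume that for every smooth strictly plurisubharmonic function $\psi$ on $D$ and every smooth $E$-valued $(n,n)$-form $f$ on $D$ with compact support, there exists a solution $u$ (an $E$-valued $(n,n-1)$-form on $D$) of $\overline{\partial}u=f$ satisfying $$\int_D|u|^2_{(\omega,h)}e^{-\psi}\,dV_\omega\le\int_D\big\langle\big([\sqrt{-1}\,\partial\overline{\partial}\psi\otimes \mathrm{Id}_E,\Lambda_\omega]+c\big)^{-1}f,f\big\rangle_{(\omega,h)}e^{-\psi}\,dV_\omega .$$ Then $$\mathrm{tr}_\omega\big(\sqrt{-1}\Theta_{(E,h)}a,a\big)_h(x)\ \ge\ c\,|a|_h^2(x)$$ for every point $x\in D$ and every $a\in E_x$. In particular, $(E,h)$ is RC-positive if $c>0$, and RC-semi-positive if $c=0$.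
   Context: Conventions. $\omega=\sqrt{-1}\sum_j dz_j\wedge d\bar z_j$ and $dV_\omega=\omega^n/n!$. The pointwise inner product $\langle\cdot,\cdot\rangle_{(\omega,h)}$ on $E$-valued forms (with norm $|\cdot|_{(\omega,h)}$) is induced by $\omega$ and $h$, normalized so that the forms $dz_I\wedge d\bar z_J$ ($I,J$ increasing multi-indices) are orthonormal. Vector bundles have finite rank. $\Theta_{(E,h)}$ is the curvature of the Chern connection of $(E,h)$. Writing $\sqrt{-1}\Theta_{(E,h)}=\sqrt{-1}\sum_{j,k}R_{j\bar k}\,dz_j\wedge d\bar z_k$ with $R_{j\bar k}$ sections of $\mathrm{End}(E)$, one has $\mathrm{tr}_\omega(\sqrt{-1}\Theta_{(E,h)}a,a)_h=\sum_{j=1}^n(R_{j\bar j}a,a)_h$, and for $v=\sum_j v_j\,\partial/\partial z_j$, $(\sqrt{-1}\Theta_{(E,h)}(v,v)a,a)_h$ denotes $\sum_{j,k}(R_{j\bar k}a,a)_h v_j\bar v_k$. $\Lambda_\omega$ is the pointwise adjoint of $\omega\wedge\cdot$, and $[\sqrt{-1}\,\partial\overline{\partial}\psi\otimes\mathrm{Id}_E,\Lambda_\omega]$ is the graded commutator of the operator $\sqrt{-1}\,\partial\overline{\partial}\psi\wedge\cdot$ with $\Lambda_\omega$, acting on $E$-valued $(n,n)$-forms. It is pointwise positive definite when $\psi$ is strictly plurisubharmonic. The solution $u$ is understood as a form with measurable, locally $L^2$ coefficients, and $\overline{\partial}u=f$ is understood in the sense of distributions. $(E,h)$ over a complex manifold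 $X$ is RC-positive if for every $x\in X$ and every nonzero $a\in E_x$ there exists $v\in T_xX$ with $(\sqrt{-1}\Theta_{(E,h)}(v,v)a,a)_h>0$. It is RC-semi-positive if for every $x\in X$ and every nonzero $a\in E_x$ there exists a nonzero $v\in T_xX$ with $(\sqrt{-1}\Theta_{(E,h)}(v,v)a,a)_h\ge0$. *)

theory Defs
  imports "HOL-Analysis.Analysis"
begin

section \<open>Smooth and holomorphic functions on open subsets of complex Euclidean space\<close>

text \<open>
  \<open>Ck_on k S f\<close> is meant for open \<open>S\<close>: all iterated directional derivatives of \<open>f\<close> up to order \<open>k\<close>
  exist and are continuous on \<open>S\<close>.  Differentiability is real throughout.
\<close>

primrec Ck_on :: "nat \<Rightarrow> 'a::real_normed_vector set \<Rightarrow> ('a \<Rightarrow> 'b::real_normed_vector) \<Rightarrow> bool" where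
  "Ck_on 0 S f \<longleftrightarrow> continuous_on S f"
| "Ck_on (Suc k) S f \<longleftrightarrow>
     (\<forall>x\<in>S. f differentiable (at x)) \<and> (\<forall>v. Ck_on k S (\<lambda>x. frechet_derivative f (at x) v))"

definition smooth_on :: "'a::real_normed_vector set \<Rightarrow> ('a \<Rightarrow> 'b::real_normed_vector) \<Rightarrow> bool" where
  "smooth_on S f \<longleftrightarrow> (\<forall>k. Ck_on k S f)"

definition holomorphic_several_on :: "(complex^'n) set \<Rightarrow> (complex^'n \<Rightarrow> complex) \<Rightarrow> bool" where
  "holomorphic_several_on S f \<longleftrightarrow>
     (\<forall>x\<in>S. \<exists>L. (f has_derivative L) (at x) \<and> (\<forall>c v. L (c *s v) = c * L v))"

text \<open>
  The operators \<open>\<partial>/\<partial>z\<^sub>j\<close> and \<open>\<partial>/\<partial>\<bar>z\<^sub>j\<close>.  With \<open>z\<^sub>j = x\<^sub>j + \<i> y\<^sub>j\<close>, the real coordinate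
  directions \<open>\<partial>/\<partial>x\<^sub>j\<close>, \<open>\<partial>/\<partial>y\<^sub>j\<close> are \<open>axis j 1\<close>, \<open>axis j \<i>\<close>.
\<close>

definition dz :: "'n \<Rightarrow> (complex^'n \<Rightarrow> complex) \<Rightarrow> complex^'n \<Rightarrow> complex" where
  "dz j f x = (frechet_derivative f (at x) (axis j 1) - \<i> * frechet_derivative f (at x) (axis j \<i>)) / 2"

definition dzbar :: "'n \<Rightarrow> (complex^'n \<Rightarrow> complex) \<Rightarrow> complex^'n \<Rightarrow> complex" where
  "dzbar j f x = (frechet_derivative f (at x) (axis j 1) + \<i> * frechet_derivative f (at x) (axis j \<i>)) / 2"

text \<open>The coefficients \<open>\<psi>\<^sub>j\<^sub>k = \<partial>\<^sup>2\<psi>/\<partial>z\<^sub>j\<partial>\<bar>z\<^sub>k\<close> of \<open>\<partial>\<bar>\<partial>\<psi> = \<Sum> \<psi>\<^sub>j\<^sub>k dz\<^sub>j \<and> d\<bar>z\<^sub>k\<close>.\<close>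

definition complex_hessian :: "(complex^'n \<Rightarrow> real) \<Rightarrow> complex^'n \<Rightarrow> 'n \<Rightarrow> 'n \<Rightarrow> complex" where
  "complex_hessian \<psi> x j k = dz j (dzbar k (\<lambda>y. complex_of_real (\<psi> y))) x"

text \<open>The Hermitian form is real-valued, so taking \<open>Re\<close> loses nothing.\<close>

definition smooth_strictly_psh_on :: "(complex^'n) set \<Rightarrow> (complex^'n \<Rightarrow> real) \<Rightarrow> bool" where
  "smooth_strictly_psh_on D \<psi> \<longleftrightarrow> smooth_on D \<psi> \<and>
     (\<forall>x\<in>D. \<forall>v. v \<noteq> 0 \<longrightarrow>
        0 < Re (\<Sum>j\<in>UNIV. \<Sum>k\<in>UNIV. complex_hessian \<psi> x j k * v $ j * cnj (v $ k)))"

section \<open>Pseudoconvex domains\<close>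

definition continuous_psh_on :: "(complex^'n) set \<Rightarrow> (complex^'n \<Rightarrow> real) \<Rightarrow> bool" where
  "continuous_psh_on D \<rho> \<longleftrightarrow> continuous_on D \<rho> \<and>
     (\<forall>z w. (\<forall>\<zeta>::complex. norm \<zeta> \<le> 1 \<longrightarrow> z + \<zeta> *s w \<in> D) \<longrightarrow>
        \<rho> z \<le> 1 / (2 * pi) * integral {0..2 * pi} (\<lambda>\<theta>. \<rho> (z + cis \<theta> *s w)))"

text \<open>Existence of a continuous plurisubharmonic exhaustion function.\<close>

definition pseudoconvex :: "(complex^'n) set \<Rightarrow> bool" where
  "pseudoconvex D \<longleftrightarrow>
     (\<exists>\<rho>. continuous_psh_on D \<rho> \<and> (\<forall>r. \<exists>K. compact K \<and> K \<subseteq> D \<and> {z\<in>D. \<rho> z < r} \<subseteq> K))"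

section \<open>Holomorphic vector bundles\<close>

class complex_vector = ab_group_add +
  fixes scaleC :: "complex \<Rightarrow> 'a \<Rightarrow> 'a"  (infixr \<open>*\<^sub>C\<close> 75)
  assumes scaleC_add_right: "c *\<^sub>C (a + b) = c *\<^sub>C a + c *\<^sub>C b"
    and scaleC_add_left: "(c + d) *\<^sub>C a = c *\<^sub>C a + d *\<^sub>C a"
    and scaleC_scaleC: "c *\<^sub>C (d *\<^sub>C a) = (c * d) *\<^sub>C a"
    and scaleC_one: "1 *\<^sub>C a = a"

text \<open>
  The fibres \<open>E x\<close> are complex subspaces of an ambient complex vector space \<open>'v\<close>.  The ambient space
  carries no topology and serves only to give all fibres a common type and common linear operations:
  any family \<open>(E\<^sub>x)\<close> of vector spaces is of this form, inside its direct sum, and different fibres need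
  not be related in any way within \<open>'v\<close>.  The bundle structure is given solely by the atlas \<open>T\<close> of local
  trivialisations \<open>(U, \<phi>)\<close>, where \<open>\<phi> x\<close> maps \<open>E x\<close> isomorphically onto \<open>complex^'r\<close> for \<open>x \<in> U\<close>, with
  holomorphic transition matrices; \<open>T\<close> need not be maximal.
\<close>

type_synonym ('n, 'r, 'v) atlas = "((complex^'n) set \<times> (complex^'n \<Rightarrow> 'v \<Rightarrow> complex^'r)) set"

definition complex_subspace :: "'v::complex_vector set \<Rightarrow> bool" where
  "complex_subspace F \<longleftrightarrow> 0 \<in> F \<and> (\<forall>a\<in>F. \<forall>b\<in>F. a + b \<in> F) \<and> (\<forall>c. \<forall>a\<in>F. c *\<^sub>C a \<in> F)"

definition linear_iso_on :: "'v::complex_vector set \<Rightarrow> ('v \<Rightarrow> complex^'r) \<Rightarrow> bool" where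
  "linear_iso_on F \<phi> \<longleftrightarrow> bij_betw \<phi> F UNIV \<and>
     (\<forall>a\<in>F. \<forall>b\<in>F. \<phi> (a + b) = \<phi> a + \<phi> b) \<and> (\<forall>c. \<forall>a\<in>F. \<phi> (c *\<^sub>C a) = c *s \<phi> a)"

definition holomorphic_vector_bundle ::
    "(complex^'n) set \<Rightarrow> (complex^'n \<Rightarrow> 'v::complex_vector set) \<Rightarrow> ('n, 'r::finite, 'v) atlas \<Rightarrow> bool" where
  "holomorphic_vector_bundle D E T \<longleftrightarrow>
     (\<forall>x\<in>D. complex_subspace (E x)) \<and>
     (\<Union>(U, \<phi>)\<in>T. U) = D \<and>
     (\<forall>(U, \<phi>)\<in>T. open U \<and> (\<forall>x\<in>U. linear_iso_on (E x) (\<phi> x))) \<and>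
     (\<forall>(U, \<phi>)\<in>T. \<forall>(V, \<phi>')\<in>T. \<exists>g :: complex^'n \<Rightarrow> complex^'r^'r.
        (\<forall>\<alpha> \<beta>. holomorphic_several_on (U \<inter> V) (\<lambda>x. g x $ \<alpha> $ \<beta>)) \<and>
        (\<forall>x\<in>U \<inter> V. \<forall>a\<in>E x. \<phi>' x a = g x *v \<phi> x a))"

text \<open>
  Sections are total functions on \<open>complex^'n\<close>; only their values on the open set \<open>W\<close> are relevant.
\<close>

definition smooth_section ::
    "(complex^'n \<Rightarrow> 'v::complex_vector set) \<Rightarrow> ('n, 'r::finite, 'v) atlas \<Rightarrow>
     (complex^'n) set \<Rightarrow> (complex^'n \<Rightarrow> 'v) \<Rightarrow> bool" where
  "smooth_section E T W s \<longleftrightarrow>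
     (\<forall>x\<in>W. s x \<in> E x) \<and> (\<forall>(U, \<phi>)\<in>T. smooth_on (W \<inter> U) (\<lambda>x. \<phi> x (s x)))"

text \<open>\<open>h x\<close> is linear in the first and conjugate-linear in the second argument.\<close>

definition smooth_hermitian_metric ::
    "(complex^'n) set \<Rightarrow> (complex^'n \<Rightarrow> 'v::complex_vector set) \<Rightarrow> ('n, 'r::finite, 'v) atlas \<Rightarrow>
     (complex^'n \<Rightarrow> 'v \<Rightarrow> 'v \<Rightarrow> complex) \<Rightarrow> bool" where
  "smooth_hermitian_metric D E T h \<longleftrightarrow>
     (\<forall>x\<in>D. \<forall>a\<in>E x. \<forall>b\<in>E x.
        (\<forall>a'\<in>E x. h x (a + a') b = h x a b + h x a' b) \<and>
        (\<forall>c. h x (c *\<^sub>C a) b = c * h x a b) \<and>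
        h x b a = cnj (h x a b) \<and>
        (a \<noteq> 0 \<longrightarrow> 0 < Re (h x a a))) \<and>
     (\<forall>W s t. open W \<and> W \<subseteq> D \<and> smooth_section E T W s \<and> smooth_section E T W t \<longrightarrow>
        smooth_on W (\<lambda>x. h x (s x) (t x)))"

section \<open>Chern connection and curvature\<close>

text \<open>
  \<open>N1 j\<close> and \<open>N2 j\<close> are the covariant derivatives along \<open>\<partial>/\<partial>z\<^sub>j\<close> and \<open>\<partial>/\<partial>\<bar>z\<^sub>j\<close>, acting on local smooth
  sections.  Since sections are total functions, compatibility with restriction is the third
  condition: on an open set the result depends only on the section on that set.
\<close>

type_synonym ('n, 'v) partial_connection = "'n \<Rightarrow> (complex^'n \<Rightarrow> 'v) \<Rightarrow> complex^'n \<Rightarrow> 'v"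

definition smooth_connection ::
    "(complex^'n) set \<Rightarrow> (complex^'n \<Rightarrow> 'v::complex_vector set) \<Rightarrow> ('n, 'r::finite, 'v) atlas \<Rightarrow>
     ('n, 'v) partial_connection \<Rightarrow> ('n, 'v) partial_connection \<Rightarrow> bool" where
  "smooth_connection D E T N1 N2 \<longleftrightarrow>
     (\<forall>W s j. open W \<and> W \<subseteq> D \<and> smooth_section E T W s \<longrightarrow>
        smooth_section E T W (N1 j s) \<and> smooth_section E T W (N2 j s) \<and>
        (\<forall>t. smooth_section E T W t \<longrightarrow>
           (\<forall>x\<in>W. N1 j (\<lambda>y. s y + t y) x = N1 j s x + N1 j t x \<and>
                    N2 j (\<lambda>y. s y + t y) x = N2 j s x + N2 j t x)) \<and>
        (\<forall>t. (\<forall>x\<in>W. t x = s x) \<longrightarrow> (\<forall>x\<in>W. N1 j t x = N1 j s x \<and> N2 j t x = N2 j s x)) \<and>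
        (\<forall>g. smooth_on W g \<longrightarrow>
           (\<forall>x\<in>W. N1 j (\<lambda>y. g y *\<^sub>C s y) x = dz j g x *\<^sub>C s x + g x *\<^sub>C N1 j s x \<and>
                    N2 j (\<lambda>y. g y *\<^sub>C s y) x = dzbar j g x *\<^sub>C s x + g x *\<^sub>C N2 j s x)))"

text \<open>
  The Chern connection: its (0,1)-part is the \<open>\<bar>\<partial>\<close>-operator of \<open>E\<close>, computed componentwise in the
  holomorphic trivialisations, and it is compatible with \<open>h\<close>.  The compatibility in the direction
  \<open>\<partial>/\<partial>\<bar>z\<^sub>j\<close> is the complex conjugate of the one stated.
\<close>

definition chern_connection ::
    "(complex^'n) set \<Rightarrow> (complex^'n \<Rightarrow> 'v::complex_vector set) \<Rightarrow> ('n, 'r::finite, 'v) atlas \<Rightarrow>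
     (complex^'n \<Rightarrow> 'v \<Rightarrow> 'v \<Rightarrow> complex) \<Rightarrow>
     ('n, 'v) partial_connection \<Rightarrow> ('n, 'v) partial_connection \<Rightarrow> bool" where
  "chern_connection D E T h N1 N2 \<longleftrightarrow> smooth_connection D E T N1 N2 \<and>
     (\<forall>W s j. open W \<and> W \<subseteq> D \<and> smooth_section E T W s \<longrightarrow>
        (\<forall>(U, \<phi>)\<in>T. \<forall>x\<in>W \<inter> U. \<forall>\<alpha>. \<phi> x (N2 j s x) $ \<alpha> = dzbar j (\<lambda>y. \<phi> y (s y) $ \<alpha>) x) \<and>
        (\<forall>t. smooth_section E T W t \<longrightarrow>
           (\<forall>x\<in>W. dz j (\<lambda>y. h y (s y) (t y)) x = h x (N1 j s x) (t x) + h x (s x) (N2 j t x))))"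

text \<open>
  \<open>chern_curvature D E T h x j k a\<close> is \<open>R\<^sub>j\<^sub>k a\<close> for \<open>\<Theta> = \<Sum> R\<^sub>j\<^sub>k dz\<^sub>j \<and> d\<bar>z\<^sub>k\<close>.  As coordinate vector fields
  commute, \<open>R\<^sub>j\<^sub>k\<close> is the commutator of the covariant derivatives along \<open>\<partial>/\<partial>z\<^sub>j\<close> and \<open>\<partial>/\<partial>\<bar>z\<^sub>k\<close>, which
  is tensorial: the value does not depend on the local section \<open>s\<close> extending \<open>a\<close>.
\<close>

definition chern_curvature ::
    "(complex^'n) set \<Rightarrow> (complex^'n \<Rightarrow> 'v::complex_vector set) \<Rightarrow> ('n, 'r::finite, 'v) atlas \<Rightarrow>
     (complex^'n \<Rightarrow> 'v \<Rightarrow> 'v \<Rightarrow> complex) \<Rightarrow> complex^'n \<Rightarrow> 'n \<Rightarrow> 'n \<Rightarrow> 'v \<Rightarrow> 'v" where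
  "chern_curvature D E T h x j k a =
     (THE b. \<exists>N1 N2 W s. chern_connection D E T h N1 N2 \<and>
        open W \<and> x \<in> W \<and> W \<subseteq> D \<and> smooth_section E T W s \<and> s x = a \<and>
        b = N1 j (N2 k s) x - N2 k (N1 j s) x)"

text \<open>
  The Hermitian quantities \<open>(\<surd>-1 \<Theta>(v,v)a, a)\<^sub>h\<close> and \<open>tr\<^sub>\<omega>(\<surd>-1 \<Theta> a, a)\<^sub>h\<close> are real.
\<close>

definition curvature_form ::
    "(complex^'n) set \<Rightarrow> (complex^'n \<Rightarrow> 'v::complex_vector set) \<Rightarrow> ('n, 'r::finite, 'v) atlas \<Rightarrow>
     (complex^'n \<Rightarrow> 'v \<Rightarrow> 'v \<Rightarrow> complex) \<Rightarrow> complex^'n \<Rightarrow> complex^'n \<Rightarrow> 'v \<Rightarrow> real" where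
  "curvature_form D E T h x v a =
     Re (\<Sum>j\<in>UNIV. \<Sum>k\<in>UNIV. h x (chern_curvature D E T h x j k a) a * v $ j * cnj (v $ k))"

definition trace_curvature ::
    "(complex^'n) set \<Rightarrow> (complex^'n \<Rightarrow> 'v::complex_vector set) \<Rightarrow> ('n, 'r::finite, 'v) atlas \<Rightarrow>
     (complex^'n \<Rightarrow> 'v \<Rightarrow> 'v \<Rightarrow> complex) \<Rightarrow> complex^'n \<Rightarrow> 'v \<Rightarrow> real" where
  "trace_curvature D E T h x a = Re (\<Sum>j\<in>UNIV. h x (chern_curvature D E T h x j j a) a)"

definition RC_positive ::
    "(complex^'n) set \<Rightarrow> (complex^'n \<Rightarrow> 'v::complex_vector set) \<Rightarrow> ('n, 'r::finite, 'v) atlas \<Rightarrow>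
     (complex^'n \<Rightarrow> 'v \<Rightarrow> 'v \<Rightarrow> complex) \<Rightarrow> bool" where
  "RC_positive D E T h \<longleftrightarrow>
     (\<forall>x\<in>D. \<forall>a\<in>E x. a \<noteq> 0 \<longrightarrow> (\<exists>v. curvature_form D E T h x v a > 0))"

definition RC_semi_positive ::
    "(complex^'n) set \<Rightarrow> (complex^'n \<Rightarrow> 'v::complex_vector set) \<Rightarrow> ('n, 'r::finite, 'v) atlas \<Rightarrow>
     (complex^'n \<Rightarrow> 'v \<Rightarrow> 'v \<Rightarrow> complex) \<Rightarrow> bool" where
  "RC_semi_positive D E T h \<longleftrightarrow>
     (\<forall>x\<in>D. \<forall>a\<in>E x. a \<noteq> 0 \<longrightarrow> (\<exists>v. v \<noteq> 0 \<and> curvature_form D E T h x v a \<ge> 0))"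

section \<open>Exterior algebra with values in a fibre\<close>

text \<open>
  An \<open>F\<close>-valued form at a point, \<open>F \<subseteq> 'v\<close>, is its family of coefficients: \<open>\<alpha> I J\<close> is the coefficient
  of \<open>dz\<^sub>I \<and> d\<bar>z\<^sub>J\<close>, where a subset of the linearly ordered index type \<open>'n\<close> stands for the increasing
  multi-index enumerating it.
\<close>

type_synonym ('n, 'v) cform = "'n set \<Rightarrow> 'n set \<Rightarrow> 'v"

definition forms_at :: "'v::complex_vector set \<Rightarrow> ('n, 'v) cform set" where
  "forms_at F = {\<alpha>. \<forall>I J. \<alpha> I J \<in> F}"

definition pq_forms_at :: "nat \<Rightarrow> nat \<Rightarrow> 'v::complex_vector set \<Rightarrow> ('n, 'v) cform set" where
  "pq_forms_at p q F = {\<alpha> \<in> forms_at F. \<forall>I J. card I \<noteq> p \<or> card J \<noteq> q \<longrightarrow> \<alpha> I J = 0}"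

text \<open>
  Left multiplication by \<open>dz\<^sub>j\<close> and by \<open>d\<bar>z\<^sub>k\<close>.  The sign is that of the permutation moving the new
  factor to its place; \<open>d\<bar>z\<^sub>k\<close> first has to pass all factors of \<open>dz\<^sub>I\<close>.
\<close>

definition wedge_dz :: "'n::{finite,linorder} \<Rightarrow> ('n, 'v::complex_vector) cform \<Rightarrow> ('n, 'v) cform" where
  "wedge_dz j \<alpha> I J =
     (if j \<in> I then (-1) ^ card {i\<in>I. i < j} *\<^sub>C \<alpha> (I - {j}) J else 0)"

definition wedge_dzbar :: "'n::{finite,linorder} \<Rightarrow> ('n, 'v::complex_vector) cform \<Rightarrow> ('n, 'v) cform" where
  "wedge_dzbar k \<alpha> I J =
     (if k \<in> J then (-1) ^ (card I + card {i\<in>J. i < k}) *\<^sub>C \<alpha> I (J - {k}) else 0)"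

text \<open>Left multiplication by the (1,1)-form \<open>\<Sum> A\<^sub>j\<^sub>k dz\<^sub>j \<and> d\<bar>z\<^sub>k\<close>.\<close>

definition wedge_11 ::
    "('n::{finite,linorder} \<Rightarrow> 'n \<Rightarrow> complex) \<Rightarrow> ('n, 'v::complex_vector) cform \<Rightarrow> ('n, 'v) cform" where
  "wedge_11 A \<alpha> I J = (\<Sum>j\<in>UNIV. \<Sum>k\<in>UNIV. A j k *\<^sub>C wedge_dz j (wedge_dzbar k \<alpha>) I J)"

definition omega_coeff :: "'n \<Rightarrow> 'n \<Rightarrow> complex" where
  "omega_coeff j k = (if j = k then \<i> else 0)"

text \<open>
  Pointwise inner product of forms, \<open>H\<close> being the inner product \<open>h x\<close> of the fibre; the forms
  \<open>dz\<^sub>I \<and> d\<bar>z\<^sub>J\<close> are orthonormal.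
\<close>

definition form_inner ::
    "('v \<Rightarrow> 'v \<Rightarrow> complex) \<Rightarrow> ('n::finite, 'v) cform \<Rightarrow> ('n, 'v) cform \<Rightarrow> complex" where
  "form_inner H \<alpha> \<beta> = (\<Sum>I\<in>UNIV. \<Sum>J\<in>UNIV. H (\<alpha> I J) (\<beta> I J))"

definition Lambda_omega ::
    "'v::complex_vector set \<Rightarrow> ('v \<Rightarrow> 'v \<Rightarrow> complex) \<Rightarrow> ('n::{finite,linorder}, 'v) cform \<Rightarrow> ('n, 'v) cform" where
  "Lambda_omega F H \<beta> = (THE \<gamma>. \<gamma> \<in> forms_at F \<and>
     (\<forall>\<alpha>\<in>forms_at F. form_inner H (wedge_11 omega_coeff \<alpha>) \<beta> = form_inner H \<alpha> \<gamma>))"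

text \<open>
  The graded commutator with \<open>\<Lambda>\<^sub>\<omega>\<close> of multiplication by \<open>\<Sum> A\<^sub>j\<^sub>k dz\<^sub>j \<and> d\<bar>z\<^sub>k\<close>; both operators have
  even degree.
\<close>

definition commutator_Lambda ::
    "'v::complex_vector set \<Rightarrow> ('v \<Rightarrow> 'v \<Rightarrow> complex) \<Rightarrow> ('n::{finite,linorder} \<Rightarrow> 'n \<Rightarrow> complex) \<Rightarrow>
     ('n, 'v) cform \<Rightarrow> ('n, 'v) cform" where
  "commutator_Lambda F H A \<alpha> =
     (\<lambda>I J. wedge_11 A (Lambda_omega F H \<alpha>) I J - Lambda_omega F H (wedge_11 A \<alpha>) I J)"

text \<open>
  The operator \<open>[\<surd>-1 \<partial>\<bar>\<partial>\<psi> \<otimes> Id\<^sub>E, \<Lambda>\<^sub>\<omega>] + c\<close> at the point \<open>x\<close>, and its inverse on the space of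
  \<open>E\<^sub>x\<close>-valued \<open>(n,n)\<close>-forms.
\<close>

definition curvature_operator ::
    "(complex^'n::{finite,linorder} \<Rightarrow> 'v::complex_vector set) \<Rightarrow> (complex^'n::{finite,linorder} \<Rightarrow> 'v \<Rightarrow> 'v \<Rightarrow> complex) \<Rightarrow>
     (complex^'n::{finite,linorder} \<Rightarrow> real) \<Rightarrow> real \<Rightarrow> complex^'n::{finite,linorder} \<Rightarrow> ('n, 'v) cform \<Rightarrow> ('n, 'v) cform" where
  "curvature_operator E h \<psi> c x \<alpha> =
     (\<lambda>I J. commutator_Lambda (E x) (h x) (\<lambda>j k. \<i> * complex_hessian \<psi> x j k) \<alpha> I J
            + complex_of_real c *\<^sub>C \<alpha> I J)"

definition curvature_operator_inverse ::
    "(complex^'n::{finite,linorder} \<Rightarrow> 'v::complex_vector set) \<Rightarrow> (complex^'n::{finite,linorder} \<Rightarrow> 'v \<Rightarrow> 'v \<Rightarrow> complex) \<Rightarrow>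
     (complex^'n::{finite,linorder} \<Rightarrow> real) \<Rightarrow> real \<Rightarrow> complex^'n::{finite,linorder} \<Rightarrow> ('n, 'v) cform \<Rightarrow> ('n, 'v) cform" where
  "curvature_operator_inverse E h \<psi> c x =
     inv_into (pq_forms_at CARD('n) CARD('n) (E x)) (curvature_operator E h \<psi> c x)"

section \<open>Bundle-valued differential forms\<close>

definition is_pq_form ::
    "(complex^'n) set \<Rightarrow> (complex^'n \<Rightarrow> 'v::complex_vector set) \<Rightarrow> nat \<Rightarrow> nat \<Rightarrow>
     (complex^'n \<Rightarrow> ('n, 'v) cform) \<Rightarrow> bool" where
  "is_pq_form D E p q f \<longleftrightarrow> (\<forall>x\<in>D. f x \<in> pq_forms_at p q (E x))"

definition smooth_compact_pq_form ::
    "(complex^'n) set \<Rightarrow> (complex^'n \<Rightarrow> 'v::complex_vector set) \<Rightarrow> ('n, 'r::finite, 'v) atlas \<Rightarrow>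
     nat \<Rightarrow> nat \<Rightarrow> (complex^'n \<Rightarrow> ('n, 'v) cform) \<Rightarrow> bool" where
  "smooth_compact_pq_form D E T p q f \<longleftrightarrow> is_pq_form D E p q f \<and>
     (\<forall>I J. smooth_section E T D (\<lambda>x. f x I J)) \<and>
     (\<exists>K. compact K \<and> K \<subseteq> D \<and> (\<forall>x\<in>D - K. \<forall>I J. f x I J = 0))"

text \<open>Measurability and local square integrability are those of the components in the trivialisations.\<close>

definition L2loc_pq_form ::
    "(complex^'n) set \<Rightarrow> (complex^'n \<Rightarrow> 'v::complex_vector set) \<Rightarrow> ('n, 'r::finite, 'v) atlas \<Rightarrow>
     nat \<Rightarrow> nat \<Rightarrow> (complex^'n \<Rightarrow> ('n, 'v) cform) \<Rightarrow> bool" where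
  "L2loc_pq_form D E T p q u \<longleftrightarrow> is_pq_form D E p q u \<and>
     (\<forall>(U, \<phi>)\<in>T. \<forall>I J.
        (\<lambda>x. \<phi> x (u x I J)) \<in> borel_measurable (lebesgue_on U) \<and>
        (\<forall>K. compact K \<and> K \<subseteq> U \<longrightarrow> set_integrable lebesgue K (\<lambda>x. (norm (\<phi> x (u x I J)))\<^sup>2)))"

definition test_function :: "(complex^'n) set \<Rightarrow> (complex^'n \<Rightarrow> complex) \<Rightarrow> bool" where
  "test_function U \<eta> \<longleftrightarrow> smooth_on UNIV \<eta> \<and> (\<exists>K. compact K \<and> K \<subseteq> U \<and> (\<forall>x. x \<notin> K \<longrightarrow> \<eta> x = 0))"

text \<open>
  \<open>\<bar>\<partial>u = f\<close> in the sense of distributions.  In a holomorphic trivialisation \<open>\<bar>\<partial>u = \<Sum>\<^sub>k d\<bar>z\<^sub>k \<and> \<partial>u/\<partial>\<bar>z\<^sub>k\<close>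
  acts on scalar components, and the derivatives are moved to the test function.
\<close>

definition weak_dbar ::
    "('n, 'r::finite, 'v::complex_vector) atlas \<Rightarrow>
     (complex^'n::{finite,linorder} \<Rightarrow> ('n, 'v) cform) \<Rightarrow> (complex^'n::{finite,linorder} \<Rightarrow> ('n, 'v) cform) \<Rightarrow> bool" where
  "weak_dbar T u f \<longleftrightarrow>
     (\<forall>(U, \<phi>)\<in>T. \<forall>\<eta> I J. test_function U \<eta> \<longrightarrow>
        (LINT x|lebesgue_on U. \<eta> x *s \<phi> x (f x I J)) =
        - (LINT x|lebesgue_on U. (\<Sum>k\<in>UNIV. dzbar k \<eta> x *s \<phi> x (wedge_dzbar k (u x) I J))))"

text \<open>
  \<open>dV\<^sub>\<omega> = \<omega>\<^sup>n/n!\<close>: since \<open>\<surd>-1 dz \<and> d\<bar>z = 2 dx \<and> dy\<close>, this is \<open>2\<^sup>n\<close> times Lebesgue measure.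
\<close>

definition dV_omega :: "(complex^'n) measure" where
  "dV_omega = scale_measure (2 ^ CARD('n)) lebesgue"

text \<open>
  The two sides of the \<open>L\<^sup>2\<close> estimate have nonnegative integrands, hence are integrals in \<open>[0,\<infinity>]\<close>.
  For smooth \<open>f\<close> with compact support the right-hand side is finite.
\<close>

definition L2_estimate ::
    "(complex^'n::{finite,linorder}) set \<Rightarrow> (complex^'n::{finite,linorder} \<Rightarrow> 'v::complex_vector set) \<Rightarrow>
     (complex^'n::{finite,linorder} \<Rightarrow> 'v \<Rightarrow> 'v \<Rightarrow> complex) \<Rightarrow> (complex^'n::{finite,linorder} \<Rightarrow> real) \<Rightarrow> real \<Rightarrow>
     (complex^'n::{finite,linorder} \<Rightarrow> ('n, 'v) cform) \<Rightarrow> (complex^'n::{finite,linorder} \<Rightarrow> ('n, 'v) cform) \<Rightarrow> bool" where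
  "L2_estimate D E h \<psi> c f u \<longleftrightarrow>
     (\<integral>\<^sup>+x\<in>D. ennreal (Re (form_inner (h x) (u x) (u x)) * exp (- \<psi> x)) \<partial>dV_omega)
     \<le> (\<integral>\<^sup>+x\<in>D. ennreal (Re (form_inner (h x) (curvature_operator_inverse E h \<psi> c x (f x)) (f x))
                       * exp (- \<psi> x)) \<partial>dV_omega)"

end

theory Submission
  imports Defs "HOL-Complex_Analysis.Cauchy_Integral_Formula"
begin

text \<open>The hypothesis, tested on sources built from a cut-off holomorphic section, becomes an integral inequality
  between \<open>c\<close> times the squared norm of the section and the trace of the curvature. A concentrating weight
  localises it at a point.

  Fix \<open>x0 \<in> D\<close> and \<open>a \<in> E x0\<close>, let \<open>e\<close> be the section through \<open>a\<close> that is constant in a holomorphic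
  trivialisation, \<open>\<kappa>\<close> a cut-off function that is 1 near \<open>x0\<close>, and \<open>s = \<kappa> e\<close>. The weight is
  \<open>\<psi> = m |z - x0|\<^sup>2\<close> with a parameter \<open>m > 0\<close>. On forms of type \<open>(n,n)\<close> the operator
  \<open>B = [\<surd>-1 \<partial>\<bar>\<partial>\<psi>, \<Lambda>\<^sub>\<omega>] + c\<close> is multiplication by the constant \<open>m n + c\<close>
  (\<open>curvature_operator_sq_dist\<close>). Take \<open>f = B s\<close>, with \<open>s\<close> regarded as a form of top degree, and let \<open>u\<close> be the
  solution. Pairing \<open>\<bar>\<partial>u = f\<close> with \<open>s\<close> in the weighted space moves \<open>\<bar>\<partial>\<close> to its adjoint, whose
  components on \<open>s\<close> are the weighted covariant derivatives \<open>t\<^sub>k = \<nabla>\<^sub>k s - (\<partial>\<psi>/\<partial>z\<^sub>k) s\<close>. Since the estimate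
  bounds \<open>\<integral> |u|\<^sup>2 exp (- \<psi>)\<close> by \<open>\<integral> (B s, s) exp (- \<psi>)\<close>, the result is
  \<open>\<integral> (m n + c) |s|\<^sup>2 exp (- \<psi>) \<le> \<integral> \<Sum>\<^sub>k |t\<^sub>k|\<^sup>2 exp (- \<psi>)\<close> (\<open>adjoint_inequality\<close>).

  One integration by parts evaluates the right-hand side (\<open>bochner_identity\<close>). The commutator of the weighted
  derivative with \<open>\<partial>/\<partial>\<bar>z\<^sub>k\<close> produces the Hessian of \<open>\<psi>\<close>, which gives \<open>m n |s|\<^sup>2\<close>, and the trace of the
  curvature; since \<open>e\<close> is holomorphic, everything else contains a derivative of \<open>\<kappa>\<close>. The terms
  \<open>m n |s|\<^sup>2\<close> cancel and leave
  \<open>\<integral> \<kappa>\<^sup>2 (c |e|\<^sup>2 - tr (\<surd>-1 \<Theta> e, e)) exp (- \<psi>) \<le> \<integral> (E0 + m E1) exp (- \<psi>)\<close>, where \<open>E0\<close> and \<open>E1\<close> do not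
  depend on \<open>m\<close> and vanish near \<open>x0\<close>. If the claimed inequality failed at \<open>x0\<close>, the integrand on the left would
  be bounded below near \<open>x0\<close>, and for \<open>m \<rightarrow> \<infinity>\<close> the weight would make the left-hand side exponentially
  larger than the right-hand side (\<open>weighted_concentration\<close>). Positivity statements follow because the trace is
  the sum of the curvature form over the coordinate directions.

  Two foundations have to be laid. The curvature is defined by a definite description over all Chern
  connections, so a Chern connection must be constructed (\<open>chern_connection_exists\<close>) and the commutator of
  its parts must be shown to be tensorial; both follow from evaluating pairings with holomorphic frames
  (\<open>curvature_pairing\<close>). Smoothness of frames in all charts requires that holomorphic functions of several
  variables are smooth (\<open>smooth_on_holomorphic\<close>), which comes from Cauchy's formula on complex lines.\<close>

section \<open>Calculus of smooth functions\<close>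

lemma has_derivative_cong_open:
  assumes "open S" "x \<in> S" "\<And>y. y \<in> S \<Longrightarrow> f y = g y"
  shows "(f has_derivative F) (at x) \<longleftrightarrow> (g has_derivative F) (at x)"
  using has_derivative_transform_within_open[of f F x UNIV S g]
    has_derivative_transform_within_open[of g F x UNIV S f] assms by auto

lemma frechet_derivative_cong_open:
  assumes "open S" "x \<in> S" "\<And>y. y \<in> S \<Longrightarrow> f y = g y"
  shows "frechet_derivative f (at x) = frechet_derivative g (at x)"
  using has_derivative_cong_open[OF assms] by (simp add: frechet_derivative_def)

lemma differentiable_cong_open:
  assumes "open S" "x \<in> S" "\<And>y. y \<in> S \<Longrightarrow> f y = g y"
  shows "f differentiable (at x) \<longleftrightarrow> g differentiable (at x)"
  using has_derivative_cong_open[OF assms] by (simp add: differentiable_def)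

lemma frechet_derivative_eq: "(f has_derivative F) (at x) \<Longrightarrow> frechet_derivative f (at x) = F"
  by (metis frechet_derivative_at)

lemma has_derivative_frechet:
  "f differentiable (at x) \<Longrightarrow> (f has_derivative frechet_derivative f (at x)) (at x)"
  by (simp add: frechet_derivative_works)

lemma Ck_on_cong:
  assumes "open S" "\<And>y. y \<in> S \<Longrightarrow> f y = g y"
  shows "Ck_on k S f \<longleftrightarrow> Ck_on k S g"
  using assms(2)
proof (induction k arbitrary: f g)
  case 0
  then show ?case by (simp cong: continuous_on_cong)
next
  case (Suc k)
  have "frechet_derivative f (at x) = frechet_derivative g (at x)" if "x \<in> S" for x
    using frechet_derivative_cong_open[OF assms(1) that Suc.prems] by simp
  then have "Ck_on k S (\<lambda>x. frechet_derivative f (at x) v) =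
      Ck_on k S (\<lambda>x. frechet_derivative g (at x) v)" for v
    by (intro Suc.IH) simp
  moreover have "f differentiable (at x) \<longleftrightarrow> g differentiable (at x)" if "x \<in> S" for x
    using differentiable_cong_open[OF assms(1) that Suc.prems] by simp
  ultimately show ?case by simp
qed

lemma Ck_on_subset: "Ck_on k S f \<Longrightarrow> T \<subseteq> S \<Longrightarrow> Ck_on k T f"
  by (induction k arbitrary: f) (auto intro: continuous_on_subset)

lemma Ck_on_Suc_imp: "Ck_on (Suc k) S f \<Longrightarrow> Ck_on k S f"
proof (induction k arbitrary: f)
  case 0
  then show ?case
    by (auto intro!: continuous_at_imp_continuous_on differentiable_imp_continuous_within)
next
  case (Suc k)
  then show ?case using Ck_on.simps(2) by blast
qed

lemma Ck_on_local:
  assumes "\<And>x. x \<in> S \<Longrightarrow> \<exists>V. open V \<and> x \<in> V \<and> Ck_on k V f"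
  shows "Ck_on k S f"
  using assms
proof (induction k arbitrary: f)
  case 0
  show ?case
    unfolding Ck_on.simps
  proof (rule continuous_at_imp_continuous_on, rule ballI)
    fix x assume "x \<in> S"
    with 0 show "isCont f x" by (metis Ck_on.simps(1) continuous_on_eq_continuous_at)
  qed
next
  case (Suc k)
  have "f differentiable at x" if "x \<in> S" for x
    using Suc.prems[OF that] by auto
  moreover have "Ck_on k S (\<lambda>x. frechet_derivative f (at x) v)" for v
  proof (rule Suc.IH)
    fix x assume "x \<in> S"
    then show "\<exists>V. open V \<and> x \<in> V \<and> Ck_on k V (\<lambda>x. frechet_derivative f (at x) v)"
      using Suc.prems[of x] by auto
  qed
  ultimately show ?case by simp
qed

lemma smooth_onD: "smooth_on S f \<Longrightarrow> Ck_on k S f"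
  by (simp add: smooth_on_def)

lemma smooth_on_cong:
  "open S \<Longrightarrow> (\<And>y. y \<in> S \<Longrightarrow> f y = g y) \<Longrightarrow> smooth_on S f \<longleftrightarrow> smooth_on S g"
  using Ck_on_cong by (metis smooth_on_def)

lemma smooth_on_subset: "smooth_on S f \<Longrightarrow> T \<subseteq> S \<Longrightarrow> smooth_on T f"
  using Ck_on_subset by (metis smooth_on_def)

lemma smooth_on_local:
  "(\<And>x. x \<in> S \<Longrightarrow> \<exists>V. open V \<and> x \<in> V \<and> smooth_on V f) \<Longrightarrow> smooth_on S f"
  unfolding smooth_on_def by (meson Ck_on_local)

lemma smooth_on_continuous_on: "smooth_on S f \<Longrightarrow> continuous_on S f"
  using smooth_onD[of S f 0] by simp

lemma smooth_on_differentiable: "smooth_on S f \<Longrightarrow> x \<in> S \<Longrightarrow> f differentiable (at x)"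
  using smooth_onD[of S f "Suc 0"] by simp

lemma smooth_on_derivative: "smooth_on S f \<Longrightarrow> smooth_on S (\<lambda>x. frechet_derivative f (at x) v)"
  by (metis Ck_on.simps(2) smooth_on_def)

text \<open>A class of differentiable functions that is closed under directional derivatives consists of smooth
  functions; this is how the exponential and holomorphic functions are treated.\<close>

lemma smooth_on_coinduct:
  assumes "P f"
    and "\<And>f x. P f \<Longrightarrow> x \<in> S \<Longrightarrow> f differentiable (at x)"
    and "\<And>f v. P f \<Longrightarrow> P (\<lambda>x. frechet_derivative f (at x) v)"
  shows "smooth_on S f"
proof -
  have "Ck_on k S f" if "P f" for f k
    using that
  proof (induction k arbitrary: f)
    case 0
    then show ?case
      using assms(2) by (auto intro!: continuous_at_imp_continuous_on differentiable_imp_continuous_within)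
  next
    case (Suc k)
    then show ?case using assms(2,3) by auto
  qed
  with assms(1) show ?thesis by (simp add: smooth_on_def)
qed

lemma Ck_on_SucI:
  assumes "open S" "\<And>x. x \<in> S \<Longrightarrow> (f has_derivative f' x) (at x)"
    and "\<And>v. Ck_on k S (\<lambda>x. f' x v)"
  shows "Ck_on (Suc k) S f"
proof -
  have "Ck_on k S (\<lambda>x. frechet_derivative f (at x) v) = Ck_on k S (\<lambda>x. f' x v)" for v
    by (rule Ck_on_cong[OF assms(1)]) (simp add: frechet_derivative_eq[OF assms(2)])
  then show ?thesis using assms by (auto simp: differentiable_def)
qed

lemma Ck_on_SucD:
  assumes "Ck_on (Suc k) S f"
  shows "x \<in> S \<Longrightarrow> (f has_derivative frechet_derivative f (at x)) (at x)"
    "Ck_on k S (\<lambda>x. frechet_derivative f (at x) v)" "Ck_on k S f"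
  using assms by (auto intro: has_derivative_frechet Ck_on_Suc_imp)

lemma Ck_on_const: "Ck_on k S (\<lambda>x. c)"
  by (induction k arbitrary: c) auto

lemma Ck_on_add:
  assumes "open S"
  shows "Ck_on k S f \<Longrightarrow> Ck_on k S g \<Longrightarrow> Ck_on k S (\<lambda>x. f x + g x)"
proof (induction k arbitrary: f g)
  case (Suc k)
  note F = Ck_on_SucD[OF Suc.prems(1)] and G = Ck_on_SucD[OF Suc.prems(2)]
  show ?case
    by (rule Ck_on_SucI[OF assms has_derivative_add[OF F(1) G(1)] Suc.IH[OF F(2) G(2)]])
qed (simp add: continuous_on_add)

lemma Ck_on_bilinear:
  assumes "open S" "bounded_bilinear B"
  shows "Ck_on k S f \<Longrightarrow> Ck_on k S g \<Longrightarrow> Ck_on k S (\<lambda>x. B (f x) (g x))"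
proof (induction k arbitrary: f g)
  case (Suc k)
  note F = Ck_on_SucD[OF Suc.prems(1)] and G = Ck_on_SucD[OF Suc.prems(2)]
  show ?case
    by (rule Ck_on_SucI[OF assms(1) bounded_bilinear.FDERIV[OF assms(2) F(1) G(1)]
          Ck_on_add[OF assms(1) Suc.IH[OF F(3) G(2)] Suc.IH[OF F(2) G(3)]]])
qed (simp add: bounded_bilinear.continuous_on[OF assms(2)])

lemma Ck_on_linear_compose:
  assumes "open S" "bounded_linear L"
  shows "Ck_on k S f \<Longrightarrow> Ck_on k S (\<lambda>x. L (f x))"
proof (induction k arbitrary: f)
  case (Suc k)
  note F = Ck_on_SucD[OF Suc.prems]
  show ?case
    by (rule Ck_on_SucI[OF assms(1) bounded_linear.has_derivative[OF assms(2) F(1)] Suc.IH[OF F(2)]])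
qed (simp add: bounded_linear.continuous_on[OF assms(2)])

text \<open>The chain rule with an outer function of one real variable: cut-off functions and weights are
  smooth functions of the squared distance to a point.\<close>

lemma Ck_on_compose_real:
  fixes F :: "real \<Rightarrow> 'b::real_normed_vector" and q :: "'a::real_normed_vector \<Rightarrow> real"
  assumes "open S" "q ` S \<subseteq> R"
  shows "Ck_on k R F \<Longrightarrow> Ck_on k S q \<Longrightarrow> Ck_on k S (\<lambda>x. F (q x))"
proof (induction k arbitrary: F)
  case 0
  then show ?case using assms(2) by (auto intro: continuous_on_compose2)
next
  case (Suc k)
  note F = Ck_on_SucD[OF Suc.prems(1)] and Q = Ck_on_SucD[OF Suc.prems(2)]
  show ?case
  proof (rule Ck_on_SucI[OF assms(1)])
    fix x assume x: "x \<in> S"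
    then have F': "(F has_derivative frechet_derivative F (at (q x))) (at (q x))"
      using assms(2) by (intro F(1)) auto
    have lin: "frechet_derivative F (at (q x)) r = r *\<^sub>R frechet_derivative F (at (q x)) 1" for r
      using linear_scale[OF has_derivative_linear[OF F'], of r 1] by simp
    show "((\<lambda>x. F (q x)) has_derivative
        (\<lambda>v. frechet_derivative q (at x) v *\<^sub>R frechet_derivative F (at (q x)) 1)) (at x)"
      by (rule has_derivative_eq_rhs[OF has_derivative_compose[where f = q and g = F, OF Q(1)[OF x] F']])
         (rule ext, rule lin)
  next
    show "Ck_on k S (\<lambda>x. frechet_derivative q (at x) v *\<^sub>R frechet_derivative F (at (q x)) 1)" for v
      by (rule Ck_on_bilinear[OF assms(1) bounded_bilinear_scaleR Q(2) Suc.IH[OF F(2) Q(3)]])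
  qed
qed

lemma Ck_on_inverse:
  fixes f :: "'a::real_normed_vector \<Rightarrow> 'b::real_normed_field"
  assumes "open S" "\<And>x. x \<in> S \<Longrightarrow> f x \<noteq> 0"
  shows "Ck_on k S f \<Longrightarrow> Ck_on k S (\<lambda>x. inverse (f x))"
proof (induction k)
  case 0
  then show ?case using assms(2) by (auto intro: continuous_on_inverse)
next
  case (Suc k)
  note F = Ck_on_SucD[OF Suc.prems]
  note mult = Ck_on_bilinear[OF assms(1) bounded_bilinear_mult]
  have D: "((\<lambda>x. inverse (f x)) has_derivative
      (\<lambda>v. - (inverse (f x) * frechet_derivative f (at x) v * inverse (f x)))) (at x)" if "x \<in> S" for x
    by (rule Deriv.has_derivative_inverse[OF assms(2)[OF that] F(1)[OF that]])
  note neg = Ck_on_linear_compose[OF assms(1) bounded_linear_minus[OF bounded_linear_ident]]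
    and inv = Suc.IH[OF F(3)]
  show ?case
    by (rule Ck_on_SucI[OF assms(1) D neg[OF mult[OF mult[OF inv F(2)] inv]]])
qed

lemma smooth_on_const: "smooth_on S (\<lambda>x. c)"
  by (simp add: smooth_on_def Ck_on_const)

lemma smooth_on_add: "open S \<Longrightarrow> smooth_on S f \<Longrightarrow> smooth_on S g \<Longrightarrow> smooth_on S (\<lambda>x. f x + g x)"
  by (simp add: smooth_on_def Ck_on_add)

lemma smooth_on_bilinear:
  "bounded_bilinear B \<Longrightarrow> open S \<Longrightarrow> smooth_on S f \<Longrightarrow> smooth_on S g \<Longrightarrow> smooth_on S (\<lambda>x. B (f x) (g x))"
  by (simp add: smooth_on_def Ck_on_bilinear)

lemma smooth_on_linear_compose:
  "bounded_linear L \<Longrightarrow> open S \<Longrightarrow> smooth_on S f \<Longrightarrow> smooth_on S (\<lambda>x. L (f x))"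
  by (simp add: smooth_on_def Ck_on_linear_compose)

lemma smooth_on_ident: "open S \<Longrightarrow> smooth_on S (\<lambda>x. x)"
proof -
  assume S: "open S"
  have "Ck_on k S (\<lambda>x. x)" for k
    by (cases k) (auto simp: Ck_on_const)
  then show ?thesis by (simp add: smooth_on_def)
qed

lemma smooth_on_compose_real:
  "smooth_on R F \<Longrightarrow> open S \<Longrightarrow> smooth_on S q \<Longrightarrow> q ` S \<subseteq> R \<Longrightarrow> smooth_on S (\<lambda>x. F (q x :: real))"
  by (simp add: smooth_on_def Ck_on_compose_real)

lemma smooth_on_inverse:
  fixes f :: "'a::real_normed_vector \<Rightarrow> 'b::real_normed_field"
  shows "open S \<Longrightarrow> smooth_on S f \<Longrightarrow> (\<And>x. x \<in> S \<Longrightarrow> f x \<noteq> 0) \<Longrightarrow> smooth_on S (\<lambda>x. inverse (f x))"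
  by (simp add: smooth_on_def Ck_on_inverse)

lemmas smooth_on_mult = smooth_on_bilinear[OF bounded_bilinear_mult]
lemmas smooth_on_inner = smooth_on_bilinear[OF bounded_bilinear_inner]
lemmas smooth_on_minus = smooth_on_linear_compose[OF bounded_linear_minus[OF bounded_linear_ident]]
lemmas smooth_on_cnj = smooth_on_linear_compose[OF bounded_linear_cnj]
lemmas smooth_on_of_real = smooth_on_linear_compose[OF bounded_linear_of_real]
lemmas smooth_on_vec_nth = smooth_on_linear_compose[OF bounded_linear_vec_nth]

lemma smooth_on_diff: "open S \<Longrightarrow> smooth_on S f \<Longrightarrow> smooth_on S g \<Longrightarrow> smooth_on S (\<lambda>x. f x - g x)"
  using smooth_on_add[of S f "\<lambda>x. - g x"] smooth_on_minus[of S g] by simp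

lemma smooth_on_divide:
  fixes f g :: "'a::real_normed_vector \<Rightarrow> 'b::real_normed_field"
  shows "open S \<Longrightarrow> smooth_on S f \<Longrightarrow> smooth_on S g \<Longrightarrow> (\<And>x. x \<in> S \<Longrightarrow> g x \<noteq> 0) \<Longrightarrow>
    smooth_on S (\<lambda>x. f x / g x)"
  using smooth_on_mult[of S f "\<lambda>x. inverse (g x)"] smooth_on_inverse[of S g] by (simp add: divide_inverse)

lemma smooth_on_sum:
  "open S \<Longrightarrow> (\<And>i. i \<in> A \<Longrightarrow> smooth_on S (f i)) \<Longrightarrow> smooth_on S (\<lambda>x. \<Sum>i\<in>A. f i x)"
  by (induction A rule: infinite_finite_induct) (auto intro: smooth_on_const smooth_on_add)

lemma smooth_on_prod:
  fixes f :: "'i \<Rightarrow> 'a::real_normed_vector \<Rightarrow> 'b::{real_normed_algebra, comm_ring_1}"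
  shows "open S \<Longrightarrow> (\<And>i. i \<in> A \<Longrightarrow> smooth_on S (f i)) \<Longrightarrow> smooth_on S (\<lambda>x. \<Prod>i\<in>A. f i x)"
  by (induction A rule: infinite_finite_induct) (auto intro: smooth_on_const smooth_on_mult)

lemma smooth_on_vec:
  fixes f :: "'a::real_normed_vector \<Rightarrow> complex^'r"
  assumes "open S" "\<And>i. smooth_on S (\<lambda>x. f x $ i)"
  shows "smooth_on S f"
proof -
  have bl: "bounded_linear (\<lambda>c::complex. axis i c)" for i :: 'r
    by (auto simp: linear_conv_bounded_linear[symmetric] linear_iff vec_eq_iff axis_def)
  have "smooth_on S (\<lambda>x. \<Sum>i\<in>UNIV. axis i (f x $ i))"
    by (intro smooth_on_sum smooth_on_linear_compose[OF bl] assms)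
  moreover have "(\<Sum>i\<in>UNIV. axis i (f x $ i)) = f x" for x
    by (simp add: vec_eq_iff axis_def if_distrib cong: if_cong)
  ultimately show ?thesis by simp
qed

lemma smooth_on_exp: "smooth_on S (exp :: real \<Rightarrow> real)"
proof (rule smooth_on_coinduct[where P = "\<lambda>f. \<exists>c. f = (\<lambda>x. c * exp x)"])
  show "\<exists>c::real. exp = (\<lambda>x. c * exp x)" by (rule exI[of _ 1]) auto
next
  fix f :: "real \<Rightarrow> real" and x assume "\<exists>c. f = (\<lambda>x. c * exp x)"
  then obtain c where c: "f = (\<lambda>x. c * exp x)" by blast
  have "(f has_derivative (\<lambda>v. c * (v * exp x))) (at x)"
    unfolding c by (auto intro!: derivative_eq_intros)
  then show "f differentiable at x" by (auto simp: differentiable_def)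
next
  fix f :: "real \<Rightarrow> real" and v assume "\<exists>c. f = (\<lambda>x. c * exp x)"
  then obtain c where c: "f = (\<lambda>x. c * exp x)" by blast
  have *: "(f has_derivative (\<lambda>v. c * (v * exp x))) (at x)" for x
    unfolding c by (auto intro!: derivative_eq_intros)
  have "frechet_derivative f (at x) v = (c * v) * exp x" for x
    by (simp add: frechet_derivative_eq[OF *])
  then show "\<exists>c. (\<lambda>x. frechet_derivative f (at x) v) = (\<lambda>x. c * exp x)" by auto
qed

lemma has_derivative_along_line:
  fixes t :: real
  assumes "f differentiable (at (x + t *\<^sub>R v))"
  shows "((\<lambda>t. f (x + t *\<^sub>R v)) has_derivative (\<lambda>h. h *\<^sub>R frechet_derivative f (at (x + t *\<^sub>R v)) v)) (at t)"
proof -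
  note F = has_derivative_frechet[OF assms]
  have "((\<lambda>t. x + t *\<^sub>R v) has_derivative (\<lambda>h. h *\<^sub>R v)) (at t)"
    by (auto intro!: derivative_eq_intros)
  from has_derivative_compose[OF this F] show ?thesis
    by (rule has_derivative_eq_rhs) (simp add: linear_scale[OF has_derivative_linear[OF F], of _ v])
qed

text \<open>Schwarz: the second difference is symmetric in the two directions, and two applications of the mean
  value theorem identify it with either mixed derivative at a nearby point.\<close>

lemma second_difference_mean_value:
  fixes f :: "'a::real_normed_vector \<Rightarrow> real"
  assumes "open S" "smooth_on S f" "t > 0"
    and S: "\<And>a b. 0 \<le> a \<Longrightarrow> a \<le> t \<Longrightarrow> 0 \<le> b \<Longrightarrow> b \<le> t \<Longrightarrow> x + a *\<^sub>R v + b *\<^sub>R w \<in> S"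
  obtains a b where "0 \<le> a" "a \<le> t" "0 \<le> b" "b \<le> t"
    "f (x + t *\<^sub>R v + t *\<^sub>R w) - f (x + t *\<^sub>R v) - f (x + t *\<^sub>R w) + f x
      = t * t * frechet_derivative (\<lambda>y. frechet_derivative f (at y) v) (at (x + a *\<^sub>R v + b *\<^sub>R w)) w"
proof -
  let ?D = "\<lambda>y. frechet_derivative f (at y) v"
  have d1: "((\<lambda>a. f (x + a *\<^sub>R v + b *\<^sub>R w)) has_derivative (\<lambda>h. h * ?D (x + a *\<^sub>R v + b *\<^sub>R w))) (at a)"
    if "0 \<le> a" "a \<le> t" "0 \<le> b" "b \<le> t" for a b
    using has_derivative_along_line[of f "x + b *\<^sub>R w" a v] smooth_on_differentiable[OF assms(2) S[OF that]]
    by (simp add: add_ac)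
  have d2: "((\<lambda>b. ?D (x + a *\<^sub>R v + b *\<^sub>R w)) has_derivative (\<lambda>h. h * frechet_derivative ?D (at (x + a *\<^sub>R v + b *\<^sub>R w)) w)) (at b)"
    if "0 \<le> a" "a \<le> t" "0 \<le> b" "b \<le> t" for a b
    using has_derivative_along_line[of ?D "x + a *\<^sub>R v" b w]
      smooth_on_differentiable[OF smooth_on_derivative[OF assms(2)] S[OF that]] by simp
  let ?g = "\<lambda>a. f (x + a *\<^sub>R v + t *\<^sub>R w) - f (x + a *\<^sub>R v + 0 *\<^sub>R w)"
  have g: "(?g has_derivative (\<lambda>h. h * ?D (x + a *\<^sub>R v + t *\<^sub>R w) - h * ?D (x + a *\<^sub>R v + 0 *\<^sub>R w))) (at a within {0..t})"
    if "0 \<le> a" "a \<le> t" for a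
    by (rule has_derivative_at_withinI[OF has_derivative_diff[OF d1 d1]]) (use that assms(3) in simp_all)
  obtain a where a: "0 < a" "a < t" "?g t - ?g 0 = t * (?D (x + a *\<^sub>R v + t *\<^sub>R w) - ?D (x + a *\<^sub>R v + 0 *\<^sub>R w))"
    using mvt_simple[OF assms(3) g] by (auto simp: algebra_simps)
  let ?k = "\<lambda>b. ?D (x + a *\<^sub>R v + b *\<^sub>R w)"
  have k: "(?k has_derivative (\<lambda>h. h * frechet_derivative ?D (at (x + a *\<^sub>R v + b *\<^sub>R w)) w)) (at b within {0..t})"
    if "0 \<le> b" "b \<le> t" for b
    by (rule has_derivative_at_withinI[OF d2]) (use that a in simp_all)
  obtain b where b: "0 < b" "b < t" "?k t - ?k 0 = t * frechet_derivative ?D (at (x + a *\<^sub>R v + b *\<^sub>R w)) w"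
    using mvt_simple[OF assms(3) k] by auto
  show ?thesis
    by (rule that[of a b]) (use a b in auto)
qed

lemma mixed_derivatives_commute_real:
  fixes f :: "'a::real_normed_vector \<Rightarrow> real"
  assumes "open S" "smooth_on S f" "x \<in> S"
  shows "frechet_derivative (\<lambda>y. frechet_derivative f (at y) v) (at x) w
       = frechet_derivative (\<lambda>y. frechet_derivative f (at y) w) (at x) v"
proof -
  let ?P = "\<lambda>y. frechet_derivative (\<lambda>y. frechet_derivative f (at y) v) (at y) w"
  let ?Q = "\<lambda>y. frechet_derivative (\<lambda>y. frechet_derivative f (at y) w) (at y) v"
  have "isCont ?P x" "isCont ?Q x"
    using smooth_on_continuous_on[OF smooth_on_derivative[OF smooth_on_derivative[OF assms(2)]]] assms(1,3)
      continuous_on_eq_continuous_at by blast+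
  then have cont: "?P \<midarrow>x\<rightarrow> ?P x" "?Q \<midarrow>x\<rightarrow> ?Q x" by (auto simp: isCont_def)
  have "\<bar>?P x - ?Q x\<bar> < e" if "e > 0" for e
  proof -
    from that have "e / 2 > 0" by simp
    with \<open>isCont ?P x\<close> \<open>isCont ?Q x\<close> obtain d1 d2 where d: "d1 > 0" "d2 > 0"
      "\<And>y. dist y x < d1 \<Longrightarrow> dist (?P y) (?P x) < e / 2"
      "\<And>y. dist y x < d2 \<Longrightarrow> dist (?Q y) (?Q x) < e / 2"
      unfolding continuous_at_eps_delta by metis
    obtain d3 where d3: "d3 > 0" "ball x d3 \<subseteq> S" using assms(1,3) open_contains_ball by blast
    define d0 where "d0 = min d1 (min d2 d3)"
    have d0: "d0 > 0" "d0 \<le> d1" "d0 \<le> d2" "d0 \<le> d3" using d d3 by (auto simp: d0_def)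
    \<comment> \<open>The side \<open>t\<close> of the parallelogram keeps it inside the ball of radius \<open>d0\<close>.\<close>
    define M where "M = norm v + norm w + 1"
    define t where "t = d0 / (2 * M)"
    have pos: "M > 0" by (simp add: M_def add_nonneg_pos)
    have t: "t > 0" using d0(1) pos by (simp add: t_def)
    have near: "dist (x + a *\<^sub>R v + b *\<^sub>R w) x < d0" if "0 \<le> a" "a \<le> t" "0 \<le> b" "b \<le> t" for a b
    proof -
      have "dist (x + a *\<^sub>R v + b *\<^sub>R w) x = norm (a *\<^sub>R v + b *\<^sub>R w)" by (simp add: dist_norm add.assoc)
      also have "\<dots> \<le> a * norm v + b * norm w" using that by (metis abs_of_nonneg norm_scaleR norm_triangle_ineq)
      also have "\<dots> \<le> t * norm v + t * norm w" using that by (intro add_mono mult_right_mono) auto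
      also have "\<dots> < 2 * (t * M)"
      proof -
        have "0 \<le> t * norm v" "0 \<le> t * norm w" using t by simp_all
        then show ?thesis using t unfolding M_def distrib_left mult_1_right by linarith
      qed
      also have "\<dots> = d0" using pos by (simp add: t_def)
      finally show ?thesis .
    qed
    obtain a b where ab: "0 \<le> a" "a \<le> t" "0 \<le> b" "b \<le> t"
      "f (x + t *\<^sub>R v + t *\<^sub>R w) - f (x + t *\<^sub>R v) - f (x + t *\<^sub>R w) + f x = t * t * ?P (x + a *\<^sub>R v + b *\<^sub>R w)"
      using near d3(2) d0(4) by (rule_tac second_difference_mean_value[OF assms(1,2) t, of x v w])
        (fastforce simp: dist_commute)+
    obtain a' b' where ab': "0 \<le> a'" "a' \<le> t" "0 \<le> b'" "b' \<le> t"
      "f (x + t *\<^sub>R w + t *\<^sub>R v) - f (x + t *\<^sub>R w) - f (x + t *\<^sub>R v) + f x = t * t * ?Q (x + a' *\<^sub>R w + b' *\<^sub>R v)"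
    proof (rule second_difference_mean_value[OF assms(1,2) t, of x w v])
      fix a b assume "0 \<le> a" "a \<le> t" "0 \<le> b" "b \<le> t"
      then have "dist (x + b *\<^sub>R v + a *\<^sub>R w) x < d0" by (intro near)
      then show "x + a *\<^sub>R w + b *\<^sub>R v \<in> S" using d3(2) d0(4) by (force simp: dist_commute algebra_simps)
    qed
    have "t * t * ?P (x + a *\<^sub>R v + b *\<^sub>R w) = t * t * ?Q (x + b' *\<^sub>R v + a' *\<^sub>R w)"
      using ab(5) ab'(5) by (simp add: algebra_simps)
    then have "?P (x + a *\<^sub>R v + b *\<^sub>R w) = ?Q (x + b' *\<^sub>R v + a' *\<^sub>R w)" using t by simp
    moreover have "dist (?P (x + a *\<^sub>R v + b *\<^sub>R w)) (?P x) < e / 2"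
      using near[OF ab(1-4)] d0 by (intro d) simp
    moreover have "dist (?Q (x + b' *\<^sub>R v + a' *\<^sub>R w)) (?Q x) < e / 2"
      using near[OF ab'(3,4,1,2)] d0 by (intro d) simp
    ultimately show ?thesis unfolding dist_real_def by argo
  qed
  then show ?thesis by (metis abs_0 eq_iff_diff_eq_0 less_irrefl zero_less_abs_iff)
qed

lemma frechet_derivative_linear_compose:
  assumes "bounded_linear L" "f differentiable (at x)"
  shows "frechet_derivative (\<lambda>x. L (f x)) (at x) v = L (frechet_derivative f (at x) v)"
  by (subst frechet_derivative_eq[OF bounded_linear.has_derivative[OF assms(1) has_derivative_frechet[OF assms(2)]]]) simp

lemma mixed_derivatives_commute:
  fixes f :: "'a::real_normed_vector \<Rightarrow> 'b::euclidean_space"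
  assumes "open S" "smooth_on S f" "x \<in> S"
  shows "frechet_derivative (\<lambda>y. frechet_derivative f (at y) v) (at x) w
       = frechet_derivative (\<lambda>y. frechet_derivative f (at y) w) (at x) v"
proof (rule euclidean_eqI)
  fix i :: 'b
  have bl: "bounded_linear (\<lambda>y::'b. y \<bullet> i)" by (rule bounded_linear_inner_left)
  have *: "frechet_derivative (\<lambda>y. frechet_derivative f (at y) v) (at x) w \<bullet> i
     = frechet_derivative (\<lambda>y. frechet_derivative (\<lambda>z. f z \<bullet> i) (at y) v) (at x) w" for v w
  proof -
    have "frechet_derivative (\<lambda>y. frechet_derivative (\<lambda>z. f z \<bullet> i) (at y) v) (at x)
       = frechet_derivative (\<lambda>y. frechet_derivative f (at y) v \<bullet> i) (at x)"
      by (rule frechet_derivative_cong_open[OF assms(1,3)])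
         (simp add: frechet_derivative_linear_compose[OF bl] smooth_on_differentiable[OF assms(2)])
    then show ?thesis
      by (simp add: frechet_derivative_linear_compose[OF bl]
           smooth_on_differentiable[OF smooth_on_derivative[OF assms(2)]] assms(3))
  qed
  show "frechet_derivative (\<lambda>y. frechet_derivative f (at y) v) (at x) w \<bullet> i
       = frechet_derivative (\<lambda>y. frechet_derivative f (at y) w) (at x) v \<bullet> i"
    unfolding * by (rule mixed_derivatives_commute_real[OF assms(1) smooth_on_linear_compose[OF bl assms(1,2)] assms(3)])
qed

section \<open>Wirtinger derivatives\<close>

lemma dz_eq:
  "(f has_derivative F) (at x) \<Longrightarrow> dz j f x = (F (axis j 1) - \<i> * F (axis j \<i>)) / 2"
  by (simp add: dz_def frechet_derivative_eq)

lemma dzbar_eq: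
  "(f has_derivative F) (at x) \<Longrightarrow> dzbar j f x = (F (axis j 1) + \<i> * F (axis j \<i>)) / 2"
  by (simp add: dzbar_def frechet_derivative_eq)

lemma dz_cong_open:
  "open S \<Longrightarrow> x \<in> S \<Longrightarrow> (\<And>y. y \<in> S \<Longrightarrow> f y = g y) \<Longrightarrow> dz j f x = dz j g x"
  using frechet_derivative_cong_open[of S x f g] unfolding dz_def by presburger

lemma dzbar_cong_open:
  "open S \<Longrightarrow> x \<in> S \<Longrightarrow> (\<And>y. y \<in> S \<Longrightarrow> f y = g y) \<Longrightarrow> dzbar j f x = dzbar j g x"
  using frechet_derivative_cong_open[of S x f g] unfolding dzbar_def by presburger

lemma dz_const [simp]: "dz j (\<lambda>y. c) x = 0" and dzbar_const [simp]: "dzbar j (\<lambda>y. c) x = 0"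
  by (simp_all add: dz_def dzbar_def)

lemma
  assumes "f differentiable (at x)" "g differentiable (at x)"
  shows dz_add: "dz j (\<lambda>y. f y + g y) x = dz j f x + dz j g x"
    and dzbar_add: "dzbar j (\<lambda>y. f y + g y) x = dzbar j f x + dzbar j g x"
    and dz_mult: "dz j (\<lambda>y. f y * g y) x = dz j f x * g x + f x * dz j g x"
    and dzbar_mult: "dzbar j (\<lambda>y. f y * g y) x = dzbar j f x * g x + f x * dzbar j g x"
proof -
  note F = has_derivative_frechet[OF assms(1)] and G = has_derivative_frechet[OF assms(2)]
  show "dz j (\<lambda>y. f y + g y) x = dz j f x + dz j g x"
    "dzbar j (\<lambda>y. f y + g y) x = dzbar j f x + dzbar j g x"
    unfolding dz_eq[OF has_derivative_add[OF F G]] dzbar_eq[OF has_derivative_add[OF F G]]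
    by (simp_all add: dz_def dzbar_def field_simps)
  show "dz j (\<lambda>y. f y * g y) x = dz j f x * g x + f x * dz j g x"
    "dzbar j (\<lambda>y. f y * g y) x = dzbar j f x * g x + f x * dzbar j g x"
    unfolding dz_eq[OF has_derivative_mult[OF F G]] dzbar_eq[OF has_derivative_mult[OF F G]]
    by (simp_all add: dz_def dzbar_def field_simps)
qed

lemma
  assumes "f differentiable (at x)"
  shows dz_cnj: "dz j (\<lambda>y. cnj (f y)) x = cnj (dzbar j f x)"
    and dzbar_cnj: "dzbar j (\<lambda>y. cnj (f y)) x = cnj (dz j f x)"
  using frechet_derivative_linear_compose[OF bounded_linear_cnj assms]
  by (simp_all add: dz_def dzbar_def)

lemma
  assumes "\<And>i. i \<in> A \<Longrightarrow> f i differentiable (at x)"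
  shows dz_sum: "dz j (\<lambda>y. \<Sum>i\<in>A. f i y) x = (\<Sum>i\<in>A. dz j (f i) x)"
    and dzbar_sum: "dzbar j (\<lambda>y. \<Sum>i\<in>A. f i y) x = (\<Sum>i\<in>A. dzbar j (f i) x)"
proof -
  note D = has_derivative_sum[of A f, OF has_derivative_frechet[OF assms]]
  show "dz j (\<lambda>y. \<Sum>i\<in>A. f i y) x = (\<Sum>i\<in>A. dz j (f i) x)"
    "dzbar j (\<lambda>y. \<Sum>i\<in>A. f i y) x = (\<Sum>i\<in>A. dzbar j (f i) x)"
    by (subst dz_eq[OF D] dzbar_eq[OF D]; simp add: dz_def dzbar_def sum_subtractf sum.distrib
        sum_distrib_left sum_divide_distrib diff_divide_distrib add_divide_distrib)+
qed

lemma smooth_on_dz: "open S \<Longrightarrow> smooth_on S f \<Longrightarrow> smooth_on S (dz j f)"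
proof -
  assume "open S" "smooth_on S f"
  then have "smooth_on S (\<lambda>x. (1/2) * (frechet_derivative f (at x) (axis j 1) - \<i> * frechet_derivative f (at x) (axis j \<i>)))"
    by (intro smooth_on_mult smooth_on_diff smooth_on_const smooth_on_derivative)
  then show "smooth_on S (dz j f)" by (simp add: dz_def[abs_def])
qed

lemma smooth_on_dzbar: "open S \<Longrightarrow> smooth_on S f \<Longrightarrow> smooth_on S (dzbar j f)"
proof -
  assume "open S" "smooth_on S f"
  then have "smooth_on S (\<lambda>x. (1/2) * (frechet_derivative f (at x) (axis j 1) + \<i> * frechet_derivative f (at x) (axis j \<i>)))"
    by (intro smooth_on_mult smooth_on_add smooth_on_const smooth_on_derivative)
  then show "smooth_on S (dzbar j f)" by (simp add: dzbar_def[abs_def])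
qed

lemma dz_dzbar_commute:
  assumes S: "open S" "x \<in> S" and f: "smooth_on S f"
  shows "dz j (dzbar k f) x = dzbar k (dz j f) x"
proof -
  let ?D = "\<lambda>v y. frechet_derivative f (at y) v"
  have d: "?D v differentiable at x" for v
    using smooth_on_differentiable[OF smooth_on_derivative[OF f] S(2)] .
  have F: "((\<lambda>y. (?D v y + c * ?D w y) / 2) has_derivative
      (\<lambda>u. (frechet_derivative (?D v) (at x) u + c * frechet_derivative (?D w) (at x) u) / 2)) (at x)" for v w c
    using has_derivative_frechet[OF d] by (auto intro!: derivative_eq_intros)
  have c: "frechet_derivative (?D v) (at x) w = frechet_derivative (?D w) (at x) v" for v w
    by (rule mixed_derivatives_commute[OF S(1) f S(2)])
  have dzj: "dz j f = (\<lambda>y. (?D (axis j 1) y + (- \<i>) * ?D (axis j \<i>) y) / 2)"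
    and dzbark: "dzbar k f = (\<lambda>y. (?D (axis k 1) y + \<i> * ?D (axis k \<i>) y) / 2)"
    by (simp_all add: fun_eq_iff dz_def dzbar_def)
  show ?thesis
    unfolding dzj dzbark dz_eq[OF F] dzbar_eq[OF F] c[of "axis k _" "axis j _"]
    by (simp add: field_simps)
qed

lemma
  fixes q :: "complex^'n \<Rightarrow> real"
  assumes "q differentiable (at x)"
  shows dz_exp: "dz j (\<lambda>y. complex_of_real (exp (- q y))) x
      = - dz j (\<lambda>y. complex_of_real (q y)) x * complex_of_real (exp (- q x))"
    and dzbar_exp: "dzbar j (\<lambda>y. complex_of_real (exp (- q y))) x
      = - dzbar j (\<lambda>y. complex_of_real (q y)) x * complex_of_real (exp (- q x))"
proof -
  note Q = has_derivative_frechet[OF assms]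
  have 1: "((\<lambda>y. complex_of_real (exp (- q y))) has_derivative
      (\<lambda>v. complex_of_real (- frechet_derivative q (at x) v * exp (- q x)))) (at x)"
    by (rule bounded_linear.has_derivative[OF bounded_linear_of_real])
       (auto intro!: derivative_eq_intros Q)
  have 2: "((\<lambda>y. complex_of_real (q y)) has_derivative (\<lambda>v. complex_of_real (frechet_derivative q (at x) v))) (at x)"
    by (rule bounded_linear.has_derivative[OF bounded_linear_of_real Q])
  show "dz j (\<lambda>y. complex_of_real (exp (- q y))) x
      = - dz j (\<lambda>y. complex_of_real (q y)) x * complex_of_real (exp (- q x))"
    "dzbar j (\<lambda>y. complex_of_real (exp (- q y))) x
      = - dzbar j (\<lambda>y. complex_of_real (q y)) x * complex_of_real (exp (- q x))"
    unfolding dz_eq[OF 1] dz_eq[OF 2] dzbar_eq[OF 1] dzbar_eq[OF 2] by (simp_all add: field_simps)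
qed

subsection \<open>The weight\<close>

text \<open>The weights are multiples of the squared distance to a fixed point. Their complex Hessian is a multiple
  of the identity, so that the curvature operator of the weight becomes multiplication by a constant, and
  they concentrate mass at the point.\<close>

definition sq_dist :: "complex^'n \<Rightarrow> complex^'n \<Rightarrow> real" where
  "sq_dist a z = (z - a) \<bullet> (z - a)"

lemma sq_dist_norm: "sq_dist a z = (norm (z - a))\<^sup>2"
  by (simp add: sq_dist_def power2_norm_eq_inner)

lemma smooth_on_sq_dist: "open S \<Longrightarrow> smooth_on S (sq_dist a)"
  unfolding sq_dist_def[abs_def] by (intro smooth_on_inner smooth_on_diff smooth_on_ident smooth_on_const)

lemma
  fixes m :: real and a x :: "complex^'n"
  shows dz_sq_dist: "dz j (\<lambda>z. complex_of_real (m * sq_dist a z)) x = m * cnj (x $ j - a $ j)"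
    and dzbar_sq_dist: "dzbar j (\<lambda>z. complex_of_real (m * sq_dist a z)) x = m * (x $ j - a $ j)"
proof -
  have D: "((\<lambda>z. complex_of_real (m * sq_dist a z)) has_derivative (\<lambda>v. complex_of_real (m * (2 * ((x - a) \<bullet> v))))) (at x)"
    unfolding sq_dist_def
    by (rule bounded_linear.has_derivative[OF bounded_linear_of_real])
       (auto intro!: derivative_eq_intros simp: inner_commute)
  have i: "v \<bullet> axis j c = v $ j \<bullet> c" for v :: "complex^'n" and c
    by (simp add: inner_axis)
  show "dz j (\<lambda>z. complex_of_real (m * sq_dist a z)) x = m * cnj (x $ j - a $ j)"
    "dzbar j (\<lambda>z. complex_of_real (m * sq_dist a z)) x = m * (x $ j - a $ j)"
    unfolding dz_eq[OF D] dzbar_eq[OF D] i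
    by (auto simp: complex_eq_iff inner_complex_def field_simps)
qed

lemma complex_hessian_sq_dist:
  fixes m :: real and a x :: "complex^'n"
  shows "complex_hessian (\<lambda>z. m * sq_dist a z) x j k = (if j = k then complex_of_real m else 0)"
proof -
  have D: "((\<lambda>z. complex_of_real m * (z $ k - a $ k)) has_derivative (\<lambda>v. complex_of_real m * v $ k)) (at x)"
    by (auto intro!: derivative_eq_intros bounded_linear_imp_has_derivative bounded_linear_vec_nth)
  show ?thesis
    unfolding complex_hessian_def dzbar_sq_dist[abs_def] dz_eq[OF D]
    by (auto simp: axis_def mult.left_commute[of \<i>])
qed

lemma strictly_psh_sq_dist:
  fixes m :: real and a :: "complex^'n"
  assumes "m > 0" "open D"
  shows "smooth_strictly_psh_on D (\<lambda>z. m * sq_dist a z)"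
proof -
  have "0 < Re (\<Sum>j\<in>UNIV. \<Sum>k\<in>UNIV. complex_hessian (\<lambda>z. m * sq_dist a z) x j k * v $ j * cnj (v $ k))"
    if "v \<noteq> 0" for x v :: "complex^'n"
  proof -
    have "(\<Sum>j\<in>UNIV. \<Sum>k\<in>UNIV. complex_hessian (\<lambda>z. m * sq_dist a z) x j k * v $ j * cnj (v $ k))
       = (\<Sum>j\<in>UNIV. complex_of_real (m * (norm (v $ j))\<^sup>2))"
      by (simp add: complex_hessian_sq_dist if_distrib if_distribR cong: if_cong)
         (simp add: mult.assoc complex_norm_square[symmetric])
    also have "Re \<dots> = m * (\<Sum>j\<in>UNIV. (norm (v $ j))\<^sup>2)" by (simp add: sum_distrib_left)
    also have "(\<Sum>j\<in>UNIV. (norm (v $ j))\<^sup>2) = (norm v)\<^sup>2"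
      by (simp add: norm_vec_def L2_set_def sum_nonneg)
    finally show ?thesis using that assms by simp
  qed
  moreover have "smooth_on D (\<lambda>z. m * sq_dist a z)"
    by (intro smooth_on_mult smooth_on_const smooth_on_sq_dist assms)
  ultimately show ?thesis by (simp add: smooth_strictly_psh_on_def)
qed

section \<open>Cut-off functions\<close>

text \<open>The functions \<open>t\<^sup>-\<^sup>k exp (- 1/t)\<close>, extended by zero, span a space that is closed under
  differentiation. This gives the smoothness of the classical flat function, the case \<open>k = 0\<close>.\<close>

definition flat_exp :: "nat \<Rightarrow> real \<Rightarrow> real" where
  "flat_exp k t = (if t \<le> 0 then 0 else inverse t ^ k * exp (- inverse t))"

lemma flat_exp_tendsto_0: "(flat_exp k \<longlongrightarrow> 0) (at 0)"
proof -
  have "((\<lambda>y. y ^ k / exp y) \<longlongrightarrow> (0::real)) at_top" by (rule tendsto_power_div_exp_0)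
  then have "((\<lambda>t. inverse t ^ k / exp (inverse t)) \<longlongrightarrow> (0::real)) (at_right 0)"
    by (rule filterlim_compose[OF _ filterlim_inverse_at_top_right])
  moreover have "eventually (\<lambda>t. inverse t ^ k / exp (inverse t) = flat_exp k t) (at_right 0)"
    by (auto simp: eventually_at_filter flat_exp_def exp_minus divide_inverse)
  ultimately have "(flat_exp k \<longlongrightarrow> 0) (at_right 0)" by (rule Lim_transform_eventually)
  moreover have "(flat_exp k \<longlongrightarrow> 0) (at_left 0)"
    by (rule tendsto_eventually) (auto simp: eventually_at_filter flat_exp_def)
  ultimately show ?thesis by (simp add: filterlim_split_at)
qed

lemma flat_exp_derivative:
  "(flat_exp k has_real_derivative (flat_exp (k + 2) t - real k * flat_exp (k + 1) t)) (at t)"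
proof -
  consider "t < 0" | "t = 0" | "t > 0" by linarith
  then show ?thesis
  proof cases
    case 1
    have "((\<lambda>t. 0) has_real_derivative 0) (at t)" by simp
    moreover have "flat_exp (k + 2) t - real k * flat_exp (k + 1) t = 0" using 1 by (simp add: flat_exp_def)
    ultimately have "((\<lambda>t. 0) has_real_derivative (flat_exp (k + 2) t - real k * flat_exp (k + 1) t)) (at t)" by simp
    then show ?thesis
      by (rule has_field_derivative_transform_within_open[of _ _ _ "{..<0}"]) (use 1 in \<open>auto simp: flat_exp_def\<close>)
  next
    case 2
    have "(flat_exp (k + 1) \<longlongrightarrow> 0) (at 0)" by (rule flat_exp_tendsto_0)
    moreover have "eventually (\<lambda>h. flat_exp (k + 1) h = (flat_exp k (0 + h) - flat_exp k 0) / h) (at 0)"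
      by (auto simp: eventually_at_filter flat_exp_def divide_inverse)
    ultimately have "((\<lambda>h. (flat_exp k (0 + h) - flat_exp k 0) / h) \<longlongrightarrow> 0) (at 0)"
      by (rule Lim_transform_eventually)
    then show ?thesis using 2 by (simp add: DERIV_def flat_exp_def)
  next
    case 3
    have "((\<lambda>t. inverse t ^ k * exp (- inverse t)) has_real_derivative
        (flat_exp (k + 2) t - real k * flat_exp (k + 1) t)) (at t)"
    proof -
      have "((\<lambda>t. inverse t ^ k * exp (- inverse t)) has_real_derivative
          (real k * (- (inverse t ^ 2) * inverse t ^ (k - 1))) * exp (- inverse t)
          + inverse t ^ k * (inverse t ^ 2 * exp (- inverse t))) (at t)"
        using 3 by (auto intro!: derivative_eq_intros simp: power2_eq_square)
      moreover have "(real k * (- (inverse t ^ 2) * inverse t ^ (k - 1))) * exp (- inverse t)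
          + inverse t ^ k * (inverse t ^ 2 * exp (- inverse t)) = flat_exp (k + 2) t - real k * flat_exp (k + 1) t"
        using 3 by (cases k) (simp_all add: flat_exp_def power2_eq_square algebra_simps)
      ultimately show ?thesis by simp
    qed
    then show ?thesis
      by (rule has_field_derivative_transform_within_open[of _ _ _ "{0<..}"]) (use 3 in \<open>auto simp: flat_exp_def\<close>)
  qed
qed

lemma smooth_on_flat_exp: "smooth_on UNIV (flat_exp k)"
proof -
  have "Ck_on n UNIV (flat_exp k)" for n
  proof (induction n arbitrary: k)
    case 0
    have "isCont (flat_exp k) t" for t by (rule DERIV_isCont[OF flat_exp_derivative])
    then show ?case by (simp add: continuous_at_imp_continuous_on)
  next
    case (Suc n)
    have D: "(flat_exp k has_derivative (\<lambda>v. v * (flat_exp (k + 2) t - real k * flat_exp (k + 1) t))) (at t)" for t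
      using flat_exp_derivative[of k t] unfolding has_field_derivative_def
      by (rule has_derivative_eq_rhs) (simp add: fun_eq_iff)
    have "Ck_on n UNIV (\<lambda>t. v * (flat_exp (k + 2) t + (- real k) * flat_exp (k + 1) t))" for v
      by (intro Ck_on_bilinear[OF _ bounded_bilinear_mult] Ck_on_add Ck_on_const Suc.IH open_UNIV)
    then show ?case by (intro Ck_on_SucI[OF open_UNIV D]) simp
  qed
  then show ?thesis by (simp add: smooth_on_def)
qed

text \<open>The quotient \<open>g (R\<^sup>2 - t) / (g (R\<^sup>2 - t) + g (t - r\<^sup>2))\<close> of flat functions, evaluated at the squared
  distance, is the cut-off function; the denominator is positive because \<open>r < R\<close>.\<close>

lemma smooth_cutoff:
  fixes x0 :: "complex^'n"
  assumes "0 < r" "r < R"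
  obtains \<kappa> :: "complex^'n \<Rightarrow> real" where "smooth_on UNIV \<kappa>" "\<And>x. x \<in> ball x0 r \<Longrightarrow> \<kappa> x = 1"
    "\<And>x. x \<notin> cball x0 R \<Longrightarrow> \<kappa> x = 0"
proof -
  define d where "d t = flat_exp 0 (R\<^sup>2 - t) + flat_exp 0 (t - r\<^sup>2)" for t
  define F where "F t = flat_exp 0 (R\<^sup>2 - t) / d t" for t
  have less: "r\<^sup>2 < R\<^sup>2" using assms by (simp add: power_strict_mono)
  have d: "d t > 0" for t
  proof -
    have "R\<^sup>2 - t > 0 \<or> t - r\<^sup>2 > 0" using less by linarith
    then show ?thesis by (auto simp: d_def flat_exp_def intro: add_pos_pos add_nonneg_pos add_pos_nonneg)
  qed
  have 1: "smooth_on UNIV (\<lambda>t. flat_exp 0 (R\<^sup>2 - t))" "smooth_on UNIV (\<lambda>t. flat_exp 0 (t - r\<^sup>2))"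
    by (intro smooth_on_compose_real[OF smooth_on_flat_exp] smooth_on_diff smooth_on_const smooth_on_ident; simp)+
  then have "smooth_on UNIV F"
    unfolding F_def[abs_def] d_def using d less_imp_neq[OF d] by (intro smooth_on_divide smooth_on_add) (auto simp: d_def)
  then have "smooth_on UNIV (\<lambda>x. F (sq_dist x0 x))"
    by (rule smooth_on_compose_real) (auto intro: smooth_on_sq_dist)
  moreover have "F (sq_dist x0 x) = 1" if "x \<in> ball x0 r" for x
  proof -
    have "norm (x - x0) < r" using that by (simp add: dist_norm norm_minus_commute)
    then have "sq_dist x0 x < r\<^sup>2" by (simp add: sq_dist_norm power_strict_mono)
    then have "flat_exp 0 (sq_dist x0 x - r\<^sup>2) = 0" by (simp add: flat_exp_def)
    then show ?thesis using d[of "sq_dist x0 x"] by (simp add: F_def d_def)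
  qed
  moreover have "F (sq_dist x0 x) = 0" if "x \<notin> cball x0 R" for x
  proof -
    have "R < norm (x - x0)" using that by (simp add: dist_norm norm_minus_commute)
    then have "R\<^sup>2 < sq_dist x0 x" using assms by (simp add: sq_dist_norm power_strict_mono)
    then show ?thesis by (simp add: F_def flat_exp_def)
  qed
  ultimately show ?thesis using that by blast
qed

lemma smooth_on_zero_extension:
  fixes f :: "'a::real_normed_vector \<Rightarrow> 'b::real_normed_vector"
  assumes "open U" "closed K" "K \<subseteq> U" "smooth_on U f" "\<And>x. x \<in> U - K \<Longrightarrow> f x = 0"
  shows "smooth_on UNIV (\<lambda>x. if x \<in> U then f x else 0)"
proof (rule smooth_on_local)
  fix x :: 'a
  show "\<exists>V. open V \<and> x \<in> V \<and> smooth_on V (\<lambda>x. if x \<in> U then f x else 0)"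
  proof (cases "x \<in> U")
    case True
    have "smooth_on U (\<lambda>x. if x \<in> U then f x else 0)"
      using smooth_on_cong[of U "\<lambda>x. if x \<in> U then f x else 0" f] assms by simp
    with True assms show ?thesis by blast
  next
    case False
    have "smooth_on (- K) (\<lambda>x. if x \<in> U then f x else 0)"
      using smooth_on_cong[of "-K" "\<lambda>x. if x \<in> U then f x else 0" "\<lambda>x. 0"] assms
      by (auto simp: open_Compl smooth_on_const)
    with False assms show ?thesis by (intro exI[of _ "- K"]) auto
  qed
qed

section \<open>Integration by parts\<close>

lemma integrable_compact_support:
  fixes f :: "'a::euclidean_space \<Rightarrow> 'b::{banach, second_countable_topology}"
  assumes "continuous_on UNIV f" "compact K" "\<And>x. x \<notin> K \<Longrightarrow> f x = 0"
  shows "integrable lborel f" "integrable lebesgue f"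
proof -
  have "integrable lborel (\<lambda>x. indicator K x *\<^sub>R f x)"
    using assms by (intro borel_integrable_compact) (auto intro: continuous_on_subset)
  moreover have "(\<lambda>x. indicator K x *\<^sub>R f x) = f" using assms(3) by (auto simp: indicator_def)
  ultimately show 1: "integrable lborel f" by simp
  then have "f \<in> borel_measurable lborel" by auto
  with 1 show "integrable lebesgue f" by (simp add: integrable_completion)
qed

lemma lborel_integral_translate:
  fixes f :: "'a::euclidean_space \<Rightarrow> 'b::{banach, second_countable_topology}"
  assumes "f \<in> borel_measurable borel"
  shows "(LINT x|lborel. f (x + v)) = (LINT x|lborel. f x)"
proof -
  have "(LINT x|lborel. f x) = (LINT x|distr lborel borel ((+) v). f x)" by (simp add: lborel_distr_plus)
  also have "\<dots> = (LINT x|lborel. f (v + x))" by (rule integral_distr) (use assms in auto)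
  finally show ?thesis by (simp add: add.commute)
qed

text \<open>Difference quotients of a compactly supported function have integral zero by translation
  invariance, and they converge boundedly to the derivative.\<close>

lemma integral_derivative_compact_support:
  fixes f :: "'a::euclidean_space \<Rightarrow> complex"
  assumes f: "smooth_on UNIV f" and K: "compact K" "\<And>x. x \<notin> K \<Longrightarrow> f x = 0"
  shows "(LINT x|lebesgue. frechet_derivative f (at x) v) = 0"
proof -
  define D where "D x = frechet_derivative f (at x) v" for x
  have contf: "continuous_on UNIV f" by (rule smooth_on_continuous_on[OF f])
  have contD: "continuous_on UNIV D"
    unfolding D_def[abs_def] by (rule smooth_on_continuous_on[OF smooth_on_derivative[OF f]])
  have D0: "D x = 0" if "x \<notin> K" for x
  proof -
    have "frechet_derivative f (at x) = frechet_derivative (\<lambda>x. 0) (at x)"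
      by (rule frechet_derivative_cong_open[of "- K"]) (use K that in \<open>auto simp: open_Compl compact_imp_closed\<close>)
    then show ?thesis by (simp add: D_def)
  qed
  have "bounded (D ` K)" using K(1) contD by (intro compact_imp_bounded compact_continuous_image) (auto intro: continuous_on_subset)
  then obtain B0 where B0: "\<And>x. x \<in> K \<Longrightarrow> norm (D x) \<le> B0" by (auto simp: bounded_iff)
  define B where "B = max 0 B0"
  have B: "norm (D x) \<le> B" for x using B0[of x] D0[of x] by (cases "x \<in> K") (auto simp: B_def)
  obtain R where R: "\<And>x. x \<in> K \<Longrightarrow> norm x \<le> R" using compact_imp_bounded[OF K(1)] by (auto simp: bounded_iff)
  define s where "s n x = real (Suc n) *\<^sub>R (f (x + (1 / real (Suc n)) *\<^sub>R v) - f x)" for n x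
  have bound: "norm (s n x) \<le> B" for n x
  proof -
    have der: "((\<lambda>t. f (x + t *\<^sub>R v)) has_derivative (\<lambda>h. h *\<^sub>R D (x + t *\<^sub>R v))) (at t within UNIV)" for t
      unfolding D_def by (rule has_derivative_along_line[OF smooth_on_differentiable[OF f UNIV_I]])
    have "onorm (\<lambda>h. h *\<^sub>R D (x + t *\<^sub>R v)) \<le> B" for t
      by (rule onorm_le) (use mult_left_mono[OF B abs_ge_zero] in \<open>simp add: mult.commute[of B]\<close>)
    then have "norm (f (x + (1 / real (Suc n)) *\<^sub>R v) - f (x + 0 *\<^sub>R v)) \<le> B * norm (1 / real (Suc n) - 0)"
      by (intro differentiable_bound[OF convex_UNIV der]) auto
    then have "real (Suc n) * norm (f (x + (1 / real (Suc n)) *\<^sub>R v) - f x) \<le> real (Suc n) * (B * (1 / real (Suc n)))"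
      by (intro mult_left_mono) simp_all
    then show ?thesis by (simp only: s_def norm_scaleR abs_of_nat) simp
  qed
  have supp: "s n x = 0" if "x \<notin> cball 0 (R + norm v)" for n x
  proof -
    from that have *: "norm x > R + norm v" by simp
    have "norm ((1 / real (Suc n)) *\<^sub>R v) \<le> norm v"
      by (simp add: divide_le_eq mult_le_cancel_left1)
    then have "norm (x + (1 / real (Suc n)) *\<^sub>R v) > R"
      using * norm_diff_ineq[of x "(1 / real (Suc n)) *\<^sub>R v"] by linarith
    moreover have "norm x > R" using * norm_ge_zero[of v] by linarith
    ultimately show ?thesis using R K(2) by (simp add: s_def) (metis less_le_not_le)
  qed
  have lim: "(\<lambda>n. s n x) \<longlonglongrightarrow> D x" for x
  proof (rule LIMSEQ_I)
    fix e :: real assume e: "e > 0"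
    have F: "(f has_derivative frechet_derivative f (at x)) (at x)"
      using smooth_on_differentiable[OF f UNIV_I] by (rule has_derivative_frechet)
    define e' where "e' = e / (norm v + 1)"
    have nv: "norm v + 1 > 0" by (simp add: add_nonneg_pos)
    then have "e' > 0" using e by (simp add: e'_def)
    then obtain d where d: "d > 0" "\<And>y. norm (y - x) < d \<Longrightarrow> norm (f y - f x - frechet_derivative f (at x) (y - x)) \<le> e' * norm (y - x)"
      using F unfolding has_derivative_at_alt by blast
    obtain N where N: "norm v / d < real N" using reals_Archimedean2 by blast
    show "\<exists>N. \<forall>n\<ge>N. norm (s n x - D x) < e"
    proof (intro exI allI impI)
      fix n assume n: "N \<le> n"
      let ?h = "1 / real (Suc n)"
      have "norm v < d * real (Suc n)" using N n d(1) by (simp add: divide_less_eq mult.commute) (smt (verit) mult_left_mono of_nat_mono)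
      then have "norm (?h *\<^sub>R v) < d" by (simp add: divide_less_eq)
      with d(2)[of "x + ?h *\<^sub>R v"]
      have "norm (f (x + ?h *\<^sub>R v) - f x - frechet_derivative f (at x) (?h *\<^sub>R v)) \<le> e' * norm (?h *\<^sub>R v)" by simp
      moreover have "frechet_derivative f (at x) (?h *\<^sub>R v) = ?h *\<^sub>R D x"
        unfolding D_def by (rule linear_scale[OF has_derivative_linear[OF F]])
      ultimately have *: "norm (f (x + ?h *\<^sub>R v) - f x - ?h *\<^sub>R D x) \<le> e' * (?h * norm v)" by simp
      have "s n x - D x = real (Suc n) *\<^sub>R (f (x + ?h *\<^sub>R v) - f x - ?h *\<^sub>R D x)"
        by (simp add: s_def scaleR_diff_right)
      then have "norm (s n x - D x) = real (Suc n) * norm (f (x + ?h *\<^sub>R v) - f x - ?h *\<^sub>R D x)" by simp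
      also have "\<dots> \<le> real (Suc n) * (e' * (?h * norm v))" using * by (rule mult_left_mono) simp
      also have "\<dots> = e' * norm v" by simp
      also have "\<dots> < e' * (norm v + 1)" using \<open>e' > 0\<close> by simp
      also have "\<dots> = e" using nv by (simp add: e'_def)
      finally show "norm (s n x - D x) < e" .
    qed
  qed
  have meas[measurable]: "f \<in> borel_measurable borel" using contf by (rule borel_measurable_continuous_onI)
  have meas'[measurable]: "D \<in> borel_measurable borel" using contD by (rule borel_measurable_continuous_onI)
  have intf: "integrable lborel f" by (rule integrable_compact_support[OF contf K])
  have ints: "integrable lborel (\<lambda>x. f (x + w))" for w
  proof (rule integrable_compact_support(1))
    show "continuous_on UNIV (\<lambda>x. f (x + w))"
      by (rule continuous_on_compose2[OF contf]) (auto intro!: continuous_intros)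
    show "compact ((\<lambda>x. x - w) ` K)"
      using K(1) by (intro compact_continuous_image) (auto intro!: continuous_intros)
    show "f (x + w) = 0" if "x \<notin> (\<lambda>x. x - w) ` K" for x
      using that by (intro K(2)) force
  qed
  have s0: "(LINT x|lborel. s n x) = 0" for n
    unfolding s_def using ints intf by (simp add: lborel_integral_translate)
  have "(\<lambda>n. LINT x|lborel. s n x) \<longlonglongrightarrow> (LINT x|lborel. D x)"
  proof (rule integral_dominated_convergence[where w = "\<lambda>x. indicator (cball 0 (R + norm v)) x *\<^sub>R B"])
    show "AE x in lborel. (\<lambda>n. s n x) \<longlonglongrightarrow> D x" using lim by simp
    show "AE x in lborel. norm (s n x) \<le> indicator (cball 0 (R + norm v)) x *\<^sub>R B" for n
    proof (rule AE_I2)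
      fix x :: 'a
      show "norm (s n x) \<le> indicator (cball 0 (R + norm v)) x *\<^sub>R B"
        using bound[of n x] supp[of x n] by (cases "x \<in> cball 0 (R + norm v)") auto
    qed
    show "integrable lborel (\<lambda>x::'a. indicator (cball 0 (R + norm v)) x *\<^sub>R B)"
      by (rule borel_integrable_compact) auto
    show "(s n) \<in> borel_measurable lborel" for n unfolding s_def by measurable
  qed simp
  then have "(LINT x|lborel. D x) = 0" using s0 by (simp add: LIMSEQ_const_iff)
  then show ?thesis by (simp add: D_def[symmetric] integral_completion)
qed

lemma integral_dz_compact_support:
  fixes f :: "complex^'n \<Rightarrow> complex"
  assumes f: "smooth_on UNIV f" and K: "compact K" "\<And>x. x \<notin> K \<Longrightarrow> f x = 0"
  shows "(LINT x|lebesgue. dz j f x) = 0"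
proof -
  have i: "integrable lebesgue (\<lambda>x. frechet_derivative f (at x) v)" for v
  proof (rule integrable_compact_support[OF _ K(1)])
    show "continuous_on UNIV (\<lambda>x. frechet_derivative f (at x) v)"
      by (rule smooth_on_continuous_on[OF smooth_on_derivative[OF f]])
    show "frechet_derivative f (at x) v = 0" if "x \<notin> K" for x
    proof -
      have "frechet_derivative f (at x) = frechet_derivative (\<lambda>x. 0) (at x)"
        by (rule frechet_derivative_cong_open[of "- K"]) (use K that in \<open>auto simp: open_Compl compact_imp_closed\<close>)
      then show ?thesis by simp
    qed
  qed
  show ?thesis
    unfolding dz_def by (simp add: i integral_derivative_compact_support[OF f K])
qed

section \<open>Holomorphic functions of several variables are smooth\<close>

lemma norm_vector_smult: "norm (c *s v) = norm c * norm (v :: complex^'n)"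
proof -
  have "norm (c *s v) = L2_set (\<lambda>i. norm c * norm (v $ i)) UNIV"
    by (simp add: norm_vec_def norm_mult)
  also have "\<dots> = norm c * norm v"
    by (simp add: norm_vec_def L2_set_right_distrib)
  finally show ?thesis .
qed

lemma bounded_linear_smult_left: "bounded_linear (\<lambda>c. c *s (v :: complex^'n))"
  by (rule bounded_linear_intro[where K = "norm v"])
     (auto simp: vec_eq_iff algebra_simps norm_vector_smult)

lemma holomorphic_several_onD:
  assumes "holomorphic_several_on S f" "x \<in> S"
  shows "f differentiable (at x)"
    "frechet_derivative f (at x) (c *s v) = c * frechet_derivative f (at x) v"
proof -
  obtain L where L: "(f has_derivative L) (at x)" "\<And>c v. L (c *s v) = c * L v"
    using assms unfolding holomorphic_several_on_def by blast
  show "f differentiable (at x)" using L(1) by (auto simp: differentiable_def)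
  show "frechet_derivative f (at x) (c *s v) = c * frechet_derivative f (at x) v"
    by (simp add: frechet_derivative_eq[OF L(1)] L(2))
qed

lemma holomorphic_line_derivative:
  fixes f :: "complex^'n \<Rightarrow> complex"
  assumes "holomorphic_several_on S f" "x + \<zeta> *s v \<in> S"
  shows "((\<lambda>\<zeta>. f (x + \<zeta> *s v)) has_field_derivative frechet_derivative f (at (x + \<zeta> *s v)) v) (at \<zeta>)"
proof -
  have F: "(f has_derivative frechet_derivative f (at (x + \<zeta> *s v))) (at (x + \<zeta> *s v))"
    using holomorphic_several_onD(1)[OF assms] by (rule has_derivative_frechet)
  have "((\<lambda>\<zeta>. x + \<zeta> *s v) has_derivative (\<lambda>h. h *s v)) (at \<zeta>)"
    using has_derivative_add[OF has_derivative_const bounded_linear_imp_has_derivative[OF bounded_linear_smult_left]]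
    by simp
  from has_derivative_compose[OF this F]
  show ?thesis
    unfolding has_field_derivative_def
    by (rule has_derivative_eq_rhs) (simp add: fun_eq_iff holomorphic_several_onD(2)[OF assms] mult.commute)
qed

text \<open>Cauchy's formula on a complex line turns a derivative of \<open>f\<close> into an average of values of \<open>f\<close>.\<close>

lemma directional_derivative_Cauchy:
  fixes f :: "complex^'n \<Rightarrow> complex"
  assumes f: "holomorphic_several_on S f" and \<rho>: "\<rho> > 0"
    and S: "\<And>\<zeta>. norm \<zeta> \<le> \<rho> \<Longrightarrow> x + \<zeta> *s v \<in> S"
  shows "frechet_derivative f (at x) v
    = integral {0..1} (\<lambda>t. f (x + circlepath 0 \<rho> t *s v) / circlepath 0 \<rho> t)"
proof -
  define g where "g \<zeta> = f (x + \<zeta> *s v)" for \<zeta>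
  have g': "(g has_field_derivative frechet_derivative f (at (x + \<zeta> *s v)) v) (at \<zeta>)" if "norm \<zeta> \<le> \<rho>" for \<zeta>
    unfolding g_def[abs_def] by (rule holomorphic_line_derivative[OF f S[OF that]])
  have cont: "continuous_on (cball 0 \<rho>) g"
    by (rule continuous_at_imp_continuous_on) (auto intro!: DERIV_isCont[OF g'])
  have hol: "g holomorphic_on ball 0 \<rho>"
    unfolding holomorphic_on_open[OF open_ball]
  proof
    fix \<zeta> :: complex assume "\<zeta> \<in> ball 0 \<rho>"
    then have "norm \<zeta> \<le> \<rho>" by simp
    from g'[OF this] show "\<exists>f'. (g has_field_derivative f') (at \<zeta>)" by blast
  qed
  have "(g has_field_derivative (1 / (2 * of_real pi * \<i>) * contour_integral (circlepath 0 \<rho>) (\<lambda>u. g u / (u - 0)^2))) (at 0)"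
    by (rule Cauchy_derivative_integral_circlepath[OF cont hol]) (use \<rho> in simp)
  moreover have "(g has_field_derivative frechet_derivative f (at x) v) (at 0)"
    using g'[of 0] \<rho> by simp
  ultimately have "frechet_derivative f (at x) v
      = 1 / (2 * of_real pi * \<i>) * contour_integral (circlepath 0 \<rho>) (\<lambda>u. g u / u^2)"
    using DERIV_unique by fastforce
  also have "contour_integral (circlepath 0 \<rho>) (\<lambda>u. g u / u^2)
      = integral {0..1} (\<lambda>t. (2 * of_real pi * \<i>) * (g (circlepath 0 \<rho> t) / circlepath 0 \<rho> t))"
    unfolding contour_integral_integral vector_derivative_circlepath
    by (rule integral_cong) (use \<rho> in \<open>simp add: circlepath field_simps power2_eq_square\<close>)
  finally show ?thesis unfolding integral_mult_right g_def by simp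
qed

text \<open>The Cauchy average of \<open>f\<close> depends continuously on the base point, so the derivative of \<open>f\<close> is continuous.
  Hence the average may be differentiated under the integral sign, and the result is again complex linear.\<close>

lemma holomorphic_directional_derivative:
  fixes f :: "complex^'n \<Rightarrow> complex"
  assumes S: "open S" and f: "holomorphic_several_on S f"
  shows "holomorphic_several_on S (\<lambda>x. frechet_derivative f (at x) v)"
proof -
  have contf: "continuous_on S f"
  proof (rule continuous_at_imp_continuous_on, rule ballI)
    fix x assume "x \<in> S"
    show "isCont f x"
      by (rule differentiable_imp_continuous_within[OF holomorphic_several_onD(1)[OF f \<open>x \<in> S\<close>]])
  qed
  \<comment> \<open>One radius serves all base points near \<open>x0\<close>.\<close>
  have radius: "\<exists>r>0. \<exists>\<rho>>0. \<forall>x\<in>ball x0 r. \<forall>\<zeta>. norm \<zeta> \<le> \<rho> \<longrightarrow> x + \<zeta> *s u \<in> S"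
    if x0S: "x0 \<in> S" for x0 u :: "complex^'n"
  proof -
    obtain e where e: "e > 0" "ball x0 e \<subseteq> S" by (rule openE[OF S x0S])
    define N where "N = norm u + 1"
    have N: "N > 0" "norm u < N" by (auto simp: N_def add_nonneg_pos)
    have "x + \<zeta> *s u \<in> S" if "x \<in> ball x0 (e/2)" "norm \<zeta> \<le> e / (2 * N)" for x \<zeta>
    proof -
      have "norm (\<zeta> *s u) \<le> e / (2 * N) * norm u"
        unfolding norm_vector_smult using that(2) by (rule mult_right_mono) simp
      also have "\<dots> \<le> e / (2 * N) * N" using e(1) N by (intro mult_left_mono) auto
      also have "\<dots> = e / 2" using N by simp
      finally have "dist x0 (x + \<zeta> *s u) < e"
        using that(1) norm_triangle_ineq[of "x - x0" "\<zeta> *s u"]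
        by (simp add: dist_norm norm_minus_commute algebra_simps)
      with e(2) show ?thesis by auto
    qed
    moreover have "e / 2 > 0" "e / (2 * N) > 0" using e(1) N by auto
    ultimately show ?thesis by blast
  qed
  have path: "norm (circlepath 0 \<rho> t) \<le> \<rho>" "\<rho> > 0 \<Longrightarrow> circlepath 0 \<rho> t \<noteq> 0" if "\<rho> > 0" for \<rho> t
    using that by (auto simp: circlepath norm_mult)
  have contpath: "continuous_on A (\<lambda>p. circlepath 0 \<rho> (snd p) *s u)" for A :: "((complex^'n) \<times> real) set" and \<rho> and u :: "complex^'n"
    unfolding circlepath
    by (rule bounded_linear.continuous_on[OF bounded_linear_smult_left]) (auto intro!: continuous_intros)
  have contden: "continuous_on A (\<lambda>p. circlepath 0 \<rho> (snd p))" for A :: "((complex^'n) \<times> real) set" and \<rho>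
    unfolding circlepath by (auto intro!: continuous_intros)
  have contD: "continuous_on S (\<lambda>x. frechet_derivative f (at x) u)" for u
  proof (rule continuous_at_imp_continuous_on, rule ballI)
    fix x0 assume "x0 \<in> S"
    then obtain r \<rho> where r: "r > 0" "\<rho> > 0"
      and inS: "\<And>x \<zeta>. x \<in> ball x0 r \<Longrightarrow> norm \<zeta> \<le> \<rho> \<Longrightarrow> x + \<zeta> *s u \<in> S"
      using radius[of x0 u] by meson
    have "continuous_on (ball x0 r \<times> cbox 0 1) (\<lambda>p. f (fst p + circlepath 0 \<rho> (snd p) *s u) / circlepath 0 \<rho> (snd p))"
      using inS path[OF r(2)] r(2)
      by (intro continuous_on_divide contden continuous_on_compose2[OF contf] continuous_on_add contpath continuous_on_fst continuous_on_id) auto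
    then have "continuous_on (ball x0 r) (\<lambda>x. integral (cbox 0 1) (\<lambda>t. f (x + circlepath 0 \<rho> t *s u) / circlepath 0 \<rho> t))"
      by (intro integral_continuous_on_param) (simp add: case_prod_unfold)
    then have "continuous_on (ball x0 r) (\<lambda>x. frechet_derivative f (at x) u)"
      by (rule continuous_on_eq) (simp add: directional_derivative_Cauchy[OF f r(2) inS])
    then show "isCont (\<lambda>x. frechet_derivative f (at x) u) x0"
      using r(1) by (simp add: continuous_on_eq_continuous_at)
  qed
  show ?thesis
    unfolding holomorphic_several_on_def
  proof
    fix x0 assume "x0 \<in> S"
    then obtain r \<rho> where r: "r > 0" "\<rho> > 0"
      and inS: "\<And>x \<zeta>. x \<in> ball x0 r \<Longrightarrow> norm \<zeta> \<le> \<rho> \<Longrightarrow> x + \<zeta> *s v \<in> S"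
      using radius[of x0 v] by meson
    define fx where "fx x t = Blinfun (\<lambda>u. frechet_derivative f (at (x + circlepath 0 \<rho> t *s v)) u / circlepath 0 \<rho> t)" for x t
    have D: "((\<lambda>x. f (x + circlepath 0 \<rho> t *s v) / circlepath 0 \<rho> t) has_derivative
        (\<lambda>u. frechet_derivative f (at (x + circlepath 0 \<rho> t *s v)) u / circlepath 0 \<rho> t)) (at x within ball x0 r)"
      if "x \<in> ball x0 r" for x t
    proof -
      let ?w = "circlepath 0 \<rho> t *s v"
      have F: "(f has_derivative frechet_derivative f (at (x + ?w))) (at (x + ?w))"
        using holomorphic_several_onD(1)[OF f inS[OF that path(1)[OF r(2)]]] by (rule has_derivative_frechet)
      have "((\<lambda>x. x + ?w) has_derivative (\<lambda>h. h)) (at x within ball x0 r)"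
        by (auto intro!: derivative_eq_intros)
      from has_derivative_compose[OF this F]
      have "((\<lambda>x. f (x + ?w)) has_derivative frechet_derivative f (at (x + ?w))) (at x within ball x0 r)" .
      from bounded_linear.has_derivative[OF bounded_linear_divide this] show ?thesis .
    qed
    have app: "blinfun_apply (fx x t) = (\<lambda>u. frechet_derivative f (at (x + circlepath 0 \<rho> t *s v)) u / circlepath 0 \<rho> t)"
      if "x \<in> ball x0 r" for x t
      unfolding fx_def by (rule bounded_linear_Blinfun_apply[OF has_derivative_bounded_linear[OF D[OF that]]])
    have cont: "continuous_on (ball x0 r \<times> cbox 0 1) (\<lambda>p. fx (fst p) (snd p))"
    proof (rule continuous_on_blinfun_componentwise)
      fix u :: "complex^'n"
      have "continuous_on (ball x0 r \<times> cbox 0 1)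
         (\<lambda>p. frechet_derivative f (at (fst p + circlepath 0 \<rho> (snd p) *s v)) u / circlepath 0 \<rho> (snd p))"
        using inS path[OF r(2)] r(2)
        by (intro continuous_on_divide contden continuous_on_compose2[OF contD] continuous_on_add contpath continuous_on_fst continuous_on_id) auto
      then show "continuous_on (ball x0 r \<times> cbox 0 1) (\<lambda>p. blinfun_apply (fx (fst p) (snd p)) u)"
        by (rule continuous_on_eq) (auto simp: app)
    qed
    have intf: "(\<lambda>t. f (x + circlepath 0 \<rho> t *s v) / circlepath 0 \<rho> t) integrable_on cbox 0 1" if "x \<in> ball x0 r" for x
    proof -
      have "continuous_on {0..1} (\<lambda>t. f (fst (x, t) + circlepath 0 \<rho> (snd (x, t)) *s v) / circlepath 0 \<rho> (snd (x, t)))"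
        unfolding fst_conv snd_conv
        using inS[OF that] path[OF r(2)] r(2) 
        by (intro continuous_on_divide continuous_on_compose2[OF contf] continuous_on_add continuous_on_const
            bounded_linear.continuous_on[OF bounded_linear_smult_left])
           (auto simp: circlepath intro!: continuous_intros)
      then show ?thesis by (intro integrable_continuous) simp
    qed
    have "((\<lambda>x. integral (cbox 0 1) (\<lambda>t. f (x + circlepath 0 \<rho> t *s v) / circlepath 0 \<rho> t)) has_derivative
        integral (cbox 0 1) (fx x0)) (at x0 within ball x0 r)"
      using D intf cont r(1) by (intro leibniz_rule) (auto simp: app case_prod_unfold)
    then have "((\<lambda>x. integral (cbox 0 1) (\<lambda>t. f (x + circlepath 0 \<rho> t *s v) / circlepath 0 \<rho> t)) has_derivative
        integral (cbox 0 1) (fx x0)) (at x0)"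
      using r(1) by (simp add: at_within_open[of x0 "ball x0 r"])
    then have 1: "((\<lambda>x. frechet_derivative f (at x) v) has_derivative integral (cbox 0 1) (fx x0)) (at x0)"
      by (rule has_derivative_transform_within_open[of _ _ _ _ "ball x0 r"])
         (use r in \<open>auto simp: directional_derivative_Cauchy[OF f r(2) inS]\<close>)
    have "continuous_on (cbox 0 1) (\<lambda>t. fx (fst (x0, t)) (snd (x0, t)))"
      by (rule continuous_on_compose2[OF cont]) (use r(1) in \<open>auto intro!: continuous_intros\<close>)
    then have int: "fx x0 integrable_on cbox 0 1" by (intro integrable_continuous) simp
    have 2: "blinfun_apply (integral (cbox 0 1) (fx x0)) (c *s w) = c * blinfun_apply (integral (cbox 0 1) (fx x0)) w" for c w
    proof -
      have "blinfun_apply (fx x0 t) (c *s w) = c * blinfun_apply (fx x0 t) w" for t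
        using r by (simp add: app holomorphic_several_onD(2)[OF f inS[OF _ path(1)[OF r(2)]]])
      then show ?thesis unfolding blinfun_apply_integral[OF int] by simp
    qed
    show "\<exists>L. ((\<lambda>x. frechet_derivative f (at x) v) has_derivative L) (at x0) \<and> (\<forall>c v. L (c *s v) = c * L v)"
      using 1 2 by blast
  qed
qed

theorem smooth_on_holomorphic:
  fixes f :: "complex^'n \<Rightarrow> complex"
  assumes "open S" "holomorphic_several_on S f"
  shows "smooth_on S f"
proof (rule smooth_on_coinduct[where P = "holomorphic_several_on S"])
  show "holomorphic_several_on S f" by fact
qed (rule holomorphic_several_onD(1) holomorphic_directional_derivative[OF assms(1)]; assumption)+

lemma dzbar_holomorphic:
  fixes f :: "complex^'n \<Rightarrow> complex"
  assumes "holomorphic_several_on S f" "x \<in> S"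
  shows "dzbar j f x = 0"
proof -
  have "axis j \<i> = \<i> *s (axis j 1 :: complex^'n)" by (auto simp: vec_eq_iff axis_def)
  then show ?thesis by (simp add: dzbar_def holomorphic_several_onD(2)[OF assms])
qed

section \<open>Hermitian holomorphic bundles\<close>

lemma scaleC_zero_left [simp]: "0 *\<^sub>C (a::'v::complex_vector) = 0"
  using scaleC_add_left[of 0 0 a] by simp

lemma scaleC_zero_right [simp]: "c *\<^sub>C (0::'v::complex_vector) = 0"
  using scaleC_add_right[of c 0 "0::'v"] by simp

lemma scaleC_minus_one: "(-1) *\<^sub>C (a::'v::complex_vector) = - a"
  using scaleC_add_left[of 1 "-1" a] by (simp add: scaleC_one eq_neg_iff_add_eq_0 add.commute)

lemma complex_subspace_closed:
  assumes "complex_subspace F"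
  shows "0 \<in> F" "a \<in> F \<Longrightarrow> b \<in> F \<Longrightarrow> a + b \<in> F" "a \<in> F \<Longrightarrow> c *\<^sub>C a \<in> F"
    "a \<in> F \<Longrightarrow> - a \<in> F" "a \<in> F \<Longrightarrow> b \<in> F \<Longrightarrow> a - b \<in> F"
proof -
  show 1: "0 \<in> F" "a \<in> F \<Longrightarrow> b \<in> F \<Longrightarrow> a + b \<in> F" "a \<in> F \<Longrightarrow> c *\<^sub>C a \<in> F" for a b c
    using assms by (auto simp: complex_subspace_def)
  show 2: "a \<in> F \<Longrightarrow> - a \<in> F" for a using 1(3)[of a "-1"] by (simp add: scaleC_minus_one)
  show "a \<in> F \<Longrightarrow> b \<in> F \<Longrightarrow> a - b \<in> F" using 1(2)[of a "-b"] 2[of b] by simp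
qed

lemma complex_subspace_sum:
  "complex_subspace F \<Longrightarrow> (\<And>i. i \<in> A \<Longrightarrow> f i \<in> F) \<Longrightarrow> (\<Sum>i\<in>A. f i) \<in> F"
  by (induction A rule: infinite_finite_induct) (auto intro: complex_subspace_closed)

locale hermitian_bundle =
  fixes D :: "(complex^'n) set"
    and E :: "complex^'n \<Rightarrow> 'v::complex_vector set"
    and T :: "('n, 'r::finite, 'v) atlas"
    and h :: "complex^'n \<Rightarrow> 'v \<Rightarrow> 'v \<Rightarrow> complex"
  assumes open_D: "open D"
    and hol_bundle: "holomorphic_vector_bundle D E T"
    and metric: "smooth_hermitian_metric D E T h"
begin

abbreviation "sec \<equiv> smooth_section E T"

definition frame :: "(complex^'n \<Rightarrow> 'v \<Rightarrow> complex^'r) \<Rightarrow> complex^'r \<Rightarrow> complex^'n \<Rightarrow> 'v" where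
  "frame \<phi> b x = inv_into (E x) (\<phi> x) b"

lemma fibre: "x \<in> D \<Longrightarrow> complex_subspace (E x)"
  using hol_bundle by (simp add: holomorphic_vector_bundle_def)

lemmas fibre_closed = complex_subspace_closed[OF fibre]
lemmas fibre_sum = complex_subspace_sum[OF fibre]

lemma chart_open: "(U, \<phi>) \<in> T \<Longrightarrow> open U"
  using hol_bundle by (auto simp: holomorphic_vector_bundle_def)

lemma chart_subset: "(U, \<phi>) \<in> T \<Longrightarrow> U \<subseteq> D"
  using hol_bundle by (auto simp: holomorphic_vector_bundle_def)

lemma chart_exists:
  assumes "x \<in> D"
  obtains U \<phi> where "(U, \<phi>) \<in> T" "x \<in> U"
proof -
  have "(\<Union>(U, \<phi>)\<in>T. U) = D"
    using hol_bundle by (simp add: holomorphic_vector_bundle_def)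
  with assms have "x \<in> (\<Union>(U, \<phi>)\<in>T. U)" by simp
  then show ?thesis using that by (elim UN_E) (auto split: prod.splits)
qed

lemma chart_iso: "(U, \<phi>) \<in> T \<Longrightarrow> x \<in> U \<Longrightarrow> linear_iso_on (E x) (\<phi> x)"
  using hol_bundle by (auto simp: holomorphic_vector_bundle_def)

lemma chart_transition:
  assumes "(U, \<phi>) \<in> T" "(V, \<phi>') \<in> T"
  obtains g :: "complex^'n \<Rightarrow> complex^'r^'r" where
    "\<And>\<alpha> \<beta>. holomorphic_several_on (U \<inter> V) (\<lambda>x. g x $ \<alpha> $ \<beta>)"
    "\<And>x a. x \<in> U \<inter> V \<Longrightarrow> a \<in> E x \<Longrightarrow> \<phi>' x a = g x *v \<phi> x a"
proof -
  have "\<forall>(U, \<phi>)\<in>T. \<forall>(V, \<phi>')\<in>T. \<exists>g :: complex^'n \<Rightarrow> complex^'r^'r.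
      (\<forall>\<alpha> \<beta>. holomorphic_several_on (U \<inter> V) (\<lambda>x. g x $ \<alpha> $ \<beta>)) \<and>
      (\<forall>x\<in>U \<inter> V. \<forall>a\<in>E x. \<phi>' x a = g x *v \<phi> x a)"
    using hol_bundle unfolding holomorphic_vector_bundle_def by (elim conjE)
  from bspec[OF this assms(1)] have "\<forall>(V, \<phi>')\<in>T. \<exists>g :: complex^'n \<Rightarrow> complex^'r^'r.
      (\<forall>\<alpha> \<beta>. holomorphic_several_on (U \<inter> V) (\<lambda>x. g x $ \<alpha> $ \<beta>)) \<and>
      (\<forall>x\<in>U \<inter> V. \<forall>a\<in>E x. \<phi>' x a = g x *v \<phi> x a)"
    by (simp only: prod.case)
  from bspec[OF this assms(2)] obtain g :: "complex^'n \<Rightarrow> complex^'r^'r" where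
      "(\<forall>\<alpha> \<beta>. holomorphic_several_on (U \<inter> V) (\<lambda>x. g x $ \<alpha> $ \<beta>)) \<and>
      (\<forall>x\<in>U \<inter> V. \<forall>a\<in>E x. \<phi>' x a = g x *v \<phi> x a)"
    by (auto simp only: prod.case)
  then show ?thesis using that[of g] by simp
qed

context
  fixes U \<phi> assumes chart: "(U, \<phi>) \<in> T"
begin

lemma chart_D: "x \<in> U \<Longrightarrow> x \<in> D"
  using chart_subset[OF chart] by blast

lemma coord_add: "x \<in> U \<Longrightarrow> a \<in> E x \<Longrightarrow> b \<in> E x \<Longrightarrow> \<phi> x (a + b) = \<phi> x a + \<phi> x b"
  using chart_iso[OF chart] by (auto simp: linear_iso_on_def)

lemma coord_scale: "x \<in> U \<Longrightarrow> a \<in> E x \<Longrightarrow> \<phi> x (c *\<^sub>C a) = c *s \<phi> x a"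
  using chart_iso[OF chart] by (auto simp: linear_iso_on_def)

lemma coord_zero: "x \<in> U \<Longrightarrow> \<phi> x 0 = 0"
  using coord_scale[of x 0 0] fibre_closed(1)[OF chart_D] by (simp add: vec_eq_iff)

lemma coord_sum:
  assumes "x \<in> U" "\<And>i. i \<in> A \<Longrightarrow> f i \<in> E x"
  shows "\<phi> x (\<Sum>i\<in>A. f i) = (\<Sum>i\<in>A. \<phi> x (f i))"
  using assms(2)
  by (induction A rule: infinite_finite_induct)
     (auto simp: coord_zero[OF assms(1)] coord_add[OF assms(1)] fibre_sum[OF chart_D[OF assms(1)]])

lemma coord_inj: "x \<in> U \<Longrightarrow> a \<in> E x \<Longrightarrow> b \<in> E x \<Longrightarrow> \<phi> x a = \<phi> x b \<Longrightarrow> a = b"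
  using chart_iso[OF chart] by (auto simp: linear_iso_on_def bij_betw_def inj_on_def)

lemma
  assumes "x \<in> U"
  shows frame_fibre: "frame \<phi> b x \<in> E x"
    and coord_frame: "\<phi> x (frame \<phi> b x) = b"
proof -
  have "b \<in> \<phi> x ` E x" using chart_iso[OF chart assms] by (auto simp: linear_iso_on_def bij_betw_def)
  then show "frame \<phi> b x \<in> E x" "\<phi> x (frame \<phi> b x) = b"
    unfolding frame_def by (rule inv_into_into, rule f_inv_into_f)
qed

lemma frame_coord: "x \<in> U \<Longrightarrow> a \<in> E x \<Longrightarrow> frame \<phi> (\<phi> x a) x = a"
  by (rule coord_inj) (auto simp: frame_fibre coord_frame)

lemma frame_expansion:
  assumes "x \<in> U" "a \<in> E x"
  shows "a = (\<Sum>\<alpha>\<in>UNIV. (\<phi> x a $ \<alpha>) *\<^sub>C frame \<phi> (axis \<alpha> 1) x)"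
proof (rule coord_inj[OF assms])
  note [simp] = fibre_closed[OF chart_D[OF assms(1)]] frame_fibre[OF assms(1)]
  show "(\<Sum>\<alpha>\<in>UNIV. (\<phi> x a $ \<alpha>) *\<^sub>C frame \<phi> (axis \<alpha> 1) x) \<in> E x"
    by (simp add: fibre_sum[OF chart_D[OF assms(1)]])
  show "\<phi> x a = \<phi> x (\<Sum>\<alpha>\<in>UNIV. (\<phi> x a $ \<alpha>) *\<^sub>C frame \<phi> (axis \<alpha> 1) x)"
    by (simp add: coord_sum coord_scale coord_frame assms vec_eq_iff axis_def if_distrib cong: if_cong)
qed

end

lemma metric_facts:
  assumes "x \<in> D" "a \<in> E x" "b \<in> E x"
  shows metric_add: "a' \<in> E x \<Longrightarrow> h x (a + a') b = h x a b + h x a' b"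
    and metric_scale: "h x (c *\<^sub>C a) b = c * h x a b"
    and metric_cnj: "h x b a = cnj (h x a b)"
    and metric_pos: "a \<noteq> 0 \<Longrightarrow> 0 < Re (h x a a)"
  using metric assms unfolding smooth_hermitian_metric_def by blast+

lemma metric_zero:
  assumes "x \<in> D" "b \<in> E x"
  shows "h x 0 b = 0" "h x b 0 = 0"
proof -
  show 1: "h x 0 b = 0"
    using metric_scale[OF assms(1) fibre_closed(1)[OF assms(1)] assms(2), of 0] by simp
  show "h x b 0 = 0"
    using metric_cnj[OF assms(1) fibre_closed(1)[OF assms(1)] assms(2)] 1 by simp
qed

lemma metric_right:
  assumes "x \<in> D" "a \<in> E x" "b \<in> E x"
  shows metric_add_right: "b' \<in> E x \<Longrightarrow> h x a (b + b') = h x a b + h x a b'"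
    and metric_scale_right: "h x a (c *\<^sub>C b) = cnj c * h x a b"
proof -
  note [simp] = fibre_closed[OF assms(1)]
  show "b' \<in> E x \<Longrightarrow> h x a (b + b') = h x a b + h x a b'"
    using metric_cnj[OF assms(1), of a b] metric_cnj[OF assms(1), of a b'] metric_cnj[OF assms(1), of a "b + b'"]
      metric_cnj[OF assms(1), of "b + b'" a] metric_add[OF assms(1) assms(3) assms(2)] assms by simp
  show "h x a (c *\<^sub>C b) = cnj c * h x a b"
    using metric_cnj[OF assms(1), of b a] metric_cnj[OF assms(1), of "c *\<^sub>C b" a]
      metric_scale[OF assms(1) assms(3) assms(2)] assms by simp
qed

lemma metric_sum:
  assumes "x \<in> D" "b \<in> E x" "\<And>i. i \<in> A \<Longrightarrow> f i \<in> E x"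
  shows metric_sum_left: "h x (\<Sum>i\<in>A. f i) b = (\<Sum>i\<in>A. h x (f i) b)"
    and metric_sum_right: "h x b (\<Sum>i\<in>A. f i) = (\<Sum>i\<in>A. h x b (f i))"
  using assms(3)
  by (induction A rule: infinite_finite_induct)
     (auto simp: metric_zero[OF assms(1,2)] metric_add[OF assms(1)] metric_add_right[OF assms(1,2)]
       assms fibre_sum[OF assms(1)])

lemma metric_diff:
  assumes "x \<in> D" "a \<in> E x" "a' \<in> E x" "b \<in> E x"
  shows metric_diff_left: "h x (a - a') b = h x a b - h x a' b"
    and metric_diff_right: "h x b (a - a') = h x b a - h x b a'"
proof -
  note [simp] = fibre_closed[OF assms(1)]
  have e: "a - a' = a + (-1) *\<^sub>C a'" by (simp add: scaleC_minus_one)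
  show "h x (a - a') b = h x a b - h x a' b"
    unfolding e using metric_add[OF assms(1,2,4), of "(-1) *\<^sub>C a'"] metric_scale[OF assms(1,3,4), of "-1"] assms by simp
  show "h x b (a - a') = h x b a - h x b a'"
    unfolding e using metric_add_right[OF assms(1,4,2), of "(-1) *\<^sub>C a'"] metric_scale_right[OF assms(1,4,3), of "-1"] assms by simp
qed

lemma metric_self: 
  assumes "x \<in> D" "a \<in> E x"
  shows "Im (h x a a) = 0" "0 \<le> Re (h x a a)" "h x a a = of_real (Re (h x a a))"
proof -
  show 1: "Im (h x a a) = 0" using metric_cnj[OF assms assms(2)] by (simp add: complex_eq_iff)
  show "0 \<le> Re (h x a a)" using metric_pos[OF assms assms(2)] metric_zero[OF assms] by (cases "a = 0") auto
  show "h x a a = of_real (Re (h x a a))" using 1 by (simp add: complex_eq_iff)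
qed

lemma metric_nondegenerate:
  assumes "x \<in> D" "a \<in> E x" "\<And>b. b \<in> E x \<Longrightarrow> h x a b = 0"
  shows "a = 0"
  using metric_pos[OF assms(1,2,2)] assms(2,3) by force

lemma metric_frame_expansion:
  assumes "(U, \<phi>) \<in> T" "x \<in> U" "a \<in> E x" "b \<in> E x"
  shows "h x a b = (\<Sum>\<alpha>\<in>UNIV. \<phi> x a $ \<alpha> * h x (frame \<phi> (axis \<alpha> 1) x) b)"
    and "h x b a = (\<Sum>\<alpha>\<in>UNIV. cnj (\<phi> x a $ \<alpha>) * h x b (frame \<phi> (axis \<alpha> 1) x))"
proof -
  note D = chart_D[OF assms(1,2)]
  note [simp] = fibre_closed[OF D] frame_fibre[OF assms(1,2)]
  show "h x a b = (\<Sum>\<alpha>\<in>UNIV. \<phi> x a $ \<alpha> * h x (frame \<phi> (axis \<alpha> 1) x) b)"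
    by (subst frame_expansion[OF assms(1-3)]) (simp add: metric_sum_left[OF D] metric_scale[OF D] assms)
  show "h x b a = (\<Sum>\<alpha>\<in>UNIV. cnj (\<phi> x a $ \<alpha>) * h x b (frame \<phi> (axis \<alpha> 1) x))"
    by (subst frame_expansion[OF assms(1-3)]) (simp add: metric_sum_right[OF D] metric_scale_right[OF D] assms)
qed

lemma metric_eq_on_frame:
  assumes "(U, \<phi>) \<in> T" "x \<in> U" "a \<in> E x" "a' \<in> E x"
    "\<And>\<beta>. h x a (frame \<phi> (axis \<beta> 1) x) = h x a' (frame \<phi> (axis \<beta> 1) x)"
  shows "a = a'"
proof -
  note D = chart_D[OF assms(1,2)]
  have "a - a' = 0"
  proof (rule metric_nondegenerate[OF D])
    show *: "a - a' \<in> E x" using assms fibre_closed[OF D] by blast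
    fix b assume b: "b \<in> E x"
    show "h x (a - a') b = 0"
      using metric_frame_expansion(2)[OF assms(1,2) b *] assms(5)
      by (simp add: metric_diff_left[OF D] assms frame_fibre[OF assms(1,2)])
  qed
  then show ?thesis by simp
qed

subsection \<open>Smooth sections\<close>

lemma sec_fibre: "sec W s \<Longrightarrow> x \<in> W \<Longrightarrow> s x \<in> E x"
  by (simp add: smooth_section_def)

lemma sec_coord: "sec W s \<Longrightarrow> (U, \<phi>) \<in> T \<Longrightarrow> smooth_on (W \<inter> U) (\<lambda>x. \<phi> x (s x))"
  by (auto simp: smooth_section_def)

lemma sec_subset: "sec W s \<Longrightarrow> V \<subseteq> W \<Longrightarrow> sec V s"
  unfolding smooth_section_def by (fast intro: smooth_on_subset)

lemma sec_cong:
  assumes "open W" "sec W s" "\<And>x. x \<in> W \<Longrightarrow> t x = s x"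
  shows "sec W t"
  unfolding smooth_section_def
proof (intro conjI ballI)
  show "t x \<in> E x" if "x \<in> W" for x using assms that by (simp add: sec_fibre)
  fix c assume "c \<in> T"
  obtain U \<phi> where c: "c = (U, \<phi>)" by (cases c)
  have "smooth_on (W \<inter> U) (\<lambda>x. \<phi> x (t x)) = smooth_on (W \<inter> U) (\<lambda>x. \<phi> x (s x))"
    by (rule smooth_on_cong) (use assms chart_open \<open>c \<in> T\<close> c in auto)
  then show "case c of (U, \<phi>) \<Rightarrow> smooth_on (W \<inter> U) (\<lambda>x. \<phi> x (t x))"
    using sec_coord[OF assms(2)] \<open>c \<in> T\<close> c by auto
qed

lemma sec_local:
  assumes "\<And>x. x \<in> W \<Longrightarrow> \<exists>V. open V \<and> x \<in> V \<and> sec V s"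
  shows "sec W s"
  unfolding smooth_section_def
proof (intro conjI ballI)
  show "s x \<in> E x" if "x \<in> W" for x using assms[OF that] sec_fibre by blast
  fix c assume "c \<in> T"
  obtain U \<phi> where c: "c = (U, \<phi>)" by (cases c)
  have "smooth_on (W \<inter> U) (\<lambda>x. \<phi> x (s x))"
  proof (rule smooth_on_local)
    fix x assume "x \<in> W \<inter> U"
    then obtain V where V: "open V" "x \<in> V" "sec V s" using assms by blast
    then have "smooth_on (V \<inter> U) (\<lambda>x. \<phi> x (s x))" using sec_coord \<open>c \<in> T\<close> c by blast
    then show "\<exists>V. open V \<and> x \<in> V \<and> smooth_on V (\<lambda>x. \<phi> x (s x))"
      using V \<open>x \<in> W \<inter> U\<close> chart_open \<open>c \<in> T\<close> c by (intro exI[of _ "V \<inter> U"]) auto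
  qed
  then show "case c of (U, \<phi>) \<Rightarrow> smooth_on (W \<inter> U) (\<lambda>x. \<phi> x (s x))" using c by simp
qed

text \<open>Smoothness in one chart suffices because the transition functions are holomorphic, hence smooth.\<close>

lemma sec_in_chart:
  assumes "(U, \<phi>) \<in> T" "open W" "W \<subseteq> U" "\<And>x. x \<in> W \<Longrightarrow> s x \<in> E x"
    "\<And>\<alpha>. smooth_on W (\<lambda>x. \<phi> x (s x) $ \<alpha>)"
  shows "sec W s"
  unfolding smooth_section_def
proof (intro conjI ballI)
  show "s x \<in> E x" if "x \<in> W" for x using assms that by simp
  fix c assume "c \<in> T"
  obtain V \<phi>' where c: "c = (V, \<phi>')" by (cases c)
  with \<open>c \<in> T\<close> have V: "(V, \<phi>') \<in> T" by simp
  obtain g :: "complex^'n \<Rightarrow> complex^'r^'r" where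
    g: "\<And>\<alpha> \<beta>. holomorphic_several_on (U \<inter> V) (\<lambda>x. g x $ \<alpha> $ \<beta>)"
    and t: "\<And>x a. x \<in> U \<inter> V \<Longrightarrow> a \<in> E x \<Longrightarrow> \<phi>' x a = g x *v \<phi> x a"
    using chart_transition[OF assms(1) V] by metis
  have o: "open (W \<inter> V)" using assms(2) chart_open[OF V] by blast
  have "smooth_on (W \<inter> V) (\<lambda>x. \<phi>' x (s x) $ \<alpha>)" for \<alpha>
  proof -
    have "smooth_on (W \<inter> V) (\<lambda>x. g x $ \<alpha> $ \<beta>)" for \<beta>
      by (rule smooth_on_subset[OF smooth_on_holomorphic[OF _ g]])
         (use assms chart_open[OF V] chart_open[OF assms(1)] in auto)
    moreover have "smooth_on (W \<inter> V) (\<lambda>x. \<phi> x (s x) $ \<beta>)" for \<beta>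
      by (rule smooth_on_subset[OF assms(5)]) auto
    ultimately have "smooth_on (W \<inter> V) (\<lambda>x. \<Sum>\<beta>\<in>UNIV. g x $ \<alpha> $ \<beta> * \<phi> x (s x) $ \<beta>)"
      by (intro smooth_on_sum smooth_on_mult o)
    then show ?thesis
      by (subst smooth_on_cong[OF o]) (use t assms in \<open>auto simp: matrix_vector_mult_def\<close>)
  qed
  then have "smooth_on (W \<inter> V) (\<lambda>x. \<phi>' x (s x))" by (rule smooth_on_vec[OF o])
  then show "case c of (U, \<phi>) \<Rightarrow> smooth_on (W \<inter> U) (\<lambda>x. \<phi> x (s x))" using c by simp
qed

lemma sec_frame:
  assumes "(U, \<phi>) \<in> T"
  shows "sec U (frame \<phi> b)"
proof (rule sec_in_chart[OF assms chart_open[OF assms] order_refl])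
  show "frame \<phi> b x \<in> E x" if "x \<in> U" for x using frame_fibre[OF assms that] .
  show "smooth_on U (\<lambda>x. \<phi> x (frame \<phi> b x) $ \<alpha>)" for \<alpha>
    by (subst smooth_on_cong[OF chart_open[OF assms], where g = "\<lambda>x. b $ \<alpha>"])
       (auto simp: coord_frame[OF assms] smooth_on_const)
qed

lemma sec_add:
  assumes "open W" "W \<subseteq> D" "sec W s" "sec W t"
  shows "sec W (\<lambda>x. s x + t x)"
proof (rule sec_local)
  fix x assume x: "x \<in> W"
  then obtain U \<phi> where c: "(U, \<phi>) \<in> T" "x \<in> U" using chart_exists assms(2) by blast
  have o: "open (W \<inter> U)" using assms(1) chart_open[OF c(1)] by blast
  have "sec (W \<inter> U) (\<lambda>x. s x + t x)"
  proof (rule sec_in_chart[OF c(1) o])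
    show "s x + t x \<in> E x" if "x \<in> W \<inter> U" for x
      using that assms(2) by (intro fibre_closed(2) sec_fibre[OF assms(3)] sec_fibre[OF assms(4)]) auto
    show "smooth_on (W \<inter> U) (\<lambda>x. \<phi> x (s x + t x) $ \<alpha>)" for \<alpha>
    proof (subst smooth_on_cong[OF o, where g = "\<lambda>x. \<phi> x (s x) $ \<alpha> + \<phi> x (t x) $ \<alpha>"])
      show "smooth_on (W \<inter> U) (\<lambda>x. \<phi> x (s x) $ \<alpha> + \<phi> x (t x) $ \<alpha>)"
        by (intro smooth_on_add smooth_on_vec_nth sec_coord c o assms)
    qed (use sec_fibre[OF assms(3)] sec_fibre[OF assms(4)] in \<open>auto simp: coord_add[OF c(1)]\<close>)
  qed auto
  then show "\<exists>V. open V \<and> x \<in> V \<and> sec V (\<lambda>x. s x + t x)" using o c x by (intro exI[of _ "W \<inter> U"]) simp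
qed

lemma sec_scale:
  assumes "open W" "W \<subseteq> D" "smooth_on W g" "sec W s"
  shows "sec W (\<lambda>x. g x *\<^sub>C s x)"
proof (rule sec_local)
  fix x assume x: "x \<in> W"
  then obtain U \<phi> where c: "(U, \<phi>) \<in> T" "x \<in> U" using chart_exists assms(2) by blast
  have o: "open (W \<inter> U)" using assms(1) chart_open[OF c(1)] by blast
  have "sec (W \<inter> U) (\<lambda>x. g x *\<^sub>C s x)"
  proof (rule sec_in_chart[OF c(1) o])
    show "g x *\<^sub>C s x \<in> E x" if "x \<in> W \<inter> U" for x
      using that assms(2) by (intro fibre_closed(3) sec_fibre[OF assms(4)]) auto
    show "smooth_on (W \<inter> U) (\<lambda>x. \<phi> x (g x *\<^sub>C s x) $ \<alpha>)" for \<alpha>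
    proof (subst smooth_on_cong[OF o, where g = "\<lambda>x. g x * \<phi> x (s x) $ \<alpha>"])
      show "smooth_on (W \<inter> U) (\<lambda>x. g x * \<phi> x (s x) $ \<alpha>)"
        by (intro smooth_on_mult smooth_on_vec_nth sec_coord c o smooth_on_subset[OF assms(3)] assms) auto
    qed (use sec_fibre[OF assms(4)] in \<open>auto simp: coord_scale[OF c(1)]\<close>)
  qed auto
  then show "\<exists>V. open V \<and> x \<in> V \<and> sec V (\<lambda>x. g x *\<^sub>C s x)" using o c x by (intro exI[of _ "W \<inter> U"]) simp
qed

lemma smooth_on_metric:
  assumes "open W" "W \<subseteq> D" "sec W s" "sec W t"
  shows "smooth_on W (\<lambda>x. h x (s x) (t x))"
proof -
  have "\<forall>W s t. open W \<and> W \<subseteq> D \<and> sec W s \<and> sec W t \<longrightarrow> smooth_on W (\<lambda>x. h x (s x) (t x))"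
    using metric unfolding smooth_hermitian_metric_def by (rule conjunct2)
  then show ?thesis using assms by simp
qed

end

section \<open>The Chern connection and its curvature\<close>

context hermitian_bundle
begin

subsection \<open>Representing a functional by the metric\<close>

text \<open>Pairing with a frame determines a vector, and by Cramer's rule its coordinates are rational expressions
  in these pairings and the Gram matrix. Vectors defined by their pairings therefore inherit smoothness.\<close>

definition gram :: "(complex^'n \<Rightarrow> 'v \<Rightarrow> complex^'r) \<Rightarrow> complex^'n \<Rightarrow> complex^'r^'r" where
  "gram \<phi> x = (\<chi> \<beta> \<alpha>. h x (frame \<phi> (axis \<alpha> 1) x) (frame \<phi> (axis \<beta> 1) x))"

definition gram_solve :: "(complex^'n \<Rightarrow> 'v \<Rightarrow> complex^'r) \<Rightarrow> complex^'n \<Rightarrow> complex^'r \<Rightarrow> complex^'r" where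
  "gram_solve \<phi> x l = (\<chi> k. det (\<chi> i j. if j = k then l $ i else gram \<phi> x $ i $ j) / det (gram \<phi> x))"

lemma gram_coord:
  assumes "(U, \<phi>) \<in> T" "x \<in> U" "a \<in> E x"
  shows "gram \<phi> x *v \<phi> x a = (\<chi> \<beta>. h x a (frame \<phi> (axis \<beta> 1) x))"
  using metric_frame_expansion(1)[OF assms frame_fibre[OF assms(1,2)]]
  by (simp add: vec_eq_iff gram_def matrix_vector_mult_def mult.commute)

lemma gram_det:
  assumes "(U, \<phi>) \<in> T" "x \<in> U"
  shows "det (gram \<phi> x) \<noteq> 0"
proof -
  note D = chart_D[OF assms]
  have "v = 0" if v: "gram \<phi> x *v v = 0" for v
  proof -
    let ?a = "frame \<phi> v x"
    have "(\<chi> \<beta>. h x ?a (frame \<phi> (axis \<beta> 1) x)) = 0"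
      using gram_coord[OF assms frame_fibre[OF assms]] v by (simp add: coord_frame[OF assms])
    then have "h x ?a (frame \<phi> (axis \<beta> 1) x) = 0" for \<beta>
      by (simp add: vec_eq_iff)
    then have "?a = 0"
      by (intro metric_eq_on_frame[OF assms])
         (simp_all add: frame_fibre[OF assms] fibre_closed(1)[OF D] metric_zero[OF D])
    then show "v = 0" using coord_frame[OF assms, of v] coord_zero[OF assms] by simp
  qed
  then have "\<exists>B. B ** gram \<phi> x = mat 1"
    by (simp add: matrix_left_invertible_ker)
  then have "invertible (gram \<phi> x)" by (simp add: invertible_left_inverse)
  then show ?thesis by (simp add: invertible_det_nz)
qed

lemma coord_eq_gram_solve:
  assumes "(U, \<phi>) \<in> T" "x \<in> U" "a \<in> E x"
  shows "\<phi> x a = gram_solve \<phi> x (\<chi> \<beta>. h x a (frame \<phi> (axis \<beta> 1) x))"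
  using gram_coord[OF assms] cramer[OF gram_det[OF assms(1,2)]] unfolding gram_solve_def by blast

lemma metric_gram_solve:
  assumes "(U, \<phi>) \<in> T" "x \<in> U"
  shows "h x (frame \<phi> (gram_solve \<phi> x l) x) (frame \<phi> (axis \<beta> 1) x) = l $ \<beta>"
proof -
  have "gram \<phi> x *v gram_solve \<phi> x l = l"
    using cramer[OF gram_det[OF assms], of "gram_solve \<phi> x l" l] unfolding gram_solve_def by blast
  with gram_coord[OF assms frame_fibre[OF assms]] show ?thesis
    by (simp add: coord_frame[OF assms] vec_eq_iff)
qed

lemma smooth_on_det:
  fixes A :: "complex^'n \<Rightarrow> complex^'r^'r"
  assumes "open W" "\<And>i j. smooth_on W (\<lambda>x. A x $ i $ j)"
  shows "smooth_on W (\<lambda>x. det (A x))"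
  unfolding det_def by (intro smooth_on_sum smooth_on_mult smooth_on_prod smooth_on_const assms)

lemma sec_by_metric:
  assumes c: "(U, \<phi>) \<in> T" and W: "open W" "W \<subseteq> U"
    and s: "\<And>x. x \<in> W \<Longrightarrow> s x \<in> E x" "\<And>\<beta>. smooth_on W (\<lambda>x. h x (s x) (frame \<phi> (axis \<beta> 1) x))"
  shows "sec W s"
proof (rule sec_in_chart[OF c W s(1)])
  fix \<alpha>
  have gram: "smooth_on W (\<lambda>x. gram \<phi> x $ i $ j)" for i j
    unfolding gram_def using W chart_subset[OF c]
    by (simp, intro smooth_on_metric sec_subset[OF sec_frame[OF c]]) auto
  have "smooth_on W (\<lambda>x. gram_solve \<phi> x (\<chi> \<beta>. h x (s x) (frame \<phi> (axis \<beta> 1) x)) $ \<alpha>)"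
    unfolding gram_solve_def vec_lambda_beta
  proof (intro smooth_on_divide smooth_on_det W gram)
    show "smooth_on W (\<lambda>x. (\<chi> i j. if j = \<alpha> then h x (s x) (frame \<phi> (axis i 1) x) else gram \<phi> x $ i $ j) $ i $ j)" for i j
      by (cases "j = \<alpha>") (simp_all add: s gram)
    show "det (gram \<phi> x) \<noteq> 0" if "x \<in> W" for x using gram_det[OF c] that W by blast
  qed
  then show "smooth_on W (\<lambda>x. \<phi> x (s x) $ \<alpha>)"
    by (subst smooth_on_cong[OF W(1)]) (use coord_eq_gram_solve[OF c _ s(1)] W in auto)
qed

subsection \<open>Existence\<close>

text \<open>Both parts of the connection are defined pointwise in a chart chosen at each point: the (0,1)-part
  differentiates coordinates, the (1,0)-part is the vector whose pairings with the holomorphic frame are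
  the derivatives of the pairings. That the choice does not matter, and hence that the result is smooth,
  follows from the two characterisations below, which hold in every chart.\<close>

definition chart_at :: "complex^'n \<Rightarrow> (complex^'n) set \<times> (complex^'n \<Rightarrow> 'v \<Rightarrow> complex^'r)" where
  "chart_at x = (SOME c. c \<in> T \<and> x \<in> fst c)"

abbreviation "coord_at x \<equiv> snd (chart_at x)"

definition nabla01 :: "('n, 'v) partial_connection" where
  "nabla01 j s x = frame (coord_at x) (\<chi> \<alpha>. dzbar j (\<lambda>y. coord_at x y (s y) $ \<alpha>) x) x"

definition nabla10 :: "('n, 'v) partial_connection" where
  "nabla10 j s x = frame (coord_at x) (gram_solve (coord_at x) x
     (\<chi> \<beta>. dz j (\<lambda>y. h y (s y) (frame (coord_at x) (axis \<beta> 1) y)) x)) x"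

lemma chart_at:
  assumes "x \<in> D"
  shows "(fst (chart_at x), coord_at x) \<in> T" "x \<in> fst (chart_at x)"
proof -
  obtain U \<phi> where "(U, \<phi>) \<in> T" "x \<in> U" using chart_exists[OF assms] .
  then have "\<exists>c. c \<in> T \<and> x \<in> fst c" by force
  from someI_ex[OF this] show "(fst (chart_at x), coord_at x) \<in> T" "x \<in> fst (chart_at x)"
    by (simp_all add: chart_at_def)
qed

lemma nabla_fibre:
  assumes "x \<in> D"
  shows "nabla01 j s x \<in> E x" "nabla10 j s x \<in> E x"
  unfolding nabla01_def nabla10_def using frame_fibre[OF chart_at[OF assms]] by blast+

lemma nabla10_metric:
  assumes "x \<in> D"
  shows "h x (nabla10 j s x) (frame (coord_at x) (axis \<beta> 1) x)
       = dz j (\<lambda>y. h y (s y) (frame (coord_at x) (axis \<beta> 1) y)) x"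
  unfolding nabla10_def by (simp add: metric_gram_solve[OF chart_at[OF assms]])

text \<open>The transition functions are holomorphic, so \<open>\<partial>/\<partial>\<bar>z\<^sub>j\<close> passes them and the formula of the chosen chart
  transforms into that of any other.\<close>

lemma nabla01_coord:
  assumes W: "open W" "W \<subseteq> D" and s: "sec W s" and c: "(U, \<phi>) \<in> T" and x: "x \<in> W" "x \<in> U"
  shows "\<phi> x (nabla01 j s x) $ \<alpha> = dzbar j (\<lambda>y. \<phi> y (s y) $ \<alpha>) x"
proof -
  define V \<phi>' where "V = fst (chart_at x)" and "\<phi>' = coord_at x"
  have "x \<in> D" using W x by auto
  then have V: "(V, \<phi>') \<in> T" "x \<in> V" using chart_at by (auto simp: V_def \<phi>'_def)
  obtain g :: "complex^'n \<Rightarrow> complex^'r^'r" where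
    g: "\<And>\<alpha> \<beta>. holomorphic_several_on (V \<inter> U) (\<lambda>x. g x $ \<alpha> $ \<beta>)"
    and t: "\<And>x a. x \<in> V \<inter> U \<Longrightarrow> a \<in> E x \<Longrightarrow> \<phi> x a = g x *v \<phi>' x a"
    using chart_transition[OF V(1) c] by metis
  have o: "open (W \<inter> V \<inter> U)" using W chart_open[OF V(1)] chart_open[OF c] by blast
  have xm: "x \<in> W \<inter> V \<inter> U" using x V by blast
  have d1: "(\<lambda>x. g x $ \<alpha> $ \<beta>) differentiable (at x)" for \<beta>
    using holomorphic_several_onD(1)[OF g] xm by blast
  have d2: "(\<lambda>x. \<phi>' x (s x) $ \<beta>) differentiable (at x)" for \<beta>
  proof (rule smooth_on_differentiable)
    show "smooth_on (W \<inter> V) (\<lambda>x. \<phi>' x (s x) $ \<beta>)"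
      by (intro smooth_on_vec_nth sec_coord[OF s V(1)]) (use W chart_open[OF V(1)] in blast)
    show "x \<in> W \<inter> V" using xm by blast
  qed
  have "dzbar j (\<lambda>y. \<phi> y (s y) $ \<alpha>) x = dzbar j (\<lambda>y. \<Sum>\<beta>\<in>UNIV. g y $ \<alpha> $ \<beta> * \<phi>' y (s y) $ \<beta>) x"
    by (rule dzbar_cong_open[OF o xm]) (use t sec_fibre[OF s] in \<open>auto simp: matrix_vector_mult_def\<close>)
  also have "\<dots> = (\<Sum>\<beta>\<in>UNIV. dzbar j (\<lambda>y. g y $ \<alpha> $ \<beta> * \<phi>' y (s y) $ \<beta>) x)"
    by (rule dzbar_sum) (intro differentiable_mult d1 d2)
  also have "\<dots> = (\<Sum>\<beta>\<in>UNIV. g x $ \<alpha> $ \<beta> * dzbar j (\<lambda>y. \<phi>' y (s y) $ \<beta>) x)"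
    using xm by (intro sum.cong refl) (auto simp: dzbar_mult[OF d1 d2] dzbar_holomorphic[OF g])
  also have "\<dots> = (g x *v \<phi>' x (nabla01 j s x)) $ \<alpha>"
    unfolding nabla01_def using coord_frame[OF V]
    by (simp add: matrix_vector_mult_def \<phi>'_def)
  also have "\<dots> = \<phi> x (nabla01 j s x) $ \<alpha>"
    using t[of x "nabla01 j s x"] xm nabla_fibre[OF \<open>x \<in> D\<close>] by simp
  finally show ?thesis by simp
qed

text \<open>By definition this holds when \<open>t\<close> is a frame section of the chosen chart; the product rule extends it to
  all combinations of frame sections.\<close>

lemma nabla_compatible:
  assumes W: "open W" "W \<subseteq> D" and s: "sec W s" and t: "sec W t" and x: "x \<in> W"
  shows "dz j (\<lambda>y. h y (s y) (t y)) x = h x (nabla10 j s x) (t x) + h x (s x) (nabla01 j t x)"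
proof -
  define V \<phi> where "V = fst (chart_at x)" and "\<phi> = coord_at x"
  have D: "x \<in> D" using W x by auto
  then have V: "(V, \<phi>) \<in> T" "x \<in> V" using chart_at by (auto simp: V_def \<phi>_def)
  let ?e = "\<lambda>\<beta> y. frame \<phi> (axis \<beta> 1) y"
  let ?t = "\<lambda>\<beta> y. \<phi> y (t y) $ \<beta>"
  have o: "open (W \<inter> V)" using W chart_open[OF V(1)] by blast
  have sub: "W \<inter> V \<subseteq> D" "x \<in> W \<inter> V" using W V x by auto
  have st: "smooth_on (W \<inter> V) (?t \<beta>)" for \<beta>
    by (intro smooth_on_vec_nth sec_coord[OF t V(1)] o)
  note dt = smooth_on_differentiable[OF st sub(2)]
  note dct = smooth_on_differentiable[OF smooth_on_cnj[OF o st] sub(2)]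
  have "smooth_on (W \<inter> V) (\<lambda>y. h y (s y) (?e \<beta> y))" for \<beta>
    by (intro smooth_on_metric o sub sec_subset[OF s] sec_subset[OF sec_frame[OF V(1)]]) auto
  note dh = smooth_on_differentiable[OF this sub(2)]
  have "dz j (\<lambda>y. h y (s y) (t y)) x = dz j (\<lambda>y. \<Sum>\<beta>\<in>UNIV. cnj (?t \<beta> y) * h y (s y) (?e \<beta> y)) x"
    by (rule dz_cong_open[OF o sub(2)])
       (use metric_frame_expansion(2)[OF V(1) _ sec_fibre[OF t] sec_fibre[OF s]] in auto)
  also have "\<dots> = (\<Sum>\<beta>\<in>UNIV. dz j (\<lambda>y. cnj (?t \<beta> y) * h y (s y) (?e \<beta> y)) x)"
    by (rule dz_sum) (intro differentiable_mult dct dh)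
  also have "\<dots> = (\<Sum>\<beta>\<in>UNIV. cnj (dzbar j (?t \<beta>) x) * h x (s x) (?e \<beta> x) + cnj (?t \<beta> x) * dz j (\<lambda>y. h y (s y) (?e \<beta> y)) x)"
    by (intro sum.cong refl) (simp add: dz_mult[OF dct dh] dz_cnj[OF dt])
  also have "\<dots> = (\<Sum>\<beta>\<in>UNIV. cnj (\<phi> x (nabla01 j t x) $ \<beta>) * h x (s x) (?e \<beta> x))
      + (\<Sum>\<beta>\<in>UNIV. cnj (?t \<beta> x) * h x (nabla10 j s x) (?e \<beta> x))"
    by (simp add: sum.distrib nabla01_coord[OF W t V(1) x V(2)] nabla10_metric[OF D, folded \<phi>_def])
  also have "\<dots> = h x (s x) (nabla01 j t x) + h x (nabla10 j s x) (t x)"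
    using metric_frame_expansion(2)[OF V nabla_fibre(1)[OF D] sec_fibre[OF s x]]
      metric_frame_expansion(2)[OF V sec_fibre[OF t x] nabla_fibre(2)[OF D]] by simp
  finally show ?thesis by simp
qed

lemma nabla01_frame:
  assumes c: "(U, \<phi>) \<in> T" "x \<in> U"
  shows "nabla01 j (frame \<phi> b) x = 0"
proof -
  note D = chart_D[OF c]
  note o = chart_open[OF c(1)]
  have "\<phi> x (nabla01 j (frame \<phi> b) x) $ \<alpha> = dzbar j (\<lambda>y. b $ \<alpha>) x" for \<alpha>
    unfolding nabla01_coord[OF o chart_subset[OF c(1)] sec_frame[OF c(1)] c(1) c(2) c(2)]
    by (rule dzbar_cong_open[OF o c(2)]) (simp add: coord_frame[OF c(1)])
  then have "\<phi> x (nabla01 j (frame \<phi> b) x) = \<phi> x 0"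
    by (simp add: vec_eq_iff coord_zero[OF c])
  then show ?thesis
    by (rule coord_inj[OF c nabla_fibre(1)[OF D] fibre_closed(1)[OF D]])
qed

lemma nabla_sec:
  assumes W: "open W" "W \<subseteq> D" and s: "sec W s"
  shows "sec W (nabla01 j s)" "sec W (nabla10 j s)"
proof -
  have "sec (W \<inter> U) (nabla01 j s) \<and> sec (W \<inter> U) (nabla10 j s)" if c: "(U, \<phi>) \<in> T" for U \<phi>
  proof
    have o: "open (W \<inter> U)" using W chart_open[OF c] by blast
    have sub: "W \<inter> U \<subseteq> D" using W by auto
    have sU: "sec (W \<inter> U) s" by (rule sec_subset[OF s]) auto
    have fU: "sec (W \<inter> U) (frame \<phi> b)" for b by (rule sec_subset[OF sec_frame[OF c]]) auto
    show "sec (W \<inter> U) (nabla01 j s)"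
    proof (rule sec_in_chart[OF c o])
      show "nabla01 j s x \<in> E x" if "x \<in> W \<inter> U" for x using nabla_fibre sub that by blast
      fix \<alpha>
      have "smooth_on (W \<inter> U) (\<lambda>y. \<phi> y (s y) $ \<alpha>)" by (intro smooth_on_vec_nth sec_coord[OF s c] o)
      then have "smooth_on (W \<inter> U) (dzbar j (\<lambda>y. \<phi> y (s y) $ \<alpha>))" by (rule smooth_on_dzbar[OF o])
      then show "smooth_on (W \<inter> U) (\<lambda>x. \<phi> x (nabla01 j s x) $ \<alpha>)"
        by (subst smooth_on_cong[OF o]) (auto simp: nabla01_coord[OF W s c])
    qed auto
    show "sec (W \<inter> U) (nabla10 j s)"
    proof (rule sec_by_metric[OF c o])
      show "nabla10 j s x \<in> E x" if "x \<in> W \<inter> U" for x using nabla_fibre sub that by blast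
      fix \<beta>
      have eq: "h x (nabla10 j s x) (frame \<phi> (axis \<beta> 1) x) = dz j (\<lambda>y. h y (s y) (frame \<phi> (axis \<beta> 1) y)) x"
        if "x \<in> W \<inter> U" for x
      proof -
        have "x \<in> D" "x \<in> U" using that sub by auto
        then show ?thesis
          using nabla_compatible[OF o sub sU fU that, of j "axis \<beta> 1"] metric_zero(2)[OF _ sec_fibre[OF sU that]]
          by (simp add: nabla01_frame[OF c])
      qed
      have "smooth_on (W \<inter> U) (\<lambda>y. h y (s y) (frame \<phi> (axis \<beta> 1) y))"
        by (rule smooth_on_metric[OF o sub sU fU])
      then have "smooth_on (W \<inter> U) (dz j (\<lambda>y. h y (s y) (frame \<phi> (axis \<beta> 1) y)))" by (rule smooth_on_dz[OF o])
      then show "smooth_on (W \<inter> U) (\<lambda>x. h x (nabla10 j s x) (frame \<phi> (axis \<beta> 1) x))"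
        by (subst smooth_on_cong[OF o]) (auto simp: eq)
    qed auto
  qed
  moreover have "\<exists>V. open V \<and> x \<in> V \<and> (\<exists>U \<phi>. (U, \<phi>) \<in> T \<and> V = W \<inter> U)" if x: "x \<in> W" for x
  proof -
    have "x \<in> D" using W x by auto
    then obtain U \<phi> where "(U, \<phi>) \<in> T" "x \<in> U" using chart_exists by metis
    then show ?thesis using W x chart_open by (intro exI[of _ "W \<inter> U"]) auto
  qed
  ultimately have "\<exists>V. open V \<and> x \<in> V \<and> sec V (nabla01 j s) \<and> sec V (nabla10 j s)" if "x \<in> W" for x
    using that by metis
  then show "sec W (nabla01 j s)" "sec W (nabla10 j s)"
    by (metis (mono_tags) sec_local)+
qed

text \<open>The remaining axioms are pointwise identities between vectors, which are checked on pairings with a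
  frame for the (1,0)-part and on coordinates for the (0,1)-part.\<close>

theorem chern_connection_exists: "chern_connection D E T h nabla10 nabla01"
proof -
  have "smooth_connection D E T nabla10 nabla01"
    unfolding smooth_connection_def
  proof (intro allI impI, elim conjE)
    fix W s j assume W: "open W" "W \<subseteq> D" and s: "sec W s"
    have diff: "(\<lambda>y. h y (s y) (t y)) differentiable (at x)" if "sec V s" "sec V t" "open V" "V \<subseteq> D" "x \<in> V" for s t V x
      using smooth_on_differentiable[OF smooth_on_metric] that by blast
    have cdiff: "(\<lambda>y. \<phi> y (s y) $ \<alpha>) differentiable (at x)"
      if "sec W s" "(U, \<phi>) \<in> T" "x \<in> W" "x \<in> U" for s x U \<phi> \<alpha>
    proof (rule smooth_on_differentiable)
      show "smooth_on (W \<inter> U) (\<lambda>y. \<phi> y (s y) $ \<alpha>)"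
        by (intro smooth_on_vec_nth sec_coord that) (use W chart_open[OF that(2)] in blast)
    qed (use that in auto)
    have eq10: "nabla10 j t x = a"
      if t: "x \<in> W" "a \<in> E x"
        "\<And>U \<phi> \<beta>. (U, \<phi>) \<in> T \<Longrightarrow> x \<in> U \<Longrightarrow> dz j (\<lambda>y. h y (t y) (frame \<phi> (axis \<beta> 1) y)) x = h x a (frame \<phi> (axis \<beta> 1) x)"
      for t x a
    proof -
      have x: "x \<in> D" using W t(1) by auto
      show ?thesis
        by (rule metric_eq_on_frame[OF chart_at[OF x] nabla_fibre(2)[OF x] t(2)])
           (simp add: nabla10_metric[OF x] t(3)[OF chart_at[OF x]])
    qed
    have eq01: "nabla01 j t x = a"
      if t: "x \<in> W" "a \<in> E x" 
        "\<And>U \<phi> \<alpha>. (U, \<phi>) \<in> T \<Longrightarrow> x \<in> U \<Longrightarrow> dzbar j (\<lambda>y. \<phi> y (t y) $ \<alpha>) x = \<phi> x a $ \<alpha>"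
      for t x a
    proof -
      have x: "x \<in> D" using W t(1) by auto
      show ?thesis
        by (rule coord_inj[OF chart_at[OF x] nabla_fibre(1)[OF x] t(2)])
           (simp add: vec_eq_iff nabla01_def coord_frame[OF chart_at[OF x]] t(3)[OF chart_at[OF x]])
    qed
    have dz10: "dz j (\<lambda>y. h y (s y) (frame \<phi> (axis \<beta> 1) y)) x = h x (nabla10 j s x) (frame \<phi> (axis \<beta> 1) x)"
      if c: "sec W s" "(U, \<phi>) \<in> T" "x \<in> U" "x \<in> W" for s U \<phi> \<beta> x
    proof -
      have o: "open (W \<inter> U)" using W chart_open[OF c(2)] by blast
      have D: "x \<in> D" using W c by auto
      show ?thesis
        using nabla_compatible[OF o _ sec_subset[OF c(1)] sec_subset[OF sec_frame[OF c(2)]], of x j "axis \<beta> 1"]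
          W c by (simp add: nabla01_frame[OF c(2,3)] metric_zero[OF D sec_fibre[OF c(1,4)]] le_infI1)
    qed
    have fd: "(\<lambda>y. h y (s y) (frame \<phi> (axis \<beta> 1) y)) differentiable (at x)"
      if c: "sec W s" "(U, \<phi>) \<in> T" "x \<in> U" "x \<in> W" for s U \<phi> \<beta> x
      by (rule diff[of "W \<inter> U"]) (use c W chart_open[OF c(2)] sec_subset[OF c(1)] sec_subset[OF sec_frame[OF c(2)]] in auto)
    show "sec W (nabla10 j s) \<and> sec W (nabla01 j s) \<and>
        (\<forall>t. sec W t \<longrightarrow> (\<forall>x\<in>W. nabla10 j (\<lambda>y. s y + t y) x = nabla10 j s x + nabla10 j t x \<and>
              nabla01 j (\<lambda>y. s y + t y) x = nabla01 j s x + nabla01 j t x)) \<and>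
        (\<forall>t. (\<forall>x\<in>W. t x = s x) \<longrightarrow> (\<forall>x\<in>W. nabla10 j t x = nabla10 j s x \<and> nabla01 j t x = nabla01 j s x)) \<and>
        (\<forall>g. smooth_on W g \<longrightarrow>
           (\<forall>x\<in>W. nabla10 j (\<lambda>y. g y *\<^sub>C s y) x = dz j g x *\<^sub>C s x + g x *\<^sub>C nabla10 j s x \<and>
                    nabla01 j (\<lambda>y. g y *\<^sub>C s y) x = dzbar j g x *\<^sub>C s x + g x *\<^sub>C nabla01 j s x))"
    proof (intro conjI allI impI ballI)
      show "sec W (nabla10 j s)" "sec W (nabla01 j s)" using nabla_sec[OF W s] by blast+
    next
      fix t x assume t: "sec W t" and x: "x \<in> W"
      then have D: "x \<in> D" using W by auto
      note f = sec_fibre[OF s x] sec_fibre[OF t x] nabla_fibre[OF D] fibre_closed[OF D]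
      note c = nabla01_coord[OF W s _ x] nabla01_coord[OF W t _ x]
      show "nabla10 j (\<lambda>y. s y + t y) x = nabla10 j s x + nabla10 j t x"
      proof (rule eq10[OF x])
        show "nabla10 j s x + nabla10 j t x \<in> E x" by (simp add: f)
        fix U \<phi> \<beta> assume U: "(U, \<phi>) \<in> T" "x \<in> U"
        let ?e = "frame \<phi> (axis \<beta> 1)"
        have o: "open (W \<inter> U)" "x \<in> W \<inter> U" using W x U chart_open[OF U(1)] by auto
        have "dz j (\<lambda>y. h y (s y + t y) (?e y)) x = dz j (\<lambda>y. h y (s y) (?e y) + h y (t y) (?e y)) x"
          by (rule dz_cong_open[OF o], rule metric_add)
             (use W sec_fibre[OF s] sec_fibre[OF t] frame_fibre[OF U(1)] in auto)
        also have "\<dots> = h x (nabla10 j s x) (?e x) + h x (nabla10 j t x) (?e x)"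
          by (simp add: dz_add[OF fd[OF s U x] fd[OF t U x]] dz10[OF s U x] dz10[OF t U x])
        also have "\<dots> = h x (nabla10 j s x + nabla10 j t x) (?e x)"
          using metric_add[OF D] f frame_fibre[OF U] by simp
        finally show "dz j (\<lambda>y. h y (s y + t y) (?e y)) x = h x (nabla10 j s x + nabla10 j t x) (?e x)" .
      qed
      show "nabla01 j (\<lambda>y. s y + t y) x = nabla01 j s x + nabla01 j t x"
      proof (rule eq01[OF x])
        show "nabla01 j s x + nabla01 j t x \<in> E x" by (simp add: f)
        fix U \<phi> \<alpha> assume U: "(U, \<phi>) \<in> T" "x \<in> U"
        have o: "open (W \<inter> U)" "x \<in> W \<inter> U" using W x U chart_open[OF U(1)] by auto
        have "dzbar j (\<lambda>y. \<phi> y (s y + t y) $ \<alpha>) x = dzbar j (\<lambda>y. \<phi> y (s y) $ \<alpha> + \<phi> y (t y) $ \<alpha>) x"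
          by (rule dzbar_cong_open[OF o])
             (use sec_fibre[OF s] sec_fibre[OF t] in \<open>auto simp: coord_add[OF U(1)]\<close>)
        also have "\<dots> = \<phi> x (nabla01 j s x + nabla01 j t x) $ \<alpha>"
          by (simp add: dzbar_add[OF cdiff[OF s U(1) x U(2)] cdiff[OF t U(1) x U(2)]] c[OF U] coord_add[OF U] f)
        finally show "dzbar j (\<lambda>y. \<phi> y (s y + t y) $ \<alpha>) x = \<phi> x (nabla01 j s x + nabla01 j t x) $ \<alpha>" .
      qed
    next
      fix t x assume t: "\<forall>x\<in>W. t x = s x" and x: "x \<in> W"
      show "nabla10 j t x = nabla10 j s x"
      proof -
        have "dz j (\<lambda>y. h y (t y) (frame \<phi> b y)) x = dz j (\<lambda>y. h y (s y) (frame \<phi> b y)) x" for \<phi> b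
          by (rule dz_cong_open[OF W(1) x]) (use t in simp)
        then show ?thesis unfolding nabla10_def by simp
      qed
      show "nabla01 j t x = nabla01 j s x"
      proof -
        have "dzbar j (\<lambda>y. \<phi> y (t y) $ \<alpha>) x = dzbar j (\<lambda>y. \<phi> y (s y) $ \<alpha>) x" for \<phi> :: "complex^'n \<Rightarrow> 'v \<Rightarrow> complex^'r" and \<alpha>
          by (rule dzbar_cong_open[OF W(1) x]) (use t in simp)
        then show ?thesis unfolding nabla01_def by simp
      qed
    next
      fix g :: "complex^'n \<Rightarrow> complex" and x assume g: "smooth_on W g" and x: "x \<in> W"
      then have D: "x \<in> D" using W by auto
      note gd = smooth_on_differentiable[OF g x]
      note f = sec_fibre[OF s x] nabla_fibre[OF D] fibre_closed[OF D]
      show "nabla10 j (\<lambda>y. g y *\<^sub>C s y) x = dz j g x *\<^sub>C s x + g x *\<^sub>C nabla10 j s x"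
      proof (rule eq10[OF x])
        show "dz j g x *\<^sub>C s x + g x *\<^sub>C nabla10 j s x \<in> E x" by (simp add: f)
        fix U \<phi> \<beta> assume U: "(U, \<phi>) \<in> T" "x \<in> U"
        let ?e = "frame \<phi> (axis \<beta> 1)"
        have o: "open (W \<inter> U)" "x \<in> W \<inter> U" using W x U chart_open[OF U(1)] by auto
        have "dz j (\<lambda>y. h y (g y *\<^sub>C s y) (?e y)) x = dz j (\<lambda>y. g y * h y (s y) (?e y)) x"
          by (rule dz_cong_open[OF o], rule metric_scale)
             (use W sec_fibre[OF s] frame_fibre[OF U(1)] in auto)
        also have "\<dots> = dz j g x * h x (s x) (?e x) + g x * h x (nabla10 j s x) (?e x)"
          by (simp add: dz_mult[OF gd fd[OF s U x]] dz10[OF s U x])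
        also have "\<dots> = h x (dz j g x *\<^sub>C s x + g x *\<^sub>C nabla10 j s x) (?e x)"
          using f frame_fibre[OF U] by (simp add: metric_add[OF D] metric_scale[OF D])
        finally show "dz j (\<lambda>y. h y (g y *\<^sub>C s y) (?e y)) x = h x (dz j g x *\<^sub>C s x + g x *\<^sub>C nabla10 j s x) (?e x)" .
      qed
      show "nabla01 j (\<lambda>y. g y *\<^sub>C s y) x = dzbar j g x *\<^sub>C s x + g x *\<^sub>C nabla01 j s x"
      proof (rule eq01[OF x])
        show "dzbar j g x *\<^sub>C s x + g x *\<^sub>C nabla01 j s x \<in> E x" by (simp add: f)
        fix U \<phi> \<alpha> assume U: "(U, \<phi>) \<in> T" "x \<in> U"
        have o: "open (W \<inter> U)" "x \<in> W \<inter> U" using W x U chart_open[OF U(1)] by auto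
        have "dzbar j (\<lambda>y. \<phi> y (g y *\<^sub>C s y) $ \<alpha>) x = dzbar j (\<lambda>y. g y * \<phi> y (s y) $ \<alpha>) x"
          by (rule dzbar_cong_open[OF o]) (use sec_fibre[OF s] in \<open>auto simp: coord_scale[OF U(1)]\<close>)
        also have "\<dots> = \<phi> x (dzbar j g x *\<^sub>C s x + g x *\<^sub>C nabla01 j s x) $ \<alpha>"
          by (simp add: dzbar_mult[OF gd cdiff[OF s U(1) x U(2)]] nabla01_coord[OF W s U(1) x U(2)]
              coord_add[OF U] coord_scale[OF U] f)
        finally show "dzbar j (\<lambda>y. \<phi> y (g y *\<^sub>C s y) $ \<alpha>) x = \<phi> x (dzbar j g x *\<^sub>C s x + g x *\<^sub>C nabla01 j s x) $ \<alpha>" .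
      qed
    qed
  qed
  then show ?thesis
    unfolding chern_connection_def
    by (intro conjI allI impI ballI) (auto simp: nabla01_coord nabla_compatible)
qed

subsection \<open>Rules for an arbitrary Chern connection\<close>

context
  fixes N1 N2 assumes conn: "chern_connection D E T h N1 N2"
begin

lemma
  fixes g :: "complex^'n \<Rightarrow> complex"
  assumes W: "open W" "W \<subseteq> D" "sec W s"
  shows conn_sec: "sec W (N1 j s)" "sec W (N2 j s)"
    and conn_add: "sec W t \<Longrightarrow> x \<in> W \<Longrightarrow> N1 j (\<lambda>y. s y + t y) x = N1 j s x + N1 j t x"
      "sec W t \<Longrightarrow> x \<in> W \<Longrightarrow> N2 j (\<lambda>y. s y + t y) x = N2 j s x + N2 j t x"
    and conn_local: "(\<And>x. x \<in> W \<Longrightarrow> t x = s x) \<Longrightarrow> x \<in> W \<Longrightarrow> N1 j t x = N1 j s x"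
      "(\<And>x. x \<in> W \<Longrightarrow> t x = s x) \<Longrightarrow> x \<in> W \<Longrightarrow> N2 j t x = N2 j s x"
    and conn_leibniz: "smooth_on W g \<Longrightarrow> x \<in> W \<Longrightarrow> N1 j (\<lambda>y. g y *\<^sub>C s y) x = dz j g x *\<^sub>C s x + g x *\<^sub>C N1 j s x"
      "smooth_on W g \<Longrightarrow> x \<in> W \<Longrightarrow> N2 j (\<lambda>y. g y *\<^sub>C s y) x = dzbar j g x *\<^sub>C s x + g x *\<^sub>C N2 j s x"
    and conn_coord: "(U, \<phi>) \<in> T \<Longrightarrow> x \<in> W \<Longrightarrow> x \<in> U \<Longrightarrow> \<phi> x (N2 j s x) $ \<alpha> = dzbar j (\<lambda>y. \<phi> y (s y) $ \<alpha>) x"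
    and conn_dz: "sec W t \<Longrightarrow> x \<in> W \<Longrightarrow> dz j (\<lambda>y. h y (s y) (t y)) x = h x (N1 j s x) (t x) + h x (s x) (N2 j t x)"
proof -
  have "smooth_connection D E T N1 N2" using conn by (simp add: chern_connection_def)
  note * = this[unfolded smooth_connection_def, rule_format, OF conjI[OF W(1) conjI[OF W(2,3)]], of j]
  show "sec W (N1 j s)" "sec W (N2 j s)" using * by blast+
  show "sec W t \<Longrightarrow> x \<in> W \<Longrightarrow> N1 j (\<lambda>y. s y + t y) x = N1 j s x + N1 j t x"
    "sec W t \<Longrightarrow> x \<in> W \<Longrightarrow> N2 j (\<lambda>y. s y + t y) x = N2 j s x + N2 j t x" using * by blast+
  show "(\<And>x. x \<in> W \<Longrightarrow> t x = s x) \<Longrightarrow> x \<in> W \<Longrightarrow> N1 j t x = N1 j s x"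
    "(\<And>x. x \<in> W \<Longrightarrow> t x = s x) \<Longrightarrow> x \<in> W \<Longrightarrow> N2 j t x = N2 j s x" using * by blast+
  show "smooth_on W g \<Longrightarrow> x \<in> W \<Longrightarrow> N1 j (\<lambda>y. g y *\<^sub>C s y) x = dz j g x *\<^sub>C s x + g x *\<^sub>C N1 j s x"
    "smooth_on W g \<Longrightarrow> x \<in> W \<Longrightarrow> N2 j (\<lambda>y. g y *\<^sub>C s y) x = dzbar j g x *\<^sub>C s x + g x *\<^sub>C N2 j s x" using * by blast+
  have c: "\<forall>W s j. open W \<and> W \<subseteq> D \<and> sec W s \<longrightarrow>
        (\<forall>(U, \<phi>)\<in>T. \<forall>x\<in>W \<inter> U. \<forall>\<alpha>. \<phi> x (N2 j s x) $ \<alpha> = dzbar j (\<lambda>y. \<phi> y (s y) $ \<alpha>) x) \<and>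
        (\<forall>t. sec W t \<longrightarrow> (\<forall>x\<in>W. dz j (\<lambda>y. h y (s y) (t y)) x = h x (N1 j s x) (t x) + h x (s x) (N2 j t x)))"
    using conn unfolding chern_connection_def by (rule conjunct2)
  note ** = c[rule_format, OF conjI[OF W(1) conjI[OF W(2,3)]], of j]
  show "\<phi> x (N2 j s x) $ \<alpha> = dzbar j (\<lambda>y. \<phi> y (s y) $ \<alpha>) x" if "(U, \<phi>) \<in> T" "x \<in> W" "x \<in> U"
    using bspec[OF conjunct1[OF **] that(1)] that by simp
  show "sec W t \<Longrightarrow> x \<in> W \<Longrightarrow> dz j (\<lambda>y. h y (s y) (t y)) x = h x (N1 j s x) (t x) + h x (s x) (N2 j t x)"
    using conjunct2[OF **] by blast
qed

lemma conn_dzbar: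
  assumes W: "open W" "W \<subseteq> D" "sec W s" "sec W t" "x \<in> W"
  shows "dzbar j (\<lambda>y. h y (s y) (t y)) x = h x (N2 j s x) (t x) + h x (s x) (N1 j t x)"
proof -
  have D: "x \<in> D" using W by auto
  have "dzbar j (\<lambda>y. h y (s y) (t y)) x = dzbar j (\<lambda>y. cnj (h y (t y) (s y))) x"
    by (rule dzbar_cong_open[OF W(1,5)], rule metric_cnj)
       (use W sec_fibre[OF W(3)] sec_fibre[OF W(4)] in auto)
  also have "\<dots> = cnj (dz j (\<lambda>y. h y (t y) (s y)) x)"
    by (rule dzbar_cnj[OF smooth_on_differentiable[OF smooth_on_metric[OF W(1,2,4,3)] W(5)]])
  also have "\<dots> = cnj (h x (N1 j t x) (s x)) + cnj (h x (t x) (N2 j s x))"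
    by (simp add: conn_dz[OF W(1,2,4,3,5)])
  also have "\<dots> = h x (s x) (N1 j t x) + h x (N2 j s x) (t x)"
    using metric_cnj[OF D] sec_fibre[OF W(3,5)] sec_fibre[OF W(4,5)] sec_fibre[OF conn_sec(1)[OF W(1,2,4)] W(5)]
      sec_fibre[OF conn_sec(2)[OF W(1,2,3)] W(5)] by metis
  finally show ?thesis by simp
qed

lemma conn_frame:
  assumes c: "(U, \<phi>) \<in> T" "x \<in> U"
  shows "N2 j (frame \<phi> b) x = 0"
proof -
  note D = chart_D[OF c]
  note o = chart_open[OF c(1)] chart_subset[OF c(1)] sec_frame[OF c(1)]
  have "\<phi> x (N2 j (frame \<phi> b) x) $ \<alpha> = dzbar j (\<lambda>y. b $ \<alpha>) x" for \<alpha>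
    unfolding conn_coord[OF o c(1) c(2) c(2)]
    by (rule dzbar_cong_open[OF o(1) c(2)]) (simp add: coord_frame[OF c(1)])
  then have "\<phi> x (N2 j (frame \<phi> b) x) = \<phi> x 0"
    by (simp add: vec_eq_iff coord_zero[OF c])
  then show ?thesis
    by (rule coord_inj[OF c sec_fibre[OF conn_sec(2)[OF o] c(2)] fibre_closed(1)[OF D]])
qed

text \<open>Expand both mixed derivatives of \<open>h (s, t)\<close> by compatibility with the metric. They agree by Schwarz, and the
  terms with one derivative on each factor cancel.\<close>

lemma commutator_adjoint:
  assumes W: "open W" "W \<subseteq> D" and s: "sec W s" and t: "sec W t" and x: "x \<in> W"
    and hol: "\<And>j y. y \<in> W \<Longrightarrow> N2 j t y = 0"
  shows "h x (N1 j (N2 k s) x - N2 k (N1 j s) x) (t x) = - h x (s x) (N2 j (N1 k t) x)"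
proof -
  have D: "x \<in> D" using W x by auto
  let ?F = "\<lambda>y. h y (s y) (t y)"
  note S = smooth_on_metric[OF W]
  note C = conn_sec(1)[OF W] conn_sec(2)[OF W]
  have z: "h y (u y) (N2 j t y) = 0" if "sec W u" "y \<in> W" for u y j
    using metric_zero(2)[of y "u y"] sec_fibre[OF that] that W by (auto simp: hol)
  have "dz j (dzbar k ?F) x = dz j (\<lambda>y. h y (N2 k s y) (t y) + h y (s y) (N1 k t y)) x"
    by (rule dz_cong_open[OF W(1) x]) (simp add: conn_dzbar[OF W s t])
  also have "\<dots> = h x (N1 j (N2 k s) x) (t x) + (h x (N1 j s x) (N1 k t x) + h x (s x) (N2 j (N1 k t) x))"
    by (simp add: dz_add[OF smooth_on_differentiable[OF S[OF C(2)[OF s] t] x] smooth_on_differentiable[OF S[OF s C(1)[OF t]] x]]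
        conn_dz[OF W C(2)[OF s] t x] conn_dz[OF W s C(1)[OF t] x] z[OF C(2)[OF s] x])
  finally have 1: "dz j (dzbar k ?F) x = h x (N1 j (N2 k s) x) (t x) + (h x (N1 j s x) (N1 k t x) + h x (s x) (N2 j (N1 k t) x))" .
  have "dzbar k (dz j ?F) x = dzbar k (\<lambda>y. h y (N1 j s y) (t y)) x"
    by (rule dzbar_cong_open[OF W(1) x]) (simp add: conn_dz[OF W s t] z[OF s])
  also have "\<dots> = h x (N2 k (N1 j s) x) (t x) + h x (N1 j s x) (N1 k t x)"
    by (rule conn_dzbar[OF W C(1)[OF s] t x])
  finally have "dzbar k (dz j ?F) x = h x (N2 k (N1 j s) x) (t x) + h x (N1 j s x) (N1 k t x)" .
  with 1 dz_dzbar_commute[OF W(1) x S[OF s t], of j k]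
  have "h x (N1 j (N2 k s) x) (t x) - h x (N2 k (N1 j s) x) (t x) = - h x (s x) (N2 j (N1 k t) x)"
    by (simp add: algebra_simps)
  then show ?thesis
    using sec_fibre[OF C(1)[OF C(2)[OF s]] x] sec_fibre[OF C(2)[OF C(1)[OF s]] x] sec_fibre[OF t x]
    by (simp add: metric_diff_left[OF D])
qed

end

lemma chern_connection_unique:
  assumes N: "chern_connection D E T h N1 N2" and M: "chern_connection D E T h M1 M2"
    and W: "open W" "W \<subseteq> D" and s: "sec W s" and x: "x \<in> W"
  shows "N1 j s x = M1 j s x" "N2 j s x = M2 j s x"
proof -
  have D: "x \<in> D" using W x by auto
  obtain U \<phi> where c: "(U, \<phi>) \<in> T" "x \<in> U" using chart_exists[OF D] .
  note f = sec_fibre[OF conn_sec(1)[OF N W s] x] sec_fibre[OF conn_sec(1)[OF M W s] x]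
    sec_fibre[OF conn_sec(2)[OF N W s] x] sec_fibre[OF conn_sec(2)[OF M W s] x]
  show "N2 j s x = M2 j s x"
    by (rule coord_inj[OF c f(3,4)])
       (simp add: vec_eq_iff conn_coord[OF N W s c(1) x c(2)] conn_coord[OF M W s c(1) x c(2)])
  have o: "open (W \<inter> U)" "W \<inter> U \<subseteq> D" "x \<in> W \<inter> U" using W x c chart_open[OF c(1)] by auto
  have se: "sec (W \<inter> U) s" "sec (W \<inter> U) (frame \<phi> b)" for b
    by (rule sec_subset[OF s] sec_subset[OF sec_frame[OF c(1)]]; auto)+
  show "N1 j s x = M1 j s x"
  proof (rule metric_eq_on_frame[OF c f(1,2)])
    fix \<beta>
    show "h x (N1 j s x) (frame \<phi> (axis \<beta> 1) x) = h x (M1 j s x) (frame \<phi> (axis \<beta> 1) x)"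
      using conn_dz[OF N o(1,2) se(1) se(2) o(3), of j "axis \<beta> 1"] conn_dz[OF M o(1,2) se(1) se(2) o(3), of j "axis \<beta> 1"]
      by (simp add: conn_frame[OF N c] conn_frame[OF M c])
  qed
qed

text \<open>The right-hand side depends only on \<open>a\<close> and, by uniqueness of the Chern connection, not on the connection.
  This shows that the definite description of the curvature is meaningful, and it evaluates the curvature
  by derivatives of holomorphic frame sections only.\<close>

theorem curvature_pairing:
  assumes N: "chern_connection D E T h N1 N2" and c: "(U, \<phi>) \<in> T" "x \<in> U" and a: "a \<in> E x"
  shows "h x (chern_curvature D E T h x j k a) (frame \<phi> b x) = - h x a (N2 j (N1 k (frame \<phi> b)) x)"
proof -
  let ?P = "\<lambda>r. \<exists>N1 N2 W s. chern_connection D E T h N1 N2 \<and>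
        open W \<and> x \<in> W \<and> W \<subseteq> D \<and> sec W s \<and> s x = a \<and>
        r = N1 j (N2 k s) x - N2 k (N1 j s) x"
  note D = chart_D[OF c]
  note o = chart_open[OF c(1)] chart_subset[OF c(1)]
  have pair: "r \<in> E x \<and> (\<forall>b. h x r (frame \<phi> b x) = - h x a (N2 j (N1 k (frame \<phi> b)) x))" if "?P r" for r
  proof -
    from that obtain M1 M2 W s where M: "chern_connection D E T h M1 M2"
      and W: "open W" "x \<in> W" "W \<subseteq> D" and s: "sec W s" "s x = a"
      and r: "r = M1 j (M2 k s) x - M2 k (M1 j s) x" by blast
    have r_in: "r \<in> E x"
      unfolding r using sec_fibre[OF conn_sec(1)[OF M W(1,3) conn_sec(2)[OF M W(1,3) s(1)]] W(2)]
        sec_fibre[OF conn_sec(2)[OF M W(1,3) conn_sec(1)[OF M W(1,3) s(1)]] W(2)] fibre_closed(5)[OF D] by blast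
    have o': "open (W \<inter> U)" "W \<inter> U \<subseteq> D" "x \<in> W \<inter> U" using W c o by auto
    have se: "sec (W \<inter> U) s" "sec (W \<inter> U) (frame \<phi> b)" for b
      by (rule sec_subset[OF s(1)] sec_subset[OF sec_frame[OF c(1)]]; auto)+
    have "h x r (frame \<phi> b x) = - h x (s x) (M2 j (M1 k (frame \<phi> b)) x)" for b
      unfolding r by (rule commutator_adjoint[OF M o'(1,2) se(1) se(2) o'(3)]) (use conn_frame[OF M c(1)] in auto)
    moreover have "M2 j (M1 k (frame \<phi> b)) x = N2 j (N1 k (frame \<phi> b)) x" for b
    proof -
      note f = sec_frame[OF c(1), of b]
      have "M2 j (M1 k (frame \<phi> b)) x = M2 j (N1 k (frame \<phi> b)) x"
        by (rule conn_local(2)[OF M o conn_sec(1)[OF N o f] _ c(2)]) (rule chern_connection_unique(1)[OF M N o f])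
      also have "\<dots> = N2 j (N1 k (frame \<phi> b)) x"
        by (rule chern_connection_unique(2)[OF M N o conn_sec(1)[OF N o f] c(2)])
      finally show ?thesis .
    qed
    ultimately show ?thesis using r_in s(2) by simp
  qed
  have "\<exists>!r. ?P r"
  proof (rule ex_ex1I)
    show "\<exists>r. ?P r"
      using N o c(2) sec_frame[OF c(1), of "\<phi> x a"] frame_coord[OF c a] by blast
    show "r = r'" if "?P r" "?P r'" for r r'
      by (rule metric_eq_on_frame[OF c]) (use pair[OF that(1)] pair[OF that(2)] in auto)
  qed
  then have "?P (chern_curvature D E T h x j k a)"
    unfolding chern_curvature_def by (rule theI')
  with pair show ?thesis by blast
qed

end

section \<open>The curvature operator of the weight on top-degree forms\<close>

lemma scaleC_sum_left: "(\<Sum>i\<in>A. f i) *\<^sub>C (a::'v::complex_vector) = (\<Sum>i\<in>A. f i *\<^sub>C a)"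
  by (induction A rule: infinite_finite_induct) (auto simp: scaleC_add_left)

definition top_form :: "'v::zero \<Rightarrow> ('n, 'v) cform" where
  "top_form a I J = (if I = UNIV \<and> J = UNIV then a else 0)"

lemma pq_forms_at_top:
  fixes \<alpha> :: "('n::finite, 'v::complex_vector) cform"
  assumes "\<alpha> \<in> pq_forms_at CARD('n) CARD('n) F"
  shows "\<alpha> = top_form (\<alpha> UNIV UNIV)" "\<alpha> UNIV UNIV \<in> F"
proof -
  have "card I = CARD('n) \<longleftrightarrow> I = UNIV" for I :: "'n set"
    by (metis card_subset_eq finite subset_UNIV)
  then show "\<alpha> = top_form (\<alpha> UNIV UNIV)"
    using assms by (auto simp: fun_eq_iff top_form_def pq_forms_at_def)
  show "\<alpha> UNIV UNIV \<in> F" using assms by (auto simp: pq_forms_at_def forms_at_def)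
qed

lemma top_form_pq:
  assumes "0 \<in> F" "a \<in> F"
  shows "(top_form a :: ('n::finite, 'v::complex_vector) cform) \<in> pq_forms_at CARD('n) CARD('n) F"
  using assms by (auto simp: pq_forms_at_def forms_at_def top_form_def)

lemma wedge_11_diagonal:
  assumes "\<And>j k. j \<noteq> k \<Longrightarrow> A j k = 0"
  shows "wedge_11 A \<alpha> I J = (\<Sum>j\<in>UNIV. A j j *\<^sub>C wedge_dz j (wedge_dzbar j \<alpha>) I J)"
proof -
  have "(\<Sum>k\<in>UNIV. A j k *\<^sub>C wedge_dz j (wedge_dzbar k \<alpha>) I J) = A j j *\<^sub>C wedge_dz j (wedge_dzbar j \<alpha>) I J" for j
    by (subst sum.remove[of UNIV j]) (auto intro!: sum.neutral simp: assms)
  then show ?thesis by (simp add: wedge_11_def)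
qed

text \<open>Sorting \<open>dz\<^sub>j\<close> and \<open>d\<bar>z\<^sub>j\<close> into their places costs the same sign twice; what remains is the sign of
  moving \<open>d\<bar>z\<^sub>j\<close> past the other \<open>n - 1\<close> factors \<open>dz\<^sub>i\<close>, which does not depend on \<open>j\<close>.\<close>

lemma wedge_pair_top:
  fixes \<beta> :: "('n::{finite,linorder}, 'v::complex_vector) cform"
  shows "wedge_dz j (wedge_dzbar j \<beta>) UNIV UNIV = (-1) ^ (CARD('n) - 1) *\<^sub>C \<beta> (UNIV - {j}) (UNIV - {j})"
proof -
  have "card (UNIV - {j} :: 'n set) = CARD('n) - 1" by (simp add: card_Diff_singleton)
  then have "wedge_dz j (wedge_dzbar j \<beta>) UNIV UNIV
     = ((-1) ^ card {i. i < j} * (-1) ^ (CARD('n) - 1 + card {i. i < j})) *\<^sub>C \<beta> (UNIV - {j}) (UNIV - {j})"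
    by (simp add: wedge_dz_def wedge_dzbar_def scaleC_scaleC)
  also have "(-1) ^ card {i. i < j} * (-1) ^ (CARD('n) - 1 + card {i. i < j}) = ((-1) ^ (CARD('n) - 1) :: complex)"
    unfolding power_add by (simp only: mult.left_commute[of "(-1) ^ card {i. i < j}"] power_mult_distrib[symmetric]) simp
  finally show ?thesis .
qed

lemma wedge_11_top_form:
  fixes a :: "'v::complex_vector"
  shows "wedge_11 A (top_form a :: ('n::{finite,linorder}, 'v) cform) = (\<lambda>I J. 0)"
proof -
  have "wedge_dzbar k (top_form a :: ('n, 'v) cform) = (\<lambda>I J. 0)" for k
    by (auto simp: fun_eq_iff wedge_dzbar_def top_form_def)
  moreover have "wedge_dz j (\<lambda>I J. 0 :: 'v) = (\<lambda>I J. 0)" for j :: 'n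
    by (auto simp: fun_eq_iff wedge_dz_def)
  ultimately show ?thesis by (intro ext) (simp add: wedge_11_def)
qed

lemma sum_complement_pairs:
  fixes g :: "'n::finite set \<Rightarrow> 'n set \<Rightarrow> 'b::comm_monoid_add"
  assumes "\<And>I J. \<not> (\<exists>j. I = UNIV - {j} \<and> J = UNIV - {j}) \<Longrightarrow> g I J = 0"
  shows "(\<Sum>I\<in>UNIV. \<Sum>J\<in>UNIV. g I J) = (\<Sum>j\<in>UNIV. g (UNIV - {j}) (UNIV - {j}))"
proof -
  let ?c = "\<lambda>j::'n. (UNIV - {j}, UNIV - {j})"
  have "(\<Sum>I\<in>UNIV. \<Sum>J\<in>UNIV. g I J) = (\<Sum>p\<in>UNIV. g (fst p) (snd p))"
    by (simp add: sum.cartesian_product case_prod_unfold)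
  also have "\<dots> = (\<Sum>p\<in>range ?c. g (fst p) (snd p))"
  proof (intro sum.mono_neutral_right ballI)
    fix p assume p: "p \<in> UNIV - range ?c"
    have "\<not> (\<exists>j. fst p = UNIV - {j} \<and> snd p = UNIV - {j})"
    proof
      assume "\<exists>j. fst p = UNIV - {j} \<and> snd p = UNIV - {j}"
      then obtain j where "p = ?c j" by (metis prod.collapse)
      with p show False by blast
    qed
    then show "g (fst p) (snd p) = 0" by (rule assms)
  qed auto
  also have "\<dots> = (\<Sum>j\<in>UNIV. g (UNIV - {j}) (UNIV - {j}))"
    by (subst sum.reindex) (auto simp: inj_on_def)
  finally show ?thesis .
qed

lemma form_inner_top:
  assumes z: "\<And>I J. H (\<beta> I J) 0 = 0"
  shows "form_inner H (\<beta> :: ('n::finite, 'v::complex_vector) cform) (top_form a) = H (\<beta> UNIV UNIV) a"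
proof -
  have "(\<Sum>J\<in>UNIV. H (\<beta> I J) (top_form a I J)) = (if I = UNIV then H (\<beta> UNIV UNIV) a else 0)" for I
  proof (cases "I = UNIV")
    case True
    then show ?thesis
      by (subst sum.remove[of UNIV UNIV]) (auto intro!: sum.neutral simp: top_form_def z)
  qed (auto intro!: sum.neutral simp: top_form_def z)
  then show ?thesis by (simp add: form_inner_def)
qed

text \<open>The value of \<open>\<Lambda>\<^sub>\<omega>\<close> on a top-degree form has this shape: the coefficient \<open>a\<close> at every
  \<open>dz\<^sub>I \<and> d\<bar>z\<^sub>I\<close> for which \<open>I\<close> omits exactly one index.\<close>

definition omit_form :: "'v::zero \<Rightarrow> ('n, 'v) cform" where
  "omit_form a I J = (if \<exists>j. I = UNIV - {j} \<and> J = UNIV - {j} then a else 0)"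

context
  fixes D :: "(complex^'n::{finite,linorder}) set"
    and E :: "complex^'n::{finite,linorder} \<Rightarrow> 'v::complex_vector set"
    and T :: "('n, 'r::finite, 'v) atlas"
    and h :: "complex^'n::{finite,linorder} \<Rightarrow> 'v \<Rightarrow> 'v \<Rightarrow> complex" and x :: "complex^'n::{finite,linorder}"
  assumes hb: "hermitian_bundle D E T h" and x: "x \<in> D"
begin

interpretation hermitian_bundle D E T h by (rule hb)

text \<open>Testing the adjointness relation against forms with a single nonzero coefficient determines every
  coefficient, so the adjoint is unique.\<close>

lemma Lambda_omega_eqI:
  fixes \<gamma> \<beta> :: "('n, 'v) cform"
  assumes "\<gamma> \<in> forms_at (E x)"
    and "\<And>\<alpha>. \<alpha> \<in> forms_at (E x) \<Longrightarrow> form_inner (h x) (wedge_11 omega_coeff \<alpha>) \<beta> = form_inner (h x) \<alpha> \<gamma>"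
  shows "Lambda_omega (E x) (h x) \<beta> = \<gamma>"
  unfolding Lambda_omega_def
proof (rule the_equality)
  show "\<gamma> \<in> forms_at (E x) \<and> (\<forall>\<alpha>\<in>forms_at (E x). form_inner (h x) (wedge_11 omega_coeff \<alpha>) \<beta> = form_inner (h x) \<alpha> \<gamma>)"
    using assms by blast
  fix \<delta> assume \<delta>: "\<delta> \<in> forms_at (E x) \<and> (\<forall>\<alpha>\<in>forms_at (E x). form_inner (h x) (wedge_11 omega_coeff \<alpha>) \<beta> = form_inner (h x) \<alpha> \<delta>)"
  have in_fibre: "\<gamma> I J \<in> E x" "\<delta> I J \<in> E x" for I J using assms(1) \<delta> by (auto simp: forms_at_def)
  show "\<delta> = \<gamma>"
  proof (intro ext)
    fix I0 J0 :: "'n set"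
    have "h x b (\<delta> I0 J0) = h x b (\<gamma> I0 J0)" if b: "b \<in> E x" for b
    proof -
      let ?\<alpha> = "\<lambda>(I::'n set) (J::'n set). if I = I0 \<and> J = J0 then b else 0"
      have single: "form_inner (h x) ?\<alpha> \<epsilon> = h x b (\<epsilon> I0 J0)" if "\<And>I J. \<epsilon> I J \<in> E x" for \<epsilon> :: "('n, 'v) cform"
      proof -
        have "(\<Sum>J\<in>UNIV. h x (?\<alpha> I J) (\<epsilon> I J)) = (if I = I0 then h x b (\<epsilon> I0 J0) else 0)" for I
        proof (cases "I = I0")
          case True
          then show ?thesis
            by (subst sum.remove[of UNIV J0]) (auto intro!: sum.neutral simp: metric_zero[OF x that])
        qed (auto intro!: sum.neutral simp: metric_zero[OF x that])
        then show ?thesis by (simp add: form_inner_def)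
      qed
      have "?\<alpha> \<in> forms_at (E x)" using b fibre_closed(1)[OF x] by (auto simp: forms_at_def)
      then have "form_inner (h x) ?\<alpha> \<delta> = form_inner (h x) ?\<alpha> \<gamma>" using \<delta> assms(2) by metis
      then show ?thesis using single in_fibre by metis
    qed
    then have "h x (\<delta> I0 J0 - \<gamma> I0 J0) (\<delta> I0 J0 - \<gamma> I0 J0) = 0"
      using in_fibre[of I0 J0] fibre_closed(5)[OF x in_fibre(2,1), of I0 J0] by (simp add: metric_diff_right[OF x])
    then show "\<delta> I0 J0 = \<gamma> I0 J0"
      using metric_pos[OF x fibre_closed(5)[OF x in_fibre(2,1)] fibre_closed(5)[OF x in_fibre(2,1)], of I0 J0 I0 J0] by auto
  qed
qed

lemma Lambda_omega_zero: "Lambda_omega (E x) (h x) (\<lambda>(I::'n set) (J::'n set). 0) = (\<lambda>I J. 0)"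
proof (rule Lambda_omega_eqI)
  show "(\<lambda>I J. 0) \<in> forms_at (E x)" using fibre_closed(1)[OF x] by (simp add: forms_at_def)
  fix \<alpha> :: "('n, 'v) cform" assume "\<alpha> \<in> forms_at (E x)"
  then have "\<alpha> I J \<in> E x" for I J by (simp add: forms_at_def)
  note f = this
  have "wedge_11 omega_coeff \<alpha> I J \<in> E x" for I J
    unfolding wedge_11_def wedge_dz_def wedge_dzbar_def
    using f fibre_closed(1,3)[OF x] by (intro fibre_sum[OF x]) auto
  then show "form_inner (h x) (wedge_11 omega_coeff \<alpha>) (\<lambda>I J. 0) = form_inner (h x) \<alpha> (\<lambda>I J. 0)"
    by (simp add: form_inner_def metric_zero[OF x] f)
qed

lemma Lambda_omega_top:
  assumes a: "a \<in> E x"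
  shows "Lambda_omega (E x) (h x) (top_form a :: ('n, 'v) cform) = omit_form ((- \<i> * (-1) ^ (CARD('n) - 1)) *\<^sub>C a)"
proof (rule Lambda_omega_eqI)
  let ?s = "(-1) ^ (CARD('n) - 1) :: complex"
  let ?a = "(- \<i> * ?s) *\<^sub>C a"
  have a': "?a \<in> E x" using a fibre_closed(3)[OF x] by blast
  then show "omit_form ?a \<in> forms_at (E x)" using fibre_closed(1)[OF x] by (auto simp: forms_at_def omit_form_def)
  fix \<alpha> :: "('n, 'v) cform" assume "\<alpha> \<in> forms_at (E x)"
  then have "\<alpha> I J \<in> E x" for I J by (simp add: forms_at_def)
  note f = this
  have w: "wedge_11 omega_coeff \<alpha> I J \<in> E x" for I J
    unfolding wedge_11_def wedge_dz_def wedge_dzbar_def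
    using f fibre_closed(1,3)[OF x] by (intro fibre_sum[OF x]) auto
  have "form_inner (h x) (wedge_11 omega_coeff \<alpha>) (top_form a) = h x (wedge_11 omega_coeff \<alpha> UNIV UNIV) a"
    by (rule form_inner_top) (use metric_zero(2)[OF x] w in auto)
  also have "wedge_11 omega_coeff \<alpha> UNIV UNIV = (\<Sum>j\<in>UNIV. (\<i> * ?s) *\<^sub>C \<alpha> (UNIV - {j}) (UNIV - {j}))"
    by (subst wedge_11_diagonal) (auto simp: omega_coeff_def wedge_pair_top scaleC_scaleC)
  also have "h x \<dots> a = (\<Sum>j\<in>UNIV. \<i> * ?s * h x (\<alpha> (UNIV - {j}) (UNIV - {j})) a)"
    using f a fibre_closed(3)[OF x] by (simp add: metric_sum_left[OF x] metric_scale[OF x])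
  also have "\<dots> = (\<Sum>j\<in>UNIV. h x (\<alpha> (UNIV - {j}) (UNIV - {j})) ?a)"
    using f a by (simp add: metric_scale_right[OF x])
  also have "\<dots> = form_inner (h x) \<alpha> (omit_form ?a)"
    unfolding form_inner_def
  proof (subst sum_complement_pairs)
    show "h x (\<alpha> I J) (omit_form ?a I J) = 0" if "\<not> (\<exists>j. I = UNIV - {j} \<and> J = UNIV - {j})" for I J
      unfolding omit_form_def if_not_P[OF that] by (rule metric_zero(2)[OF x f])
    have "omit_form ?a (UNIV - {j}) (UNIV - {j}) = ?a" for j :: 'n by (auto simp: omit_form_def)
    then show "(\<Sum>j\<in>UNIV. h x (\<alpha> (UNIV - {j}) (UNIV - {j})) ?a)
        = (\<Sum>j\<in>UNIV. h x (\<alpha> (UNIV - {j}) (UNIV - {j})) (omit_form ?a (UNIV - {j}) (UNIV - {j})))"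
      by simp
  qed
  finally show "form_inner (h x) (wedge_11 omega_coeff \<alpha>) (top_form a) = form_inner (h x) \<alpha> (omit_form ?a)" .
qed

text \<open>On forms of top degree only \<open>m \<omega> \<and> \<Lambda>\<^sub>\<omega>\<close> survives in the commutator, and it multiplies by \<open>m\<close> times the
  trace of \<open>\<omega>\<close>, which is \<open>n\<close>.\<close>

lemma curvature_operator_sq_dist:
  fixes m :: real
  assumes a: "a \<in> E x"
  shows "curvature_operator E h (\<lambda>z. m * sq_dist z0 z) c x (top_form a)
      = top_form (complex_of_real (m * real CARD('n) + c) *\<^sub>C a)"
proof -
  let ?s = "(-1) ^ (CARD('n) - 1) :: complex"
  let ?A = "\<lambda>j k. \<i> * complex_hessian (\<lambda>z. m * sq_dist z0 z) x j k"
  let ?a = "(- \<i> * ?s) *\<^sub>C a"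
  have ss: "?s * ?s = 1" by (simp flip: power_mult_distrib)
  have "wedge_11 ?A (omit_form ?a) I J = top_form (complex_of_real (m * real CARD('n)) *\<^sub>C a) I J" for I J
  proof -
    have W: "wedge_11 ?A (omit_form ?a) I J = (\<Sum>j\<in>UNIV. (\<i> * m) *\<^sub>C wedge_dz j (wedge_dzbar j (omit_form ?a)) I J)"
      by (subst wedge_11_diagonal) (auto simp: complex_hessian_sq_dist)
    show ?thesis
    proof (cases "I = UNIV \<and> J = UNIV")
      case True
      have o: "omit_form ?a (UNIV - {j}) (UNIV - {j}) = ?a" for j :: 'n by (auto simp: omit_form_def)
      have "wedge_11 ?A (omit_form ?a) I J = (\<Sum>j\<in>(UNIV::'n set). (\<i> * m * ?s * (- \<i> * ?s)) *\<^sub>C a)"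
        unfolding W using True by (simp only: wedge_pair_top o scaleC_scaleC mult.assoc)
      also have "\<i> * m * ?s * (- \<i> * ?s) = complex_of_real m"
        using ss by (simp add: algebra_simps)
      also have "(\<Sum>j\<in>(UNIV::'n set). complex_of_real m *\<^sub>C a) = complex_of_real (m * real CARD('n)) *\<^sub>C a"
        by (simp add: mult.commute flip: scaleC_sum_left)
      finally show ?thesis using True by (simp add: top_form_def)
    next
      case False
      have "omit_form ?a (I - {j}) (J - {j}) = 0" if "j \<in> I" "j \<in> J" for j
      proof -
        have "\<not> (\<exists>i. I - {j} = UNIV - {i} \<and> J - {j} = UNIV - {i})"
        proof
          assume "\<exists>i. I - {j} = UNIV - {i} \<and> J - {j} = UNIV - {i}"
          then obtain i where i: "I - {j} = UNIV - {i}" "J - {j} = UNIV - {i}" by blast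
          then have "i = j" by blast
          with i that have "I = UNIV" "J = UNIV" by blast+
          with False show False by blast
        qed
        then show ?thesis unfolding omit_form_def by (rule if_not_P)
      qed
      then have "wedge_dz j (wedge_dzbar j (omit_form ?a)) I J = 0" for j
        by (simp add: wedge_dz_def wedge_dzbar_def)
      then have "wedge_11 ?A (omit_form ?a) I J = 0" unfolding W by simp
      with False show ?thesis by (auto simp: top_form_def)
    qed
  qed
  then have "commutator_Lambda (E x) (h x) ?A (top_form a) = top_form (complex_of_real (m * real CARD('n)) *\<^sub>C a)"
    unfolding commutator_Lambda_def wedge_11_top_form Lambda_omega_zero Lambda_omega_top[OF a] by (simp add: fun_eq_iff)
  then show ?thesis
    unfolding curvature_operator_def
    by (auto simp: fun_eq_iff top_form_def scaleC_add_left)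
qed

lemma form_inner_curvature_operator_inverse:
  fixes m c :: real
  assumes a: "a \<in> E x" and pos: "m * real CARD('n) + c > 0"
  shows "form_inner (h x)
      (curvature_operator_inverse E h (\<lambda>z. m * sq_dist z0 z) c x (top_form (complex_of_real (m * real CARD('n) + c) *\<^sub>C a)))
      (top_form (complex_of_real (m * real CARD('n) + c) *\<^sub>C a))
    = complex_of_real (m * real CARD('n) + c) * h x a a"
proof -
  let ?B = "complex_of_real (m * real CARD('n) + c)"
  let ?P = "pq_forms_at CARD('n) CARD('n) (E x)"
  let ?op = "curvature_operator E h (\<lambda>z. m * sq_dist z0 z) c x"
  have B: "?B \<noteq> 0" using pos by (simp only: of_real_eq_0_iff)
  have "inj_on ?op ?P"
  proof (rule inj_onI)
    fix \<alpha> \<beta> assume "\<alpha> \<in> ?P" "\<beta> \<in> ?P" "?op \<alpha> = ?op \<beta>"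
    then have "top_form (?B *\<^sub>C \<alpha> UNIV UNIV) = (top_form (?B *\<^sub>C \<beta> UNIV UNIV) :: ('n, 'v) cform)"
      using pq_forms_at_top[of \<alpha> "E x"] pq_forms_at_top[of \<beta> "E x"] curvature_operator_sq_dist by metis
    from fun_cong[OF fun_cong[OF this, of UNIV], of UNIV]
    have "?B *\<^sub>C \<alpha> UNIV UNIV = ?B *\<^sub>C \<beta> UNIV UNIV"
      unfolding top_form_def by simp
    then have "inverse ?B *\<^sub>C (?B *\<^sub>C \<alpha> UNIV UNIV) = inverse ?B *\<^sub>C (?B *\<^sub>C \<beta> UNIV UNIV)" by simp
    then have "\<alpha> UNIV UNIV = \<beta> UNIV UNIV"
      unfolding scaleC_scaleC left_inverse[OF B] scaleC_one .
    then show "\<alpha> = \<beta>" using pq_forms_at_top(1) \<open>\<alpha> \<in> ?P\<close> \<open>\<beta> \<in> ?P\<close> by metis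
  qed
  then have inv: "curvature_operator_inverse E h (\<lambda>z. m * sq_dist z0 z) c x (top_form (?B *\<^sub>C a)) = top_form a"
    unfolding curvature_operator_inverse_def
    by (rule inv_into_f_eq) (use top_form_pq[OF fibre_closed(1)[OF x] a] curvature_operator_sq_dist[OF a] in auto)
  have "form_inner (h x) (top_form a :: ('n, 'v) cform) (top_form (?B *\<^sub>C a)) = h x (top_form a (UNIV::'n set) (UNIV::'n set)) (?B *\<^sub>C a)"
    by (rule form_inner_top) (use a in \<open>auto simp: top_form_def metric_zero[OF x] fibre_closed(1)[OF x]\<close>)
  also have "\<dots> = ?B * h x a a"
    unfolding top_form_def by (simp add: metric_scale_right[OF x a a])
  finally show ?thesis unfolding inv .
qed

end

section \<open>Concentration of the weight\<close>

text \<open>The left-hand side is at least of order \<open>exp (- m r\<^sup>2 / 4)\<close>, from the ball of radius \<open>r / 2\<close>, whereas the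
  right-hand side lives outside the ball of radius \<open>r\<close> and is at most of order \<open>m exp (- m r\<^sup>2)\<close>. For large
  \<open>m\<close> this is impossible.\<close>

lemma weighted_concentration:
  fixes F E0 E1 :: "complex^'n \<Rightarrow> real"
  assumes cont: "continuous_on UNIV F" "continuous_on UNIV E0" "continuous_on UNIV E1"
    and K: "compact K" "\<And>x. x \<notin> K \<Longrightarrow> F x = 0" "\<And>x. x \<notin> K \<Longrightarrow> E0 x = 0" "\<And>x. x \<notin> K \<Longrightarrow> E1 x = 0"
    and F: "\<And>x. F x \<ge> 0" "\<And>x. x \<in> ball x0 r \<Longrightarrow> F x \<ge> \<delta>" and pos: "r > 0" "\<delta> > 0"
    and E: "\<And>x. x \<in> ball x0 r \<Longrightarrow> E0 x = 0" "\<And>x. x \<in> ball x0 r \<Longrightarrow> E1 x = 0"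
    and ineq: "\<And>m. m > 0 \<Longrightarrow> (LINT x|lebesgue. F x * exp (- (m * sq_dist x0 x)))
        \<le> (LINT x|lebesgue. (E0 x + m * E1 x) * exp (- (m * sq_dist x0 x)))"
  shows False
proof -
  define V where "V = measure lebesgue (ball x0 (r/2))"
  define A0 A1 where "A0 = (LINT x|lebesgue. \<bar>E0 x\<bar>)" and "A1 = (LINT x|lebesgue. \<bar>E1 x\<bar>)"
  \<comment> \<open>The difference of the exponents \<open>r\<^sup>2\<close> and \<open>(r/2)\<^sup>2\<close>.\<close>
  define q where "q = (3/4) * r\<^sup>2"
  have q: "q > 0" using pos by (simp add: q_def)
  have V: "V > 0" unfolding V_def using pos(1) by (simp add: content_ball_pos)
  have cw: "continuous_on UNIV (\<lambda>x. exp (- (m * sq_dist x0 x)))" for m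
    unfolding sq_dist_def by (intro continuous_intros)
  have main: "\<delta> * V \<le> exp (- (q * m)) * (A0 + m * A1)" if m: "m > 0" for m
  proof -
    have 1: "\<delta> * exp (- (m * (r\<^sup>2 / 4))) * V \<le> (LINT x|lebesgue. F x * exp (- (m * sq_dist x0 x)))"
    proof -
      have "(LINT x|lebesgue. indicator (ball x0 (r/2)) x *\<^sub>R (\<delta> * exp (- (m * (r\<^sup>2 / 4)))))
          \<le> (LINT x|lebesgue. F x * exp (- (m * sq_dist x0 x)))"
      proof (rule integral_mono)
        show "integrable lebesgue (\<lambda>x. indicator (ball x0 (r/2)) x *\<^sub>R (\<delta> * exp (- (m * (r\<^sup>2 / 4)))))"
          using emeasure_bounded_finite[OF bounded_ball[of x0 "r/2"]]
          by (intro integrable_scaleR_left integrable_real_indicator) auto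
        show "integrable lebesgue (\<lambda>x. F x * exp (- (m * sq_dist x0 x)))"
          by (rule integrable_compact_support[OF _ K(1)]) (use K in \<open>auto intro!: continuous_on_mult cont cw\<close>)
        fix x
        show "indicator (ball x0 (r/2)) x *\<^sub>R (\<delta> * exp (- (m * (r\<^sup>2 / 4)))) \<le> F x * exp (- (m * sq_dist x0 x))"
        proof (cases "x \<in> ball x0 (r/2)")
          case True
          then have n: "norm (x - x0) < r/2" by (simp add: dist_norm norm_minus_commute)
          then have "sq_dist x0 x \<le> (r/2)\<^sup>2" unfolding sq_dist_norm by (intro power_mono) auto
          then have "m * sq_dist x0 x \<le> m * (r\<^sup>2 / 4)" using m by (simp add: power_divide)
          moreover have "x \<in> ball x0 r" using n pos(1) by (simp add: dist_norm norm_minus_commute)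
          ultimately have "\<delta> * exp (- (m * (r\<^sup>2 / 4))) \<le> F x * exp (- (m * sq_dist x0 x))"
            using F pos by (intro mult_mono) auto
          with True show ?thesis by simp
        qed (use F in simp)
      qed
      then show ?thesis by (simp add: V_def mult.commute)
    qed
    have 2: "(LINT x|lebesgue. (E0 x + m * E1 x) * exp (- (m * sq_dist x0 x)))
        \<le> (LINT x|lebesgue. (\<bar>E0 x\<bar> + m * \<bar>E1 x\<bar>) * exp (- (m * r\<^sup>2)))"
    proof (rule integral_mono)
      show "integrable lebesgue (\<lambda>x. (E0 x + m * E1 x) * exp (- (m * sq_dist x0 x)))"
        by (rule integrable_compact_support[OF _ K(1)]) (use K in \<open>auto intro!: continuous_intros cont cw\<close>)
      show "integrable lebesgue (\<lambda>x. (\<bar>E0 x\<bar> + m * \<bar>E1 x\<bar>) * exp (- (m * r\<^sup>2)))"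
        by (rule integrable_compact_support[OF _ K(1)]) (use K in \<open>auto intro!: continuous_intros cont\<close>)
      fix x
      show "(E0 x + m * E1 x) * exp (- (m * sq_dist x0 x)) \<le> (\<bar>E0 x\<bar> + m * \<bar>E1 x\<bar>) * exp (- (m * r\<^sup>2))"
      proof (cases "x \<in> ball x0 r")
        case True
        then show ?thesis using E by simp
      next
        case False
        then have "r \<le> norm (x - x0)" by (simp add: dist_norm norm_minus_commute)
        then have "r\<^sup>2 \<le> sq_dist x0 x" unfolding sq_dist_norm using pos by (intro power_mono) auto
        then have "exp (- (m * sq_dist x0 x)) \<le> exp (- (m * r\<^sup>2))" using m by simp
        moreover have "E0 x + m * E1 x \<le> \<bar>E0 x\<bar> + m * \<bar>E1 x\<bar>" using m by (intro add_mono mult_left_mono) auto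
        ultimately show ?thesis using m by (intro mult_mono) auto
      qed
    qed
    have i: "integrable lebesgue (\<lambda>x. \<bar>E0 x\<bar>)" "integrable lebesgue (\<lambda>x. \<bar>E1 x\<bar>)"
      by (rule integrable_compact_support[OF _ K(1)]; use K in \<open>auto intro!: continuous_intros cont\<close>)+
    have "(LINT x|lebesgue. (\<bar>E0 x\<bar> + m * \<bar>E1 x\<bar>) * exp (- (m * r\<^sup>2))) = (A0 + m * A1) * exp (- (m * r\<^sup>2))"
      by (simp add: i A0_def A1_def)
    with 1 2 ineq[OF m] have "\<delta> * exp (- (m * (r\<^sup>2 / 4))) * V \<le> (A0 + m * A1) * exp (- (m * r\<^sup>2))" by linarith
    then have "exp (m * (r\<^sup>2 / 4)) * (\<delta> * exp (- (m * (r\<^sup>2 / 4))) * V) \<le> exp (m * (r\<^sup>2 / 4)) * ((A0 + m * A1) * exp (- (m * r\<^sup>2)))"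
      by (rule mult_left_mono) simp
    moreover have "exp (m * (r\<^sup>2 / 4)) * (\<delta> * exp (- (m * (r\<^sup>2 / 4))) * V) = \<delta> * V"
      by (simp add: exp_minus)
    moreover have "exp (m * (r\<^sup>2 / 4)) * ((A0 + m * A1) * exp (- (m * r\<^sup>2))) = exp (- (q * m)) * (A0 + m * A1)"
    proof -
      have "exp (- (q * m)) = exp (m * (r\<^sup>2 / 4)) * exp (- (m * r\<^sup>2))"
        unfolding exp_add[symmetric] by (simp add: q_def field_simps)
      then show ?thesis by simp
    qed
    ultimately show ?thesis by linarith
  qed
  have "((\<lambda>m. exp (- (q * m)) * (A0 + m * A1)) \<longlongrightarrow> 0) at_top"
  proof -
    have qm: "filterlim (\<lambda>m. q * m) at_top at_top"
      by (rule filterlim_tendsto_pos_mult_at_top[OF tendsto_const q filterlim_ident])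
    have "((\<lambda>m. A0 * ((q * m) ^ 0 / exp (q * m)) + A1 / q * ((q * m) ^ 1 / exp (q * m))) \<longlongrightarrow> A0 * 0 + A1 / q * 0) at_top"
      by (intro tendsto_intros filterlim_compose[OF tendsto_power_div_exp_0 qm])
    moreover have "A0 * ((q * m) ^ 0 / exp (q * m)) + A1 / q * ((q * m) ^ 1 / exp (q * m)) = exp (- (q * m)) * (A0 + m * A1)" for m
      using q by (simp add: exp_minus field_simps)
    ultimately show ?thesis by simp
  qed
  moreover have "\<forall>\<^sub>F m in at_top. \<delta> * V \<le> exp (- (q * m)) * (A0 + m * A1)"
    using eventually_gt_at_top[of 0] by eventually_elim (rule main)
  ultimately have "\<delta> * V \<le> 0" by (rule tendsto_lowerbound) simp
  with V pos show False by (simp add: mult_le_0_iff)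
qed

section \<open>The Bochner identity for a cut-off holomorphic section\<close>

text \<open>A holomorphic frame section \<open>e\<close> of constant coordinates \<open>b\<close>, cut off near \<open>x0\<close>. Only the cut-off prevents
  \<open>s\<close> from being holomorphic; all terms caused by it are collected in \<open>E0\<close> and \<open>E1\<close>, which vanish wherever
  \<open>\<kappa>\<close> is locally constant.\<close>

locale cutoff_section = hermitian_bundle D E T h
  for D :: "(complex^'n) set" and E :: "complex^'n \<Rightarrow> 'v::complex_vector set"
    and T :: "('n, 'r::finite, 'v) atlas" and h +
  fixes N1 N2 U \<phi> and b :: "complex^'r" and x0 :: "complex^'n" and R :: real
    and \<kappa> :: "complex^'n \<Rightarrow> real"
  assumes conn: "chern_connection D E T h N1 N2" and chart: "(U, \<phi>) \<in> T"
    and \<kappa>: "smooth_on UNIV \<kappa>" "\<And>x. x \<notin> cball x0 R \<Longrightarrow> \<kappa> x = 0" and ball_U: "cball x0 R \<subseteq> U"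
begin

lemmas U = chart_open[OF chart] chart_subset[OF chart]

lemma U_D: "y \<in> U \<Longrightarrow> y \<in> D"
  using U by blast

definition cut :: "complex^'n \<Rightarrow> complex" where "cut y = complex_of_real (\<kappa> y)"
abbreviation "e \<equiv> frame \<phi> b"
definition s :: "complex^'n \<Rightarrow> 'v" where "s y = cut y *\<^sub>C e y"

text \<open>The derivative \<open>\<partial>\<psi>/\<partial>z\<^sub>k\<close> of the weight function \<open>\<psi> = m |z - x0|\<^sup>2\<close>.\<close>

definition p :: "real \<Rightarrow> 'n \<Rightarrow> complex^'n \<Rightarrow> complex" where "p m k y = complex_of_real m * cnj (y $ k - x0 $ k)"

definition weight :: "real \<Rightarrow> complex^'n \<Rightarrow> complex" where
  "weight m y = complex_of_real (exp (- (m * sq_dist x0 y)))"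

text \<open>The covariant derivative of \<open>s\<close> along \<open>\<partial>/\<partial>z\<^sub>k\<close> with respect to the weighted metric \<open>h exp (- \<psi>)\<close>.\<close>

definition t :: "real \<Rightarrow> 'n \<Rightarrow> complex^'n \<Rightarrow> 'v" where "t m k y = N1 k s y + (- p m k y) *\<^sub>C s y"

definition "H0 y = h y (e y) (e y)"
definition "P k y = h y (e y) (N1 k e y)"
definition "Q k y = h y (e y) (N2 k (N1 k e) y)"
definition "E0 k y = - cut y * (cnj (dzbar k (dz k cut) y) * H0 y + cnj (dzbar k cut y) * P k y)"
definition "E1 k y = cut y * (y $ k - x0 $ k) * cnj (dzbar k cut y) * H0 y"

lemma smooth_cut: "smooth_on UNIV cut" "smooth_on U cut"
proof -
  show "smooth_on UNIV cut" unfolding cut_def[abs_def] by (intro smooth_on_of_real \<kappa> open_UNIV)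
  then show "smooth_on U cut" by (rule smooth_on_subset) auto
qed

lemma smooth_coordinate: "smooth_on U (\<lambda>y. y $ k - x0 $ k)"
  by (intro smooth_on_diff smooth_on_vec_nth smooth_on_ident smooth_on_const U)

lemma smooth_p: "smooth_on U (p m k)" "smooth_on U (\<lambda>y. - p m k y)"
proof -
  show "smooth_on U (p m k)"
    unfolding p_def[abs_def] by (intro smooth_on_mult smooth_on_const smooth_on_cnj smooth_coordinate U)
  then show "smooth_on U (\<lambda>y. - p m k y)" by (intro smooth_on_minus U)
qed

lemma smooth_weight: "smooth_on U (weight m)" 
  unfolding weight_def[abs_def]
  by (intro smooth_on_of_real U smooth_on_compose_real[OF smooth_on_exp[of UNIV]] smooth_on_minus smooth_on_mult smooth_on_const smooth_on_sq_dist) simp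

lemma dzbar_weight: "dzbar k (weight m) y = - cnj (p m k y) * weight m y"
  and dz_weight: "dz k (weight m) y = - p m k y * weight m y"
proof -
  have d: "(\<lambda>y. m * sq_dist x0 y) differentiable (at y)"
    by (rule smooth_on_differentiable[of UNIV]) (intro smooth_on_mult smooth_on_const smooth_on_sq_dist open_UNIV, simp)
  show "dzbar k (weight m) y = - cnj (p m k y) * weight m y"
    unfolding weight_def[abs_def] dzbar_exp[OF d] dzbar_sq_dist by (simp add: p_def)
  show "dz k (weight m) y = - p m k y * weight m y"
    unfolding weight_def[abs_def] dz_exp[OF d] dz_sq_dist by (simp add: p_def)
qed

lemma dzbar_p: "dzbar k (\<lambda>y. - p m k y) y = - complex_of_real m"
proof -
  have D: "((\<lambda>y. - p m k y) has_derivative (\<lambda>v. - (complex_of_real m * cnj (v $ k)))) (at y)"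
    unfolding p_def
    by (auto intro!: derivative_eq_intros bounded_linear_imp_has_derivative bounded_linear_vec_nth bounded_linear.has_derivative[OF bounded_linear_cnj])
  show ?thesis unfolding dzbar_eq[OF D] by (simp add: axis_def mult.left_commute[of \<i>])
qed

lemma sec_e: "sec U e"
  by (rule sec_frame[OF chart])

lemma sec_s: "sec U s"
  unfolding s_def[abs_def] by (rule sec_scale[OF U smooth_cut(2) sec_e])

lemma N1_s: "y \<in> U \<Longrightarrow> N1 k s y = dz k cut y *\<^sub>C e y + cut y *\<^sub>C N1 k e y"
  unfolding s_def[abs_def] by (rule conn_leibniz(1)[OF conn U sec_e smooth_cut(2)])

lemma N2_s: "y \<in> U \<Longrightarrow> N2 k s y = dzbar k cut y *\<^sub>C e y"
  unfolding s_def[abs_def]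
  using conn_leibniz(2)[OF conn U sec_e smooth_cut(2), of y k] by (simp add: conn_frame[OF conn chart])

lemma sec_t: "sec U (t m k)"
  unfolding t_def[abs_def]
  by (intro sec_add[OF U] sec_scale[OF U] smooth_p conn_sec(1)[OF conn U] sec_s)

lemma cut_zero:
  assumes "y \<notin> cball x0 R"
  shows "cut y = 0" "dz k cut y = 0" "dzbar k cut y = 0" "dzbar k (dz k cut) y = 0"
proof -
  have o: "open (- cball x0 R)" "y \<in> - cball x0 R" using assms by auto
  show "cut y = 0" using assms \<kappa>(2) by (simp add: cut_def)
  have 1: "dz k cut z = 0" "dzbar k cut z = 0" if "z \<in> - cball x0 R" for z
    using dz_cong_open[OF o(1) that, of cut "\<lambda>_. 0" k] dzbar_cong_open[OF o(1) that, of cut "\<lambda>_. 0" k] \<kappa>(2)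
    by (simp_all add: cut_def)
  then show "dz k cut y = 0" "dzbar k cut y = 0" using o by blast+
  show "dzbar k (dz k cut) y = 0"
    using dzbar_cong_open[OF o, of "dz k cut" "\<lambda>_. 0" k] 1 by simp
qed

lemma t_zero: "y \<in> U \<Longrightarrow> y \<notin> cball x0 R \<Longrightarrow> t m k y = 0"
  unfolding t_def by (simp add: N1_s cut_zero s_def)

lemma s_zero: "y \<notin> cball x0 R \<Longrightarrow> s y = 0"
  by (simp add: s_def cut_zero)

text \<open>Up to sign, \<open>t m k\<close> is the \<open>k\<close>-th component of the formal adjoint of \<open>\<bar>\<partial>\<close> in the weighted space, applied to
  the top-degree form with coefficient \<open>s\<close>.\<close>

lemma dzbar_weighted_pairing:
  assumes v: "sec U v" and y: "y \<in> U" and hol: "N2 k v y = 0"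
  shows "dzbar k (\<lambda>y. h y (v y) (s y) * weight m y) y = h y (v y) (t m k y) * weight m y"
proof -
  note d = smooth_on_differentiable[OF smooth_on_metric[OF U v sec_s] y] smooth_on_differentiable[OF smooth_weight y]
  note D = U_D[OF y]
  note f = sec_fibre[OF v y] sec_fibre[OF sec_s y] sec_fibre[OF conn_sec(1)[OF conn U sec_s] y] fibre_closed(3)[OF D sec_fibre[OF sec_s y]]
  have "dzbar k (\<lambda>y. h y (v y) (s y) * weight m y) y
      = (h y (N2 k v y) (s y) + h y (v y) (N1 k s y)) * weight m y + h y (v y) (s y) * (- cnj (p m k y) * weight m y)"
    by (simp add: dzbar_mult[OF d] conn_dzbar[OF conn U v sec_s y] dzbar_weight)
  also have "\<dots> = (h y (v y) (N1 k s y) - cnj (p m k y) * h y (v y) (s y)) * weight m y"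
    using metric_zero(1)[OF D f(2)] by (simp add: hol algebra_simps)
  also have "h y (v y) (N1 k s y) - cnj (p m k y) * h y (v y) (s y) = h y (v y) (t m k y)"
    unfolding t_def by (simp add: metric_add_right[OF D f(1,3,4)] metric_scale_right[OF D f(1,2)])
  finally show ?thesis .
qed

lemma N2_t:
  assumes y: "y \<in> U"
  shows "N2 k (t m k) y = (dzbar k (dz k cut) y *\<^sub>C e y + dzbar k cut y *\<^sub>C N1 k e y + cut y *\<^sub>C N2 k (N1 k e) y)
     + ((- complex_of_real m) *\<^sub>C s y + (- p m k y) *\<^sub>C (dzbar k cut y *\<^sub>C e y))"
proof -
  note N1e = conn_sec(1)[OF conn U sec_e]
  note dzcut = smooth_on_dz[OF U(1) smooth_cut(2)]
  have 1: "N2 k (N1 k s) y = dzbar k (dz k cut) y *\<^sub>C e y + dzbar k cut y *\<^sub>C N1 k e y + cut y *\<^sub>C N2 k (N1 k e) y"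
  proof -
    have "N2 k (N1 k s) y = N2 k (\<lambda>y. dz k cut y *\<^sub>C e y + cut y *\<^sub>C N1 k e y) y"
      by (rule conn_local(2)[OF conn U _ _ y]) (use N1_s in \<open>auto intro!: sec_add[OF U] sec_scale[OF U] dzcut smooth_cut sec_e N1e\<close>)
    also have "\<dots> = N2 k (\<lambda>y. dz k cut y *\<^sub>C e y) y + N2 k (\<lambda>y. cut y *\<^sub>C N1 k e y) y"
      by (rule conn_add(2)[OF conn U _ _ y]) (intro sec_scale[OF U] dzcut smooth_cut sec_e N1e)+
    also have "N2 k (\<lambda>y. dz k cut y *\<^sub>C e y) y = dzbar k (dz k cut) y *\<^sub>C e y"
      using conn_leibniz(2)[OF conn U sec_e dzcut y, of k] by (simp add: conn_frame[OF conn chart y])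
    also have "N2 k (\<lambda>y. cut y *\<^sub>C N1 k e y) y = dzbar k cut y *\<^sub>C N1 k e y + cut y *\<^sub>C N2 k (N1 k e) y"
      by (rule conn_leibniz(2)[OF conn U N1e smooth_cut(2) y])
    finally show ?thesis by (simp add: add.assoc)
  qed
  have "N2 k (t m k) y = N2 k (N1 k s) y + N2 k (\<lambda>y. (- p m k y) *\<^sub>C s y) y"
    unfolding t_def[abs_def]
    by (rule conn_add(2)[OF conn U _ _ y]) (intro sec_scale[OF U] smooth_p sec_s conn_sec(1)[OF conn U])+
  also have "N2 k (\<lambda>y. (- p m k y) *\<^sub>C s y) y = dzbar k (\<lambda>y. - p m k y) y *\<^sub>C s y + (- p m k y) *\<^sub>C N2 k s y"
    by (rule conn_leibniz(2)[OF conn U sec_s smooth_p(2) y])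
  finally show ?thesis by (simp add: 1 dzbar_p N2_s[OF y])
qed

text \<open>The product rule for \<open>h\<close> turns \<open>(t, t)\<close> into a divergence minus \<open>(s, N2 k (t m k))\<close>, and \<open>N2 k (t m k)\<close> is
  explicit because \<open>e\<close> is holomorphic. The Hessian of the weight contributes \<open>m\<close>, the curvature contributes \<open>Q\<close>.\<close>

lemma bochner_pointwise:
  assumes y: "y \<in> U"
  shows "h y (t m k y) (t m k y) * weight m y
    = dz k (\<lambda>y. h y (s y) (t m k y) * weight m y) y
      + ((cut y)\<^sup>2 * (complex_of_real m * H0 y - Q k y) + E0 k y + complex_of_real m * E1 k y) * weight m y"
proof -
  note D = U_D[OF y]
  note N1e = conn_sec(1)[OF conn U sec_e]
  note fs = sec_fibre[OF sec_s y] and fe = sec_fibre[OF sec_e y]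
    and ft = sec_fibre[OF sec_t y] and fN1s = sec_fibre[OF conn_sec(1)[OF conn U sec_s] y]
    and fN2t = sec_fibre[OF conn_sec(2)[OF conn U sec_t] y]
    and fN1e = sec_fibre[OF N1e y] and fN2N1e = sec_fibre[OF conn_sec(2)[OF conn U N1e] y]
  note cl = fibre_closed(2,3)[OF D]
  note d = smooth_on_differentiable[OF smooth_on_metric[OF U sec_s sec_t] y] smooth_on_differentiable[OF smooth_weight y]
  have "dz k (\<lambda>y. h y (s y) (t m k y) * weight m y) y
     = (h y (N1 k s y) (t m k y) + h y (s y) (N2 k (t m k) y)) * weight m y + h y (s y) (t m k y) * (- p m k y * weight m y)"
    by (simp add: dz_mult[OF d] conn_dz[OF conn U sec_s sec_t y] dz_weight)
  also have "\<dots> = ((h y (N1 k s y) (t m k y) - p m k y * h y (s y) (t m k y)) + h y (s y) (N2 k (t m k) y)) * weight m y"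
    by (simp add: algebra_simps)
  also have "h y (N1 k s y) (t m k y) - p m k y * h y (s y) (t m k y) = h y (t m k y) (t m k y)"
  proof -
    have "h y (t m k y) (t m k y) = h y (N1 k s y + (- p m k y) *\<^sub>C s y) (t m k y)" by (simp add: t_def)
    then show ?thesis by (simp add: metric_add[OF D fN1s ft] metric_scale[OF D fs ft] cl fs)
  qed
  finally have 1: "dz k (\<lambda>y. h y (s y) (t m k y) * weight m y) y
      = (h y (t m k y) (t m k y) + h y (s y) (N2 k (t m k) y)) * weight m y" .
  have c: "cnj (cut y) = cut y" by (simp add: cut_def)
  have "h y (s y) (N2 k (t m k) y) = cut y * h y (e y) (N2 k (t m k) y)"
    by (simp add: s_def metric_scale[OF D fe fN2t])
  also have "h y (e y) (N2 k (t m k) y) = cnj (dzbar k (dz k cut) y) * H0 y + cnj (dzbar k cut y) * P k y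
      + cut y * Q k y - complex_of_real m * cut y * H0 y - cnj (p m k y) * cnj (dzbar k cut y) * H0 y"
    unfolding N2_t[OF y] s_def
    by (simp add: metric_add_right[OF D fe] metric_scale_right[OF D fe] cl fe fN1e fN2N1e H0_def P_def Q_def c algebra_simps)
  finally have 2: "h y (s y) (N2 k (t m k) y) = - ((cut y)\<^sup>2 * (complex_of_real m * H0 y - Q k y) + E0 k y + complex_of_real m * E1 k y)"
    by (simp add: E0_def E1_def p_def algebra_simps power2_eq_square)
  show ?thesis unfolding 1 2 by (simp add: algebra_simps)
qed

subsection \<open>Integration\<close>

definition ext :: "(complex^'n \<Rightarrow> complex) \<Rightarrow> complex^'n \<Rightarrow> complex" where
  "ext F y = (if y \<in> U then F y else 0)"

lemma smooth_ext:
  assumes "smooth_on U F" "\<And>y. y \<in> U \<Longrightarrow> y \<notin> cball x0 R \<Longrightarrow> F y = 0"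
  shows "smooth_on UNIV (ext F)"
  unfolding ext_def[abs_def]
  by (rule smooth_on_zero_extension[OF U(1) closed_cball ball_U assms(1)]) (use assms(2) in auto)

lemma ext_zero:
  assumes "\<And>y. y \<in> U \<Longrightarrow> y \<notin> cball x0 R \<Longrightarrow> F y = 0" "y \<notin> cball x0 R"
  shows "ext F y = 0"
  using assms by (auto simp: ext_def)

lemma integrable_ext:
  assumes "smooth_on U F" "\<And>y. y \<in> U \<Longrightarrow> y \<notin> cball x0 R \<Longrightarrow> F y = 0"
  shows "integrable lebesgue (ext F)"
  by (rule integrable_compact_support(2)[OF smooth_on_continuous_on[OF smooth_ext[OF assms]] compact_cball, of x0 R])
     (use assms(2) in \<open>auto simp: ext_def\<close>)

lemma integral_ext_dz:
  assumes F: "smooth_on U F" "\<And>y. y \<in> U \<Longrightarrow> y \<notin> cball x0 R \<Longrightarrow> F y = 0"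
  shows "(LINT y|lebesgue. ext (dz k F) y) = 0" "\<And>y. y \<in> U \<Longrightarrow> y \<notin> cball x0 R \<Longrightarrow> dz k F y = 0"
proof -
  have z: "dz k (ext F) y = 0" if "y \<notin> cball x0 R" for y
    using dz_cong_open[of "- cball x0 R" y "ext F" "\<lambda>_. 0" k] that F(2)
    by (auto simp: ext_def open_Compl)
  have eq: "dz k (ext F) y = dz k F y" if "y \<in> U" for y
    by (rule dz_cong_open[OF U(1) that]) (simp add: ext_def)
  have "ext (dz k F) y = dz k (ext F) y" for y
  proof (cases "y \<in> U")
    case False
    then have "y \<notin> cball x0 R" using ball_U by blast
    from z[OF this] False show ?thesis by (simp add: ext_def[of "dz k F"])
  qed (simp add: ext_def eq)
  moreover have "(LINT y|lebesgue. dz k (ext F) y) = 0"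
  proof (rule integral_dz_compact_support[OF _ compact_cball[of x0 R]])
    show "smooth_on UNIV (ext F)" by (rule smooth_ext[OF F])
    show "ext F y = 0" if "y \<notin> cball x0 R" for y by (rule ext_zero[OF F(2) that])
  qed
  ultimately show "(LINT y|lebesgue. ext (dz k F) y) = 0" by simp
  show "\<And>y. y \<in> U \<Longrightarrow> y \<notin> cball x0 R \<Longrightarrow> dz k F y = 0" using z eq by metis
qed

lemma smooth_terms:
  "smooth_on U H0" "smooth_on U (P k)" "smooth_on U (Q k)" "smooth_on U (E0 k)" "smooth_on U (E1 k)"
proof -
  note N1e = conn_sec(1)[OF conn U sec_e]
  show 1: "smooth_on U H0" "smooth_on U (P k)" "smooth_on U (Q k)"
    unfolding H0_def[abs_def] P_def[abs_def] Q_def[abs_def]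
    by (intro smooth_on_metric[OF U] sec_e N1e conn_sec(2)[OF conn U])+
  show "smooth_on U (E0 k)" "smooth_on U (E1 k)"
    unfolding E0_def[abs_def] E1_def[abs_def]
    by (intro smooth_on_mult smooth_on_add smooth_on_minus smooth_on_cnj smooth_on_dzbar smooth_on_dz smooth_coordinate
        smooth_cut U 1)+
qed

text \<open>The divergence terms have compact support and integrate to zero.\<close>

theorem bochner_identity:
  "(LINT y|lebesgue. ext (\<lambda>y. (\<Sum>k\<in>UNIV. h y (t m k y) (t m k y)) * weight m y) y)
   = (LINT y|lebesgue. ext (\<lambda>y. ((cut y)\<^sup>2 * (complex_of_real (m * CARD('n)) * H0 y - (\<Sum>k\<in>UNIV. Q k y))
        + (\<Sum>k\<in>UNIV. E0 k y) + complex_of_real m * (\<Sum>k\<in>UNIV. E1 k y)) * weight m y) y)"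
proof -
  let ?G = "\<lambda>k y. h y (s y) (t m k y) * weight m y"
  let ?X = "\<lambda>k y. ((cut y)\<^sup>2 * (complex_of_real m * H0 y - Q k y) + E0 k y + complex_of_real m * E1 k y) * weight m y"
  have G: "smooth_on U (?G k)" for k
    by (intro smooth_on_mult smooth_on_metric[OF U] sec_s sec_t smooth_weight U)
  have G0: "?G k y = 0" if "y \<in> U" "y \<notin> cball x0 R" for k y
    using that metric_zero(1)[OF U_D[OF that(1)] sec_fibre[OF sec_t that(1)]] by (simp add: s_zero)
  have X: "smooth_on U (?X k)" for k
    unfolding power2_eq_square
    by (intro smooth_on_mult smooth_on_add smooth_on_diff smooth_on_const smooth_terms smooth_cut smooth_weight U)
  have X0: "?X k y = 0" if "y \<notin> cball x0 R" for k y
    using that by (simp add: cut_zero E0_def E1_def)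
  have "(LINT y|lebesgue. ext (\<lambda>y. (\<Sum>k\<in>UNIV. h y (t m k y) (t m k y)) * weight m y) y)
      = (LINT y|lebesgue. (\<Sum>k\<in>UNIV. ext (dz k (?G k)) y) + (\<Sum>k\<in>UNIV. ext (?X k) y))"
    by (rule arg_cong[where f = "integral\<^sup>L lebesgue"])
       (auto simp: fun_eq_iff ext_def sum_distrib_right bochner_pointwise sum.distrib)
  also have "\<dots> = (LINT y|lebesgue. (\<Sum>k\<in>UNIV. ext (dz k (?G k)) y)) + (LINT y|lebesgue. (\<Sum>k\<in>UNIV. ext (?X k) y))"
    by (intro Bochner_Integration.integral_add Bochner_Integration.integrable_sum integrable_ext smooth_on_dz U G X X0
        integral_ext_dz(2)[OF G G0])
  also have "(LINT y|lebesgue. (\<Sum>k\<in>UNIV. ext (dz k (?G k)) y)) = 0"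
  proof -
    have z: "(LINT y|lebesgue. ext (dz k (?G k)) y) = 0" for k by (rule integral_ext_dz(1)[OF G G0])
    have "(LINT y|lebesgue. (\<Sum>k\<in>UNIV. ext (dz k (?G k)) y)) = (\<Sum>k\<in>UNIV. LINT y|lebesgue. ext (dz k (?G k)) y)"
      by (intro Bochner_Integration.integral_sum integrable_ext smooth_on_dz U G integral_ext_dz(2)[OF G G0])
    then show ?thesis by (simp only: z sum.neutral_const)
  qed
  also have "(\<lambda>y. \<Sum>k\<in>UNIV. ext (?X k) y) = ext (\<lambda>y. ((cut y)\<^sup>2 * (complex_of_real (m * CARD('n)) * H0 y - (\<Sum>k\<in>UNIV. Q k y))
        + (\<Sum>k\<in>UNIV. E0 k y) + complex_of_real m * (\<Sum>k\<in>UNIV. E1 k y)) * weight m y)"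
    by (auto simp: fun_eq_iff ext_def sum.distrib sum_subtractf sum_distrib_left sum_distrib_right algebra_simps)
  finally show ?thesis by simp
qed

end

section \<open>From the estimate to the trace\<close>

context hermitian_bundle
begin

lemma sec_zero:
  assumes "open W" "W \<subseteq> D"
  shows "sec W (\<lambda>x. 0)"
  unfolding smooth_section_def
proof (intro conjI ballI)
  show "0 \<in> E x" if "x \<in> W" for x using fibre_closed(1) assms that by blast
  fix c assume "c \<in> T"
  obtain U \<phi> where c: "c = (U, \<phi>)" by (cases c)
  have "smooth_on (W \<inter> U) (\<lambda>x. \<phi> x 0) = smooth_on (W \<inter> U) (\<lambda>x. 0 :: complex^'r)"
    by (rule smooth_on_cong) (use \<open>c \<in> T\<close> c assms chart_open coord_zero in auto)
  then show "case c of (U, \<phi>) \<Rightarrow> smooth_on (W \<inter> U) (\<lambda>x. \<phi> x 0)"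
    by (simp add: c smooth_on_const)
qed

end

lemma bounded_bilinear_smult: "bounded_bilinear (\<lambda>c v. c *s (v :: complex^'r))"
proof
  show "\<exists>K. \<forall>a b. norm (a *s (b :: complex^'r)) \<le> norm a * norm b * K"
    by (rule exI[of _ 1]) (simp add: norm_vector_smult)
qed (auto simp: vec_eq_iff algebra_simps)

lemma borel_measurable_smult:
  fixes v :: "'a \<Rightarrow> complex^'r"
  assumes "g \<in> borel_measurable M" "v \<in> borel_measurable M"
  shows "(\<lambda>x. g x *s v x) \<in> borel_measurable M"
  by (rule borel_measurable_continuous_Pair[OF assms])
     (intro bounded_bilinear.continuous_on[OF bounded_bilinear_smult] continuous_on_fst continuous_on_snd continuous_on_id)

context cutoff_section
begin

definition s0 :: "complex^'n \<Rightarrow> 'v" where "s0 y = (if y \<in> U then s y else 0)"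

lemma sec_s0: "sec D s0"
proof (rule sec_local)
  fix x assume x: "x \<in> D"
  show "\<exists>V. open V \<and> x \<in> V \<and> sec V s0"
  proof (cases "x \<in> U")
    case True
    have "sec U s0" by (rule sec_cong[OF U(1) sec_s]) (simp add: s0_def)
    with True U show ?thesis by blast
  next
    case False
    have o: "open (D - cball x0 R)" using open_D by (simp add: open_Diff)
    have "sec (D - cball x0 R) s0" by (rule sec_cong[OF o sec_zero[OF o]]) (auto simp: s0_def s_zero)
    with o x False ball_U show ?thesis by blast
  qed
qed

lemma metric_s0: "y \<in> D \<Longrightarrow> h y (s0 y) (s0 y) = ext (\<lambda>y. (cut y)\<^sup>2 * H0 y) y"
proof (cases "y \<in> U")
  case True
  note D = U_D[OF True]
  note f = sec_fibre[OF sec_e True]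
  show ?thesis
    using True f fibre_closed(3)[OF D f]
    by (simp add: s0_def ext_def s_def metric_scale[OF D] metric_scale_right[OF D] H0_def power2_eq_square cut_def)
next
  case False
  assume "y \<in> D"
  with False show ?thesis by (simp add: s0_def ext_def metric_zero fibre_closed(1))
qed

text \<open>The scalar test functions for the distributional equation: the coefficients of the metric dual of \<open>s\<close>, with
  the weight included.\<close>

definition \<eta> :: "real \<Rightarrow> 'r \<Rightarrow> complex^'n \<Rightarrow> complex" where
  "\<eta> m \<alpha> = ext (\<lambda>y. h y (frame \<phi> (axis \<alpha> 1) y) (s y) * weight m y)"

lemma smooth_\<eta>: "smooth_on UNIV (\<eta> m \<alpha>)"
  unfolding \<eta>_def
proof (rule smooth_ext)
  show "smooth_on U (\<lambda>y. h y (frame \<phi> (axis \<alpha> 1) y) (s y) * weight m y)"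
    by (intro smooth_on_mult smooth_on_metric[OF U] sec_frame[OF chart] sec_s smooth_weight U)
  show "h y (frame \<phi> (axis \<alpha> 1) y) (s y) * weight m y = 0" if "y \<in> U" "y \<notin> cball x0 R" for y
    using that by (simp add: s_zero metric_zero(2)[OF U_D frame_fibre[OF chart]])
qed

lemma \<eta>_zero: "y \<notin> cball x0 R \<Longrightarrow> \<eta> m \<alpha> y = 0"
  by (simp add: \<eta>_def ext_def s_zero metric_zero(2)[OF U_D frame_fibre[OF chart]])

lemma test_function_\<eta>: "test_function U (\<eta> m \<alpha>)"
  unfolding test_function_def
  by (intro conjI exI[of _ "cball x0 R"] smooth_\<eta> compact_cball ball_U allI impI \<eta>_zero)

lemma dzbar_\<eta>:
  assumes "y \<in> U"
  shows "dzbar k (\<eta> m \<alpha>) y = h y (frame \<phi> (axis \<alpha> 1) y) (t m k y) * weight m y"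
proof -
  have "dzbar k (\<eta> m \<alpha>) y = dzbar k (\<lambda>y. h y (frame \<phi> (axis \<alpha> 1) y) (s y) * weight m y) y"
    by (rule dzbar_cong_open[OF U(1) assms]) (simp add: \<eta>_def ext_def)
  also have "\<dots> = h y (frame \<phi> (axis \<alpha> 1) y) (t m k y) * weight m y"
    by (rule dzbar_weighted_pairing[OF sec_frame[OF chart] assms conn_frame[OF conn chart assms]])
  finally show ?thesis .
qed

lemma dzbar_\<eta>_zero: "y \<notin> cball x0 R \<Longrightarrow> dzbar k (\<eta> m \<alpha>) y = 0"
  using dzbar_cong_open[of "- cball x0 R" y "\<eta> m \<alpha>" "\<lambda>_. 0" k] \<eta>_zero by (auto simp: open_Compl)

lemma U_lebesgue: "U \<in> sets lebesgue" "U \<inter> space lebesgue \<in> sets lebesgue"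
  using U(1) by auto

text \<open>On the compact ball, which has finite measure, the norm of \<open>v\<close> is dominated by one plus its square.\<close>

lemma integrable_test_pairing:
  fixes v :: "complex^'n \<Rightarrow> complex^'r"
  assumes g: "continuous_on UNIV g" "\<And>y. y \<notin> cball x0 R \<Longrightarrow> g y = 0"
    and v: "v \<in> borel_measurable (lebesgue_on U)" "set_integrable lebesgue (cball x0 R) (\<lambda>y. (norm (v y))\<^sup>2)"
  shows "integrable (lebesgue_on U) (\<lambda>y. g y *s v y)"
proof -
  have "bounded (g ` cball x0 R)"
    by (intro compact_imp_bounded compact_continuous_image continuous_on_subset[OF g(1)]) auto
  then obtain C where "\<forall>z\<in>g ` cball x0 R. norm z \<le> C" unfolding bounded_iff by blast
  then have C: "norm (g y) \<le> C" if "y \<in> cball x0 R" for y using that by blast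
  let ?d = "\<lambda>y. indicator (cball x0 R) y *\<^sub>R (\<bar>C\<bar> * (1 + (norm (v y))\<^sup>2)) :: real"
  show ?thesis
  proof (rule Bochner_Integration.integrable_bound)
    have "integrable lebesgue (\<lambda>y. \<bar>C\<bar> * (indicator (cball x0 R) y *\<^sub>R (1::real) + indicator (cball x0 R) y *\<^sub>R (norm (v y))\<^sup>2))"
      using v(2) emeasure_bounded_finite[OF bounded_cball[of x0 R]] unfolding set_integrable_def
      by (intro integrable_mult_right Bochner_Integration.integrable_add integrable_scaleR_left integrable_real_indicator) auto
    moreover have "(\<lambda>y. indicator U y *\<^sub>R ?d y)
       = (\<lambda>y. \<bar>C\<bar> * (indicator (cball x0 R) y *\<^sub>R (1::real) + indicator (cball x0 R) y *\<^sub>R (norm (v y))\<^sup>2))"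
      using ball_U by (auto simp: fun_eq_iff indicator_def)
    ultimately show "integrable (lebesgue_on U) ?d"
      unfolding integrable_restrict_space[OF U_lebesgue(2)] by simp
    have "g \<in> borel_measurable (lebesgue_on U)"
      by (rule continuous_imp_measurable_on_sets_lebesgue[OF continuous_on_subset[OF g(1)] U_lebesgue(1)]) auto
    then show "(\<lambda>y. g y *s v y) \<in> borel_measurable (lebesgue_on U)" by (rule borel_measurable_smult[OF _ v(1)])
    show "AE y in lebesgue_on U. norm (g y *s v y) \<le> norm (?d y)"
    proof (rule AE_I2)
      fix y
      show "norm (g y *s v y) \<le> norm (?d y)"
      proof (cases "y \<in> cball x0 R")
        case True
        have "norm (v y) \<le> 1 + (norm (v y))\<^sup>2"
          using zero_le_power2[of "norm (v y) - 1"] norm_ge_zero[of "v y"]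
          unfolding power2_diff power_one mult_1_right by linarith
        then have "norm (g y) * norm (v y) \<le> \<bar>C\<bar> * (1 + (norm (v y))\<^sup>2)"
          using C[OF True] by (intro mult_mono) auto
        with True show ?thesis by (simp add: norm_vector_smult)
      qed (simp add: g(2) norm_vector_smult)
    qed
  qed
qed

lemma sum_\<eta>_coord:
  assumes "y \<in> U" "v \<in> E y"
  shows "(\<Sum>\<alpha>\<in>UNIV. \<eta> m \<alpha> y * \<phi> y v $ \<alpha>) = h y v (s y) * weight m y"
    and "(\<Sum>\<alpha>\<in>UNIV. dzbar k (\<eta> m \<alpha>) y * \<phi> y v $ \<alpha>) = h y v (t m k y) * weight m y"
proof -
  show "(\<Sum>\<alpha>\<in>UNIV. \<eta> m \<alpha> y * \<phi> y v $ \<alpha>) = h y v (s y) * weight m y"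
    unfolding metric_frame_expansion(1)[OF chart assms sec_fibre[OF sec_s assms(1)]]
    using assms(1) by (simp add: \<eta>_def ext_def sum_distrib_right sum_distrib_left mult_ac)
  show "(\<Sum>\<alpha>\<in>UNIV. dzbar k (\<eta> m \<alpha>) y * \<phi> y v $ \<alpha>) = h y v (t m k y) * weight m y"
    unfolding metric_frame_expansion(1)[OF chart assms sec_fibre[OF sec_t assms(1)]]
    by (simp add: dzbar_\<eta>[OF assms(1)] sum_distrib_right sum_distrib_left mult_ac)
qed

text \<open>Summing the equation for the test functions \<open>\<eta> m \<alpha>\<close> over the frame index reassembles the pairings by \<open>h\<close>:
  with \<open>s\<close> on the side of the source, with \<open>t\<close> on the side of the solution.\<close>

lemma weak_equation_tested:
  fixes w :: "'n \<Rightarrow> complex^'n \<Rightarrow> 'v" and B :: complex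
  assumes w: "\<And>k y. y \<in> U \<Longrightarrow> w k y \<in> E y"
    and wm: "\<And>k. (\<lambda>y. \<phi> y (w k y)) \<in> borel_measurable (lebesgue_on U)"
    and wi: "\<And>k. set_integrable lebesgue (cball x0 R) (\<lambda>y. (norm (\<phi> y (w k y)))\<^sup>2)"
    and weak: "\<And>\<alpha>. (LINT y|lebesgue_on U. \<eta> m \<alpha> y *s \<phi> y (B *\<^sub>C s0 y))
        = - (LINT y|lebesgue_on U. (\<Sum>k\<in>UNIV. dzbar k (\<eta> m \<alpha>) y *s \<phi> y (w k y)))"
  shows "(LINT y|lebesgue. ext (\<lambda>y. B * (cut y)\<^sup>2 * H0 y * weight m y) y)
     = - (LINT y|lebesgue. ext (\<lambda>y. (\<Sum>k\<in>UNIV. h y (w k y) (t m k y)) * weight m y) y)"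
    and "integrable lebesgue (ext (\<lambda>y. (\<Sum>k\<in>UNIV. h y (w k y) (t m k y)) * weight m y))"
proof -
  let ?M = "lebesgue_on U"
  have s0U: "s0 y = s y" if "y \<in> U" for y using that by (simp add: s0_def)
  have Bs: "B *\<^sub>C s0 y \<in> E y" if "y \<in> U" for y
    using that fibre_closed(3)[OF U_D[OF that] sec_fibre[OF sec_s that]] by (simp add: s0U)
  have phis: "smooth_on U (\<lambda>y. \<phi> y (B *\<^sub>C s0 y))"
    using sec_coord[OF sec_scale[OF open_D order_refl smooth_on_const sec_s0] chart, of B] U(2) by (simp add: Int_absorb1)
  have cphis: "continuous_on U (\<lambda>y. \<phi> y (B *\<^sub>C s0 y))" by (rule smooth_on_continuous_on[OF phis])
  have int1: "integrable ?M (\<lambda>y. \<eta> m \<alpha> y *s \<phi> y (B *\<^sub>C s0 y))" for \<alpha>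
  proof (rule integrable_test_pairing)
    show "continuous_on UNIV (\<eta> m \<alpha>)" by (rule smooth_on_continuous_on[OF smooth_\<eta>])
    show "(\<lambda>y. \<phi> y (B *\<^sub>C s0 y)) \<in> borel_measurable ?M"
      by (rule continuous_imp_measurable_on_sets_lebesgue[OF cphis U_lebesgue(1)])
    show "set_integrable lebesgue (cball x0 R) (\<lambda>y. (norm (\<phi> y (B *\<^sub>C s0 y)))\<^sup>2)"
    proof -
      have "integrable lborel (\<lambda>y. indicator (cball x0 R) y *\<^sub>R (norm (\<phi> y (B *\<^sub>C s0 y)))\<^sup>2)"
        by (rule borel_integrable_compact[OF compact_cball])
           (intro continuous_on_power continuous_on_norm continuous_on_subset[OF cphis ball_U])
      then show ?thesis
        unfolding set_integrable_def by (simp add: integrable_completion)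
    qed
  qed (rule \<eta>_zero)
  have int2: "integrable ?M (\<lambda>y. dzbar k (\<eta> m \<alpha>) y *s \<phi> y (w k y))" for k \<alpha>
    by (rule integrable_test_pairing[OF _ dzbar_\<eta>_zero wm wi])
       (rule smooth_on_continuous_on[OF smooth_on_dzbar[OF open_UNIV smooth_\<eta>]])
  note int2s = Bochner_Integration.integrable_sum[OF int2]
  have c1: "integrable ?M (\<lambda>y. (\<eta> m \<alpha> y *s \<phi> y (B *\<^sub>C s0 y)) $ \<alpha>)" for \<alpha>
    by (rule integrable_bounded_linear[OF bounded_linear_vec_nth int1])
  have c2: "integrable ?M (\<lambda>y. (\<Sum>k\<in>UNIV. dzbar k (\<eta> m \<alpha>) y *s \<phi> y (w k y)) $ \<alpha>)" for \<alpha>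
    by (rule integrable_bounded_linear[OF bounded_linear_vec_nth int2s])
  have comp: "(LINT y|?M. (\<eta> m \<alpha> y *s \<phi> y (B *\<^sub>C s0 y)) $ \<alpha>)
      = - (LINT y|?M. (\<Sum>k\<in>UNIV. dzbar k (\<eta> m \<alpha>) y *s \<phi> y (w k y)) $ \<alpha>)" for \<alpha>
    using weak[of \<alpha>] unfolding integral_bounded_linear[OF bounded_linear_vec_nth int1]
      integral_bounded_linear[OF bounded_linear_vec_nth int2s] by simp
  have e1: "(\<Sum>\<alpha>\<in>UNIV. (\<eta> m \<alpha> y *s \<phi> y (B *\<^sub>C s0 y)) $ \<alpha>) = B * (cut y)\<^sup>2 * H0 y * weight m y" if "y \<in> U" for y
  proof -
    note D = U_D[OF that]
    have "(\<Sum>\<alpha>\<in>UNIV. (\<eta> m \<alpha> y *s \<phi> y (B *\<^sub>C s0 y)) $ \<alpha>) = h y (B *\<^sub>C s0 y) (s y) * weight m y"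
      using sum_\<eta>_coord(1)[OF that Bs[OF that]] by simp
    also have "h y (B *\<^sub>C s0 y) (s y) = B * h y (s0 y) (s0 y)"
      using sec_fibre[OF sec_s that] by (simp add: s0U[OF that] metric_scale[OF D])
    also have "h y (s0 y) (s0 y) = (cut y)\<^sup>2 * H0 y"
      using metric_s0[OF D] that by (simp add: ext_def)
    finally show ?thesis by simp
  qed
  have e2: "(\<Sum>\<alpha>\<in>UNIV. (\<Sum>k\<in>UNIV. dzbar k (\<eta> m \<alpha>) y *s \<phi> y (w k y)) $ \<alpha>) = (\<Sum>k\<in>UNIV. h y (w k y) (t m k y)) * weight m y"
    if "y \<in> U" for y
  proof -
    have "(\<Sum>\<alpha>\<in>UNIV. (\<Sum>k\<in>UNIV. dzbar k (\<eta> m \<alpha>) y *s \<phi> y (w k y)) $ \<alpha>)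
       = (\<Sum>k\<in>UNIV. \<Sum>\<alpha>\<in>UNIV. dzbar k (\<eta> m \<alpha>) y * \<phi> y (w k y) $ \<alpha>)"
      by (simp add: sum_component) (rule sum.swap)
    then show ?thesis by (simp add: sum_\<eta>_coord(2)[OF that w[OF that]] sum_distrib_right)
  qed
  have ext: "(LINT y|lebesgue. ext F y) = (LINT y|?M. F y)" "integrable lebesgue (ext F) = integrable ?M F" for F
  proof -
    have "ext F = (\<lambda>y. indicator U y *\<^sub>R F y)" by (auto simp: fun_eq_iff ext_def)
    then show "(LINT y|lebesgue. ext F y) = (LINT y|?M. F y)" "integrable lebesgue (ext F) = integrable ?M F"
      by (simp_all only: integral_restrict_space[OF U_lebesgue(2)] integrable_restrict_space[OF U_lebesgue(2)])
  qed
  have sp: "space ?M = U" by (simp add: space_restrict_space)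
  show "integrable lebesgue (ext (\<lambda>y. (\<Sum>k\<in>UNIV. h y (w k y) (t m k y)) * weight m y))"
  proof -
    have "integrable ?M (\<lambda>y. \<Sum>\<alpha>\<in>UNIV. (\<Sum>k\<in>UNIV. dzbar k (\<eta> m \<alpha>) y *s \<phi> y (w k y)) $ \<alpha>)"
      by (rule Bochner_Integration.integrable_sum[OF c2])
    moreover have "integrable ?M (\<lambda>y. \<Sum>\<alpha>\<in>UNIV. (\<Sum>k\<in>UNIV. dzbar k (\<eta> m \<alpha>) y *s \<phi> y (w k y)) $ \<alpha>)
      = integrable ?M (\<lambda>y. (\<Sum>k\<in>UNIV. h y (w k y) (t m k y)) * weight m y)"
      by (rule Bochner_Integration.integrable_cong[OF refl]) (simp only: sp e2)
    ultimately show ?thesis unfolding ext by simp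
  qed
  have "(LINT y|?M. B * (cut y)\<^sup>2 * H0 y * weight m y) = (LINT y|?M. (\<Sum>\<alpha>\<in>UNIV. (\<eta> m \<alpha> y *s \<phi> y (B *\<^sub>C s0 y)) $ \<alpha>))"
    by (rule Bochner_Integration.integral_cong[OF refl]) (simp only: sp e1)
  also have "\<dots> = (\<Sum>\<alpha>\<in>UNIV. LINT y|?M. (\<eta> m \<alpha> y *s \<phi> y (B *\<^sub>C s0 y)) $ \<alpha>)"
    by (rule Bochner_Integration.integral_sum[OF c1])
  also have "\<dots> = - (\<Sum>\<alpha>\<in>UNIV. LINT y|?M. (\<Sum>k\<in>UNIV. dzbar k (\<eta> m \<alpha>) y *s \<phi> y (w k y)) $ \<alpha>)"
    unfolding comp by (simp add: sum_negf)
  also have "\<dots> = - (LINT y|?M. (\<Sum>\<alpha>\<in>UNIV. (\<Sum>k\<in>UNIV. dzbar k (\<eta> m \<alpha>) y *s \<phi> y (w k y)) $ \<alpha>))"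
    by (subst Bochner_Integration.integral_sum[OF c2]) simp
  also have "(LINT y|?M. (\<Sum>\<alpha>\<in>UNIV. (\<Sum>k\<in>UNIV. dzbar k (\<eta> m \<alpha>) y *s \<phi> y (w k y)) $ \<alpha>))
      = (LINT y|?M. (\<Sum>k\<in>UNIV. h y (w k y) (t m k y)) * weight m y)"
    by (rule Bochner_Integration.integral_cong[OF refl]) (simp only: sp e2)
  finally show "(LINT y|lebesgue. ext (\<lambda>y. B * (cut y)\<^sup>2 * H0 y * weight m y) y)
     = - (LINT y|lebesgue. ext (\<lambda>y. (\<Sum>k\<in>UNIV. h y (w k y) (t m k y)) * weight m y) y)"
    unfolding ext .
qed

lemma Re_metric_AM_GM:
  assumes "y \<in> D" "v \<in> E y" "w \<in> E y"
  shows "- 2 * Re (h y v w) \<le> Re (h y v v) + Re (h y w w)"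
proof -
  note vw = fibre_closed(2)[OF assms]
  have "h y (v + w) (v + w) = h y v v + h y v w + (h y w v + h y w w)"
    using assms vw by (simp add: metric_add metric_add_right)
  moreover have "Re (h y w v) = Re (h y v w)" using metric_cnj[OF assms] by simp
  ultimately show ?thesis using metric_self(2)[OF assms(1) vw] by simp
qed

lemma Re_ext_weight: "Re (ext (\<lambda>y. F y * weight m y) y) = Re (ext F y) * exp (- (m * sq_dist x0 y))"
  by (simp add: ext_def weight_def)

lemma measurable_weighted_norm:
  fixes w :: "'n \<Rightarrow> complex^'n \<Rightarrow> 'v"
  assumes w: "\<And>k y. y \<in> U \<Longrightarrow> w k y \<in> E y"
    and wm: "\<And>k. (\<lambda>y. \<phi> y (w k y)) \<in> borel_measurable (lebesgue_on U)"
  shows "(\<lambda>y. Re (ext (\<lambda>y. (\<Sum>k\<in>UNIV. h y (w k y) (w k y)) * weight m y) y)) \<in> borel_measurable lebesgue"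
proof -
  have m1: "(\<lambda>y. h y (w k y) (w k y)) \<in> borel_measurable (lebesgue_on U)" for k
  proof -
    have "(\<lambda>y. \<Sum>\<beta>\<in>UNIV. cnj (\<phi> y (w k y) $ \<beta>) * (\<Sum>\<alpha>\<in>UNIV. \<phi> y (w k y) $ \<alpha> * h y (frame \<phi> (axis \<alpha> 1) y) (frame \<phi> (axis \<beta> 1) y)))
        \<in> borel_measurable (lebesgue_on U)"
    proof (intro borel_measurable_sum borel_measurable_times)
      show c: "(\<lambda>y. \<phi> y (w k y) $ \<alpha>) \<in> borel_measurable (lebesgue_on U)" for \<alpha>
        by (rule borel_measurable_continuous_on[OF _ wm]) (intro continuous_intros)
      show "(\<lambda>y. cnj (\<phi> y (w k y) $ \<beta>)) \<in> borel_measurable (lebesgue_on U)" for \<beta>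
        by (rule borel_measurable_continuous_on[OF _ c]) (intro continuous_intros)
      show "(\<lambda>y. h y (frame \<phi> (axis \<alpha> 1) y) (frame \<phi> (axis \<beta> 1) y)) \<in> borel_measurable (lebesgue_on U)" for \<alpha> \<beta>
        by (rule continuous_imp_measurable_on_sets_lebesgue[OF smooth_on_continuous_on U_lebesgue(1)])
           (intro smooth_on_metric[OF U] sec_frame[OF chart])
    qed
    moreover have "(\<Sum>\<beta>\<in>UNIV. cnj (\<phi> y (w k y) $ \<beta>) * (\<Sum>\<alpha>\<in>UNIV. \<phi> y (w k y) $ \<alpha> * h y (frame \<phi> (axis \<alpha> 1) y) (frame \<phi> (axis \<beta> 1) y)))
        = h y (w k y) (w k y)" if "y \<in> U" for y
      using metric_frame_expansion(2)[OF chart that w[OF that] w[OF that]]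
        metric_frame_expansion(1)[OF chart that w[OF that] frame_fibre[OF chart that]] by simp
    ultimately show ?thesis
      by (subst measurable_cong) (auto simp: space_restrict_space)
  qed
  have "weight m \<in> borel_measurable (lebesgue_on U)"
    by (rule continuous_imp_measurable_on_sets_lebesgue[OF smooth_on_continuous_on[OF smooth_weight] U_lebesgue(1)])
  then have "(\<lambda>y. Re ((\<Sum>k\<in>UNIV. h y (w k y) (w k y)) * weight m y)) \<in> borel_measurable (lebesgue_on U)"
    by (intro borel_measurable_continuous_on[OF _ borel_measurable_times] borel_measurable_sum m1) (auto intro!: continuous_intros)
  then have "(\<lambda>y. indicator U y *\<^sub>R Re ((\<Sum>k\<in>UNIV. h y (w k y) (w k y)) * weight m y)) \<in> borel_measurable lebesgue"
    by (rule iffD1[OF borel_measurable_restrict_space_iff[OF U_lebesgue(2)]])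
  then show ?thesis
    by (rule back_subst[where P = "\<lambda>f. f \<in> borel_measurable lebesgue"]) (auto simp: fun_eq_iff ext_def)
qed

text \<open>Let \<open>S\<close> be the left-hand side. The estimate bounds the squared norm of the solution by \<open>S\<close> itself, so
  \<open>2 S = - 2 Re (w, t) \<le> |w|\<^sup>2 + |t|\<^sup>2 \<le> S + |t|\<^sup>2\<close> has the right scale and replaces the
  Cauchy-Schwarz inequality.\<close>

lemma dual_inequality:
  fixes w :: "'n \<Rightarrow> complex^'n \<Rightarrow> 'v" and B :: real
  assumes B: "B \<ge> 0" and w: "\<And>k y. y \<in> U \<Longrightarrow> w k y \<in> E y"
    and wm: "\<And>k. (\<lambda>y. \<phi> y (w k y)) \<in> borel_measurable (lebesgue_on U)"
    and wi: "\<And>k. set_integrable lebesgue (cball x0 R) (\<lambda>y. (norm (\<phi> y (w k y)))\<^sup>2)"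
    and weak: "\<And>\<alpha>. (LINT y|lebesgue_on U. \<eta> m \<alpha> y *s \<phi> y (complex_of_real B *\<^sub>C s0 y))
        = - (LINT y|lebesgue_on U. (\<Sum>k\<in>UNIV. dzbar k (\<eta> m \<alpha>) y *s \<phi> y (w k y)))"
    and est: "(\<integral>\<^sup>+y. ennreal (Re (ext (\<lambda>y. (\<Sum>k\<in>UNIV. h y (w k y) (w k y)) * weight m y) y)) \<partial>lebesgue)
      \<le> (\<integral>\<^sup>+y. ennreal (Re (ext (\<lambda>y. B * (cut y)\<^sup>2 * H0 y * weight m y) y)) \<partial>lebesgue)"
  shows "(LINT y|lebesgue. Re (ext (\<lambda>y. B * (cut y)\<^sup>2 * H0 y * weight m y) y))
      \<le> (LINT y|lebesgue. Re (ext (\<lambda>y. (\<Sum>k\<in>UNIV. h y (t m k y) (t m k y)) * weight m y) y))"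
proof -
  let ?S = "ext (\<lambda>y. B * (cut y)\<^sup>2 * H0 y * weight m y)"
  let ?W = "\<lambda>y. Re (ext (\<lambda>y. (\<Sum>k\<in>UNIV. h y (w k y) (w k y)) * weight m y) y)"
  let ?TT = "ext (\<lambda>y. (\<Sum>k\<in>UNIV. h y (t m k y) (t m k y)) * weight m y)"
  let ?P = "ext (\<lambda>y. (\<Sum>k\<in>UNIV. h y (w k y) (t m k y)) * weight m y)"
  note weak' = weak_equation_tested[where B = "complex_of_real B", OF w wm wi weak]
  have H0: "0 \<le> Re (H0 y)" "Im (H0 y) = 0" if "y \<in> U" for y
    unfolding H0_def using metric_self(1,2)[OF U_D sec_fibre[OF sec_e]] that by auto
  have Snn: "0 \<le> Re (?S y)" for y
  proof (cases "y \<in> U")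
    case True
    have "Re (?S y) = B * (\<kappa> y)\<^sup>2 * Re (H0 y) * exp (- (m * sq_dist x0 y))"
      using True by (simp add: ext_def cut_def weight_def power2_eq_square)
    then show ?thesis using B H0[OF True] by simp
  qed (simp add: ext_def)
  have iS: "integrable lebesgue ?S"
    by (rule integrable_ext)
       (auto intro!: smooth_on_mult smooth_on_const smooth_cut smooth_terms smooth_weight U simp: power2_eq_square cut_zero)
  have iTT: "integrable lebesgue ?TT"
    by (rule integrable_ext)
       (auto intro!: smooth_on_mult smooth_on_sum smooth_on_metric sec_t smooth_weight U simp: t_zero metric_zero[OF U_D fibre_closed(1)[OF U_D]])
  note iRe = integrable_bounded_linear[OF bounded_linear_Re]
  note Re_int = integral_bounded_linear[OF bounded_linear_Re]
  have Wnn: "0 \<le> ?W y" for y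
  proof (cases "y \<in> U")
    case True
    then show ?thesis
      unfolding Re_ext_weight using metric_self(2)[OF U_D w] by (auto simp: ext_def intro!: mult_nonneg_nonneg sum_nonneg)
  qed (simp add: ext_def)
  have mW: "?W \<in> borel_measurable lebesgue" by (rule measurable_weighted_norm[OF w wm])
  have nS: "(\<integral>\<^sup>+y. ennreal (Re (?S y)) \<partial>lebesgue) = ennreal (LINT y|lebesgue. Re (?S y))"
    by (rule nn_integral_eq_integral[OF iRe[OF iS]]) (simp add: Snn)
  have iW: "integrable lebesgue ?W"
  proof (rule integrableI_bounded[OF mW])
    have "(\<integral>\<^sup>+y. ennreal (norm (?W y)) \<partial>lebesgue) \<le> ennreal (LINT y|lebesgue. Re (?S y))"
      using est Wnn nS by simp
    then show "(\<integral>\<^sup>+y. ennreal (norm (?W y)) \<partial>lebesgue) < \<infinity>"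
      by (rule order_le_less_trans) simp
  qed
  have W_le: "(LINT y|lebesgue. ?W y) \<le> (LINT y|lebesgue. Re (?S y))"
    using est unfolding nS
    by (intro integral_real_bounded) (simp_all add: Bochner_Integration.integral_nonneg Snn)
  have "2 * (LINT y|lebesgue. Re (?S y)) = (LINT y|lebesgue. - 2 * Re (?P y))"
    using weak'(1) by (simp add: Re_int[OF iS] Re_int[OF weak'(2)] iRe[OF weak'(2)])
  also have "\<dots> \<le> (LINT y|lebesgue. ?W y + Re (?TT y))"
  proof (rule integral_mono)
    show "integrable lebesgue (\<lambda>y. - 2 * Re (?P y))" by (intro integrable_mult_right iRe weak'(2))
    show "integrable lebesgue (\<lambda>y. ?W y + Re (?TT y))" by (intro Bochner_Integration.integrable_add iW iRe iTT)
    fix y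
    show "- 2 * Re (?P y) \<le> ?W y + Re (?TT y)"
    proof (cases "y \<in> U")
      case True
      have "(\<Sum>k\<in>UNIV. - 2 * Re (h y (w k y) (t m k y))) \<le> (\<Sum>k\<in>UNIV. Re (h y (w k y) (w k y)) + Re (h y (t m k y) (t m k y)))"
        by (intro sum_mono Re_metric_AM_GM U_D w sec_fibre[OF sec_t] True)
      then have "- 2 * Re (\<Sum>k\<in>UNIV. h y (w k y) (t m k y))
          \<le> Re (\<Sum>k\<in>UNIV. h y (w k y) (w k y)) + Re (\<Sum>k\<in>UNIV. h y (t m k y) (t m k y))"
        by (simp add: sum_distrib_left sum.distrib sum_negf)
      from mult_right_mono[OF this, of "exp (- (m * sq_dist x0 y))"]
      show ?thesis unfolding Re_ext_weight using True by (simp add: ext_def algebra_simps)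
    qed (simp add: ext_def)
  qed
  also have "\<dots> = (LINT y|lebesgue. ?W y) + (LINT y|lebesgue. Re (?TT y))"
    by (intro Bochner_Integration.integral_add iW iRe iTT)
  finally show ?thesis using W_le by linarith
qed

end

context
  fixes D :: "(complex^'n::{finite,linorder}) set"
    and E :: "complex^'n::{finite,linorder} \<Rightarrow> 'v::complex_vector set"
    and T :: "('n, 'r::finite, 'v) atlas"
    and h :: "complex^'n::{finite,linorder} \<Rightarrow> 'v \<Rightarrow> 'v \<Rightarrow> complex"
    and N1 N2 :: "('n, 'v) partial_connection"
    and U :: "(complex^'n::{finite,linorder}) set"
    and \<phi> :: "complex^'n::{finite,linorder} \<Rightarrow> 'v \<Rightarrow> complex^'r"
    and b :: "complex^'r" and x0 :: "complex^'n::{finite,linorder}" and R :: real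
    and \<kappa> :: "complex^'n::{finite,linorder} \<Rightarrow> real"
  assumes cs: "cutoff_section D E T h N1 N2 U \<phi> x0 R \<kappa>"
begin

interpretation cutoff_section D E T h N1 N2 U \<phi> b x0 R \<kappa> by (rule cs)

lemma smooth_compact_source:
  "smooth_compact_pq_form D E T CARD('n) CARD('n) (\<lambda>x. top_form (B *\<^sub>C s0 x))"
  unfolding smooth_compact_pq_form_def is_pq_form_def
proof (intro conjI ballI allI)
  have s: "sec D (\<lambda>x. B *\<^sub>C s0 x)"
    by (rule sec_scale[OF open_D order_refl smooth_on_const sec_s0])
  show "(top_form (B *\<^sub>C s0 x) :: ('n, 'v) cform) \<in> pq_forms_at CARD('n) CARD('n) (E x)" if "x \<in> D" for x
    by (rule top_form_pq[OF fibre_closed(1)[OF that] sec_fibre[OF s that]])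
  show "sec D (\<lambda>x. top_form (B *\<^sub>C s0 x) I J)" for I J :: "'n set"
  proof (cases "I = UNIV \<and> J = UNIV")
    case True
    then show ?thesis using s by (simp add: top_form_def)
  next
    case False
    show ?thesis unfolding top_form_def if_not_P[OF False] by (rule sec_zero[OF open_D order_refl])
  qed
  show "\<exists>K. compact K \<and> K \<subseteq> D \<and> (\<forall>x\<in>D - K. \<forall>I J. (top_form (B *\<^sub>C s0 x) :: ('n, 'v) cform) I J = 0)"
    using ball_U U(2) by (intro exI[of _ "cball x0 R"]) (auto simp: top_form_def s0_def s_zero)
qed

text \<open>Up to sign, the component of \<open>d\<bar>z\<^sub>k \<and> \<alpha>\<close> in top degree is the coefficient of \<open>\<alpha>\<close> with \<open>d\<bar>z\<^sub>k\<close> omitted.\<close>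

lemma sum_components_le_form_norm:
  fixes \<alpha> :: "('n, 'v) cform"
  assumes x: "x \<in> D" and \<alpha>: "\<And>I J. \<alpha> I J \<in> E x"
  shows "Re (\<Sum>k\<in>UNIV. h x (wedge_dzbar k \<alpha> UNIV UNIV) (wedge_dzbar k \<alpha> UNIV UNIV)) \<le> Re (form_inner (h x) \<alpha> \<alpha>)"
proof -
  have nn: "0 \<le> Re (h x (\<alpha> I J) (\<alpha> I J))" for I J by (rule metric_self(2)[OF x \<alpha>])
  have w: "h x (wedge_dzbar k \<alpha> UNIV UNIV) (wedge_dzbar k \<alpha> UNIV UNIV) = h x (\<alpha> UNIV (UNIV - {k})) (\<alpha> UNIV (UNIV - {k}))" for k
  proof -
    let ?c = "(-1) ^ (card (UNIV::'n set) + card {i\<in>UNIV. i < k}) :: complex"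
    have c: "?c * cnj ?c = 1" by (simp flip: power_mult_distrib)
    have "h x (?c *\<^sub>C \<alpha> UNIV (UNIV - {k})) (?c *\<^sub>C \<alpha> UNIV (UNIV - {k})) = (?c * cnj ?c) * h x (\<alpha> UNIV (UNIV - {k})) (\<alpha> UNIV (UNIV - {k}))"
      using \<alpha> fibre_closed(3)[OF x \<alpha>] by (simp add: metric_scale[OF x] metric_scale_right[OF x])
    then show ?thesis unfolding c by (simp add: wedge_dzbar_def)
  qed
  have "Re (\<Sum>k\<in>UNIV. h x (wedge_dzbar k \<alpha> UNIV UNIV) (wedge_dzbar k \<alpha> UNIV UNIV))
      = (\<Sum>J\<in>range (\<lambda>k. UNIV - {k}). Re (h x (\<alpha> UNIV J) (\<alpha> UNIV J)))"
    by (subst sum.reindex) (auto simp: inj_on_def w)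
  also have "\<dots> \<le> (\<Sum>J\<in>UNIV. Re (h x (\<alpha> UNIV J) (\<alpha> UNIV J)))"
    by (rule sum_mono2) (auto simp: nn)
  also have "\<dots> \<le> (\<Sum>I\<in>UNIV. \<Sum>J\<in>UNIV. Re (h x (\<alpha> I J) (\<alpha> I J)))"
    using sum_mono2[of UNIV "{UNIV}" "\<lambda>I. \<Sum>J\<in>UNIV. Re (h x (\<alpha> I J) (\<alpha> I J))"] by (simp add: sum_nonneg nn)
  also have "\<dots> = Re (form_inner (h x) \<alpha> \<alpha>)" by (simp add: form_inner_def)
  finally show ?thesis .
qed

text \<open>The source is the curvature operator applied to the cut-off section. Since that operator is the constant
  \<open>m n + c\<close>, the right-hand side of the estimate equals the pairing of the source with \<open>s\<close>.\<close>

lemma adjoint_inequality: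
  fixes m c :: real
  assumes m: "m > 0" and c: "c \<ge> 0"
    and solve: "\<And>\<psi> f. smooth_strictly_psh_on D \<psi> \<Longrightarrow>
           smooth_compact_pq_form D E T CARD('n) CARD('n) f \<Longrightarrow>
           \<exists>u. L2loc_pq_form D E T CARD('n) (CARD('n) - 1) u \<and>
               weak_dbar T u f \<and> L2_estimate D E h \<psi> c f u"
  shows "(LINT y|lebesgue. Re (ext (\<lambda>y. (m * real CARD('n) + c) * (cut y)\<^sup>2 * H0 y * weight m y) y))
      \<le> (LINT y|lebesgue. Re (ext (\<lambda>y. (\<Sum>k\<in>UNIV. h y (t m k y) (t m k y)) * weight m y) y))"
proof -
  define B where "B = m * real CARD('n) + c"
  have B: "B > 0" using m c by (simp add: B_def add_pos_nonneg)
  let ?\<psi> = "\<lambda>z. m * sq_dist x0 z"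
  let ?f = "\<lambda>x. top_form (complex_of_real B *\<^sub>C s0 x) :: ('n, 'v) cform"
  obtain u where L2: "L2loc_pq_form D E T CARD('n) (CARD('n) - 1) u"
    and weak: "weak_dbar T u ?f" and est: "L2_estimate D E h ?\<psi> c ?f u"
    using solve[OF strictly_psh_sq_dist[OF m open_D] smooth_compact_source] by blast
  have uE: "u y I J \<in> E y" if "y \<in> D" for y I J
    using L2 that by (auto simp: L2loc_pq_form_def is_pq_form_def pq_forms_at_def forms_at_def)
  define w where "w k y = wedge_dzbar k (u y) UNIV UNIV" for k y
  define sg where "sg k = ((-1) ^ (card (UNIV::'n set) + card {i\<in>UNIV. i < k}) :: complex)" for k :: 'n
  have w_eq: "w k y = sg k *\<^sub>C u y UNIV (UNIV - {k})" for k y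
    by (simp add: w_def sg_def wedge_dzbar_def)
  have wE: "w k y \<in> E y" if "y \<in> U" for k y
    unfolding w_eq by (rule fibre_closed(3)[OF U_D[OF that] uE[OF U_D[OF that]]])
  have coord: "\<phi> y (w k y) = sg k *s \<phi> y (u y UNIV (UNIV - {k}))" if "y \<in> U" for k y
    unfolding w_eq by (rule coord_scale[OF chart that uE[OF U_D[OF that]]])
  have um: "(\<lambda>y. \<phi> y (u y I J)) \<in> borel_measurable (lebesgue_on U)"
    and ui: "set_integrable lebesgue (cball x0 R) (\<lambda>y. (norm (\<phi> y (u y I J)))\<^sup>2)" for I J
    using L2 chart ball_U compact_cball[of x0 R] unfolding L2loc_pq_form_def by blast+
  have wm: "(\<lambda>y. \<phi> y (w k y)) \<in> borel_measurable (lebesgue_on U)" for k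
  proof -
    have "(\<lambda>y. sg k *s \<phi> y (u y UNIV (UNIV - {k}))) \<in> borel_measurable (lebesgue_on U)"
      by (rule borel_measurable_smult[OF borel_measurable_const um])
    then show ?thesis
      by (subst measurable_cong) (auto simp: space_restrict_space coord)
  qed
  have wi: "set_integrable lebesgue (cball x0 R) (\<lambda>y. (norm (\<phi> y (w k y)))\<^sup>2)" for k
  proof -
    have "norm (sg k) = 1" by (simp add: sg_def norm_power)
    then have "norm (\<phi> y (w k y)) = norm (\<phi> y (u y UNIV (UNIV - {k})))" if "y \<in> cball x0 R" for y
      using ball_U that coord[of y k] by (auto simp: norm_vector_smult)
    then have "(\<lambda>y. indicator (cball x0 R) y *\<^sub>R (norm (\<phi> y (w k y)))\<^sup>2)
       = (\<lambda>y. indicator (cball x0 R) y *\<^sub>R (norm (\<phi> y (u y UNIV (UNIV - {k}))))\<^sup>2)"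
      by (auto simp: fun_eq_iff indicator_def)
    with ui[of UNIV "UNIV - {k}"] show ?thesis by (simp add: set_integrable_def)
  qed
  have weak': "(LINT y|lebesgue_on U. \<eta> m \<alpha> y *s \<phi> y (complex_of_real B *\<^sub>C s0 y))
      = - (LINT y|lebesgue_on U. (\<Sum>k\<in>UNIV. dzbar k (\<eta> m \<alpha>) y *s \<phi> y (w k y)))" for \<alpha>
  proof -
    have "\<forall>\<eta> I J. test_function U \<eta> \<longrightarrow>
        (LINT x|lebesgue_on U. \<eta> x *s \<phi> x (?f x I J)) =
        - (LINT x|lebesgue_on U. (\<Sum>k\<in>UNIV. dzbar k \<eta> x *s \<phi> x (wedge_dzbar k (u x) I J)))"
      using bspec[OF weak[unfolded weak_dbar_def] chart] by (simp only: prod.case)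
    from this[rule_format, OF test_function_\<eta>, of m \<alpha> UNIV UNIV] show ?thesis
      by (simp add: w_def top_form_def)
  qed
  let ?G = "\<lambda>y. ennreal (Re (ext (\<lambda>y. (\<Sum>k\<in>UNIV. h y (w k y) (w k y)) * weight m y) y))"
  let ?S = "\<lambda>y. ennreal (Re (ext (\<lambda>y. B * (cut y)\<^sup>2 * H0 y * weight m y) y))"
  have "(2 ^ CARD('n)) * (\<integral>\<^sup>+y. ?G y \<partial>lebesgue) = (\<integral>\<^sup>+y. ?G y \<partial>dV_omega)"
    unfolding dV_omega_def
    by (rule nn_integral_scale_measure[symmetric]) (intro measurable_compose[OF measurable_weighted_norm[OF wE wm] measurable_ennreal])
  also have "\<dots> \<le> (\<integral>\<^sup>+x\<in>D. ennreal (Re (form_inner (h x) (u x) (u x)) * exp (- ?\<psi> x)) \<partial>dV_omega)"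
  proof (rule nn_integral_mono)
    fix y
    show "?G y \<le> ennreal (Re (form_inner (h y) (u y) (u y)) * exp (- ?\<psi> y)) * indicator D y"
    proof (cases "y \<in> U")
      case True
      note D = U_D[OF True]
      have "Re (ext (\<lambda>y. (\<Sum>k\<in>UNIV. h y (w k y) (w k y)) * weight m y) y)
          = Re (\<Sum>k\<in>UNIV. h y (w k y) (w k y)) * exp (- ?\<psi> y)"
        unfolding Re_ext_weight using True by (simp add: ext_def)
      also have "\<dots> \<le> Re (form_inner (h y) (u y) (u y)) * exp (- ?\<psi> y)"
        unfolding w_def by (intro mult_right_mono sum_components_le_form_norm[OF D uE[OF D]]) simp
      finally show ?thesis using D by (simp add: ennreal_leI)
    qed (simp add: ext_def)
  qed
  also have "\<dots> \<le> (\<integral>\<^sup>+x\<in>D. ennreal (Re (form_inner (h x) (curvature_operator_inverse E h ?\<psi> c x (?f x)) (?f x))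
                       * exp (- ?\<psi> x)) \<partial>dV_omega)"
    using est unfolding L2_estimate_def .
  also have "\<dots> = (\<integral>\<^sup>+y. ?S y \<partial>dV_omega)"
  proof (rule nn_integral_cong)
    fix y
    show "ennreal (Re (form_inner (h y) (curvature_operator_inverse E h ?\<psi> c y (?f y)) (?f y)) * exp (- ?\<psi> y)) * indicator D y = ?S y"
    proof (cases "y \<in> D")
      case True
      have "form_inner (h y) (curvature_operator_inverse E h ?\<psi> c y (?f y)) (?f y) = B * h y (s0 y) (s0 y)"
        unfolding B_def
        by (rule form_inner_curvature_operator_inverse[OF hermitian_bundle_axioms True sec_fibre[OF sec_s0 True]])
           (use B in \<open>simp add: B_def\<close>)
      then have "Re (form_inner (h y) (curvature_operator_inverse E h ?\<psi> c y (?f y)) (?f y)) * exp (- ?\<psi> y)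
          = Re (ext (\<lambda>y. B * (cut y)\<^sup>2 * H0 y) y) * exp (- ?\<psi> y)"
        by (simp add: metric_s0[OF True] ext_def mult.assoc)
      then show ?thesis unfolding Re_ext_weight using True by simp
    next
      case False
      then have "y \<notin> U" using U_D by blast
      with False show ?thesis by (simp add: ext_def)
    qed
  qed
  also have "\<dots> = (2 ^ CARD('n)) * (\<integral>\<^sup>+y. ?S y \<partial>lebesgue)"
    unfolding dV_omega_def
  proof (rule nn_integral_scale_measure)
    have "integrable lebesgue (ext (\<lambda>y. B * (cut y)\<^sup>2 * H0 y * weight m y))"
      by (rule integrable_ext)
         (auto intro!: smooth_on_mult smooth_on_const smooth_cut smooth_terms smooth_weight U simp: power2_eq_square cut_zero)
    from borel_measurable_integrable[OF integrable_bounded_linear[OF bounded_linear_Re this]]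
    show "?S \<in> borel_measurable lebesgue" by (rule measurable_compose[OF _ measurable_ennreal])
  qed
  finally have "(2 ^ CARD('n)) * (\<integral>\<^sup>+y. ?G y \<partial>lebesgue) \<le> (2 ^ CARD('n)) * (\<integral>\<^sup>+y. ?S y \<partial>lebesgue)" .
  then have "(\<integral>\<^sup>+y. ?G y \<partial>lebesgue) \<le> (\<integral>\<^sup>+y. ?S y \<partial>lebesgue)"
    by (subst (asm) ennreal_mult_le_mult_iff) (auto simp: power_eq_top_ennreal)
  from dual_inequality[OF less_imp_le[OF B] wE wm wi weak' this]
  show ?thesis unfolding B_def by simp
qed

text \<open>The term \<open>m n |s|\<^sup>2\<close> of the Bochner identity cancels against the same term of the adjoint inequality. What
  remains of order \<open>m\<close> is the cut-off error \<open>E1\<close>.\<close>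

lemma trace_integral_inequality:
  fixes m c :: real
  assumes m: "m > 0" and c: "c \<ge> 0"
    and solve: "\<And>\<psi> f. smooth_strictly_psh_on D \<psi> \<Longrightarrow>
           smooth_compact_pq_form D E T CARD('n) CARD('n) f \<Longrightarrow>
           \<exists>u. L2loc_pq_form D E T CARD('n) (CARD('n) - 1) u \<and>
               weak_dbar T u f \<and> L2_estimate D E h \<psi> c f u"
  shows "(LINT y|lebesgue. Re (ext (\<lambda>y. (cut y)\<^sup>2 * (c * H0 y + (\<Sum>k\<in>UNIV. Q k y))) y) * exp (- (m * sq_dist x0 y)))
      \<le> (LINT y|lebesgue. (Re (ext (\<lambda>y. \<Sum>k\<in>UNIV. E0 k y) y) + m * Re (ext (\<lambda>y. \<Sum>k\<in>UNIV. E1 k y) y)) * exp (- (m * sq_dist x0 y)))"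
proof -
  let ?q = "\<lambda>y. \<Sum>k\<in>UNIV. Q k y" and ?e0 = "\<lambda>y. \<Sum>k\<in>UNIV. E0 k y" and ?e1 = "\<lambda>y. \<Sum>k\<in>UNIV. E1 k y"
  let ?L = "ext (\<lambda>y. (m * real CARD('n) + c) * (cut y)\<^sup>2 * H0 y * weight m y)"
  let ?X = "ext (\<lambda>y. ((cut y)\<^sup>2 * (complex_of_real (m * CARD('n)) * H0 y - ?q y) + ?e0 y + complex_of_real m * ?e1 y) * weight m y)"
  let ?A = "\<lambda>y. Re (ext (\<lambda>y. (cut y)\<^sup>2 * (c * H0 y + ?q y)) y) * exp (- (m * sq_dist x0 y))"
  let ?Z = "\<lambda>y. (Re (ext ?e0 y) + m * Re (ext ?e1 y)) * exp (- (m * sq_dist x0 y))"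
  let ?TT = "ext (\<lambda>y. (\<Sum>k\<in>UNIV. h y (t m k y) (t m k y)) * weight m y)"
  note iRe = integrable_bounded_linear[OF bounded_linear_Re]
  note Re_int = integral_bounded_linear[OF bounded_linear_Re]
  note sm = smooth_on_mult smooth_on_const smooth_on_add smooth_on_diff smooth_on_sum smooth_cut smooth_terms smooth_weight U
  have iL: "integrable lebesgue ?L"
    by (rule integrable_ext) (auto intro!: sm simp: power2_eq_square cut_zero)
  have iX: "integrable lebesgue ?X"
  proof (rule integrable_ext)
    show "smooth_on U (\<lambda>y. ((cut y)\<^sup>2 * (complex_of_real (m * CARD('n)) * H0 y - ?q y) + ?e0 y + complex_of_real m * ?e1 y) * weight m y)"
      by (auto intro!: sm simp: power2_eq_square)
  qed (simp add: cut_zero E0_def E1_def)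
  have iA: "integrable lebesgue ?A"
    unfolding Re_ext_weight[symmetric]
    by (rule iRe, rule integrable_ext) (auto intro!: sm simp: power2_eq_square cut_zero)
  have iTT: "integrable lebesgue ?TT"
    by (rule integrable_ext)
       (auto intro!: sm smooth_on_metric sec_t simp: t_zero metric_zero[OF U_D fibre_closed(1)[OF U_D]])
  have "(LINT y|lebesgue. Re (?L y)) \<le> (LINT y|lebesgue. Re (?TT y))"
    using adjoint_inequality[OF m c solve] by simp
  also have "\<dots> = (LINT y|lebesgue. Re (?X y))"
    unfolding Re_int[OF iTT] Re_int[OF iX] bochner_identity by simp
  finally have le: "(LINT y|lebesgue. Re (?L y)) \<le> (LINT y|lebesgue. Re (?X y))" .
  have "?A y - ?Z y = Re (?L y) - Re (?X y)" for y
    by (cases "y \<in> U") (simp_all add: ext_def weight_def algebra_simps)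
  then have Z: "?Z = (\<lambda>y. ?A y - (Re (?L y) - Re (?X y)))" by (auto simp: fun_eq_iff algebra_simps)
  have "(LINT y|lebesgue. ?Z y) = (LINT y|lebesgue. ?A y) - ((LINT y|lebesgue. Re (?L y)) - (LINT y|lebesgue. Re (?X y)))"
    unfolding Z by (simp only: Bochner_Integration.integral_diff[OF iA Bochner_Integration.integrable_diff[OF iRe[OF iL] iRe[OF iX]]]
        Bochner_Integration.integral_diff[OF iRe[OF iL] iRe[OF iX]])
  with le show ?thesis by simp
qed

end

text \<open>If the bound fails at \<open>x0\<close>, it fails with a margin near \<open>x0\<close> for the frame section through \<open>a\<close>. Cutting this
  section off where the margin persists contradicts the concentration of the weight.\<close>

theorem trace_lower_bound:
  fixes D :: "(complex^'n::{finite,linorder}) set"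
    and E :: "complex^'n::{finite,linorder} \<Rightarrow> 'v::complex_vector set"
    and T :: "('n, 'r::finite, 'v) atlas"
    and h :: "complex^'n::{finite,linorder} \<Rightarrow> 'v \<Rightarrow> 'v \<Rightarrow> complex"
    and c :: real
  assumes hb: "hermitian_bundle D E T h" and c: "c \<ge> 0"
    and solve: "\<And>\<psi> f. smooth_strictly_psh_on D \<psi> \<Longrightarrow>
           smooth_compact_pq_form D E T CARD('n) CARD('n) f \<Longrightarrow>
           \<exists>u. L2loc_pq_form D E T CARD('n) (CARD('n) - 1) u \<and>
               weak_dbar T u f \<and> L2_estimate D E h \<psi> c f u"
    and x0: "x0 \<in> D" and a: "a \<in> E x0"
  shows "c * Re (h x0 a a) \<le> trace_curvature D E T h x0 a"
proof (rule ccontr)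
  interpret hermitian_bundle D E T h by (rule hb)
  assume contra: "\<not> ?thesis"
  obtain U \<phi> where chart: "(U, \<phi>) \<in> T" and x0U: "x0 \<in> U" using chart_exists[OF x0] .
  note U = chart_open[OF chart] chart_subset[OF chart]
  define b where "b = \<phi> x0 a"
  let ?e = "frame \<phi> b"
  have e0: "?e x0 = a" unfolding b_def by (rule frame_coord[OF chart x0U a])
  \<comment> \<open>By the curvature pairing, the second summand at \<open>x0\<close> is minus the trace.\<close>
  define F where "F y = c * Re (h y (?e y) (?e y)) + Re (\<Sum>k\<in>UNIV. h y (?e y) (nabla01 k (nabla10 k ?e) y))" for y
  have "trace_curvature D E T h x0 a = - Re (\<Sum>k\<in>UNIV. h x0 (?e x0) (nabla01 k (nabla10 k ?e) x0))"
    unfolding trace_curvature_def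
    using curvature_pairing[OF chern_connection_exists chart x0U a, of _ _ b] by (simp add: e0 sum_negf)
  with contra have pos: "F x0 > 0" by (simp add: F_def e0)
  have se: "sec U ?e" by (rule sec_frame[OF chart])
  have "smooth_on U (\<lambda>y. h y (?e y) (?e y))" "smooth_on U (\<lambda>y. h y (?e y) (nabla01 k (nabla10 k ?e) y))" for k
    by (intro smooth_on_metric[OF U] se nabla_sec[OF U])+
  then have "continuous_on U F"
    unfolding F_def[abs_def] by (intro continuous_intros smooth_on_continuous_on)
  then have "isCont F x0" using U(1) x0U by (simp add: continuous_on_eq_continuous_at)
  then obtain d where d: "d > 0" "\<And>y. dist y x0 < d \<Longrightarrow> dist (F y) (F x0) < F x0 / 2"
    unfolding continuous_at_eps_delta using pos by (metis half_gt_zero)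
  obtain d' where d': "d' > 0" "cball x0 d' \<subseteq> U" using open_contains_cball U(1) x0U by metis
  \<comment> \<open>Half of \<open>d\<close>, because the estimate by continuity needs an open ball.\<close>
  define R where "R = min (d/2) d'"
  have R: "R > 0" "cball x0 R \<subseteq> U" "cball x0 R \<subseteq> ball x0 d"
    using d d' by (auto simp: R_def)
  have FR: "F y \<ge> F x0 / 2" if "y \<in> cball x0 R" for y
  proof -
    have "dist y x0 < d" using R(3) that by (auto simp: dist_commute)
    from d(2)[OF this] show ?thesis unfolding dist_real_def by linarith
  qed
  obtain \<kappa> :: "complex^'n::{finite,linorder} \<Rightarrow> real" where bump: "smooth_on UNIV \<kappa>" "\<And>x. x \<in> ball x0 (R/2) \<Longrightarrow> \<kappa> x = 1"
    "\<And>x. x \<notin> cball x0 R \<Longrightarrow> \<kappa> x = 0"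
    using smooth_cutoff[of "R/2" R x0] R(1) by auto
  have cs: "cutoff_section D E T h nabla10 nabla01 U \<phi> x0 R \<kappa>"
    by unfold_locales (use chern_connection_exists chart bump R in auto)
  interpret cutoff_section D E T h nabla10 nabla01 U \<phi> b x0 R \<kappa> by (rule cs)
  let ?F = "\<lambda>y. Re (ext (\<lambda>y. (cut y)\<^sup>2 * (c * H0 y + (\<Sum>k\<in>UNIV. Q k y))) y)"
  let ?E0 = "\<lambda>y. Re (ext (\<lambda>y. \<Sum>k\<in>UNIV. E0 k y) y)" and ?E1 = "\<lambda>y. Re (ext (\<lambda>y. \<Sum>k\<in>UNIV. E1 k y) y)"
  note sm = smooth_on_mult smooth_on_const smooth_on_add smooth_on_sum smooth_cut smooth_terms U
  have cont: "continuous_on UNIV (\<lambda>y. Re (ext G y))" if "smooth_on U G" "\<And>y. y \<notin> cball x0 R \<Longrightarrow> G y = 0" for G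
    by (intro continuous_on_Re smooth_on_continuous_on smooth_ext that)
  have z: "(cut y)\<^sup>2 * (c * H0 y + (\<Sum>k\<in>UNIV. Q k y)) = 0" "(\<Sum>k\<in>UNIV. E0 k y) = 0" "(\<Sum>k\<in>UNIV. E1 k y) = 0"
    if "y \<notin> cball x0 R" for y
    using that by (simp_all add: cut_zero E0_def E1_def)
  have F_eq: "?F y = (\<kappa> y)\<^sup>2 * F y" if "y \<in> U" for y
    using that by (simp add: ext_def cut_def F_def H0_def Q_def flip: of_real_power)
  have flat: "dz k cut y = 0" "dzbar k cut y = 0" "dzbar k (dz k cut) y = 0" if "y \<in> ball x0 (R/2)" for k y
  proof -
    have 1: "dz k cut y = 0" "dzbar k cut y = 0" if "y \<in> ball x0 (R/2)" for y
    proof -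
      have "dz k cut y = dz k (\<lambda>_. 1) y" "dzbar k cut y = dzbar k (\<lambda>_. 1) y"
        by (rule dz_cong_open[OF open_ball that], simp only: cut_def bump(2) of_real_1)
          (rule dzbar_cong_open[OF open_ball that], simp only: cut_def bump(2) of_real_1)
      then show "dz k cut y = 0" "dzbar k cut y = 0" by simp_all
    qed
    then show "dz k cut y = 0" "dzbar k cut y = 0" using that by blast+
    show "dzbar k (dz k cut) y = 0"
      using dzbar_cong_open[OF open_ball that, of "dz k cut" "\<lambda>_. 0" k] 1 by simp
  qed
  show False
  proof (rule weighted_concentration[of ?F ?E0 ?E1 "cball x0 R" x0 "R/2" "F x0 / 2"])
    show "continuous_on UNIV ?F"
      by (rule cont) (auto intro!: sm simp: power2_eq_square cut_zero)
    show "continuous_on UNIV ?E0" "continuous_on UNIV ?E1" by (rule cont; (intro sm z)?; assumption?)+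
    show "?F y = 0" "?E0 y = 0" "?E1 y = 0" if "y \<notin> cball x0 R" for y
      by (simp_all only: ext_def z[OF that] if_cancel zero_complex.sel)
    show "0 \<le> ?F y" for y
    proof (cases "y \<in> cball x0 R")
      case True
      then have "y \<in> U" "0 \<le> F y" using R(2) FR[OF True] pos by auto
      then show ?thesis by (simp add: F_eq)
    next
      case False
      then have "?F y = 0" by (simp only: ext_def z(1)[OF False] if_cancel zero_complex.sel)
      then show ?thesis by simp
    qed
    show "F x0 / 2 \<le> ?F y" if "y \<in> ball x0 (R/2)" for y
    proof -
      have "y \<in> cball x0 R" using that R(1) by auto
      then show ?thesis using FR[of y] R(2) that by (auto simp: F_eq bump(2))
    qed
    show "?E0 y = 0" "?E1 y = 0" if "y \<in> ball x0 (R/2)" for y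
      using flat[OF that] by (simp_all add: ext_def E0_def E1_def)
    show "(LINT y|lebesgue. ?F y * exp (- (m * sq_dist x0 y))) \<le> (LINT y|lebesgue. (?E0 y + m * ?E1 y) * exp (- (m * sq_dist x0 y)))"
      if "m > 0" for m
      by (rule trace_integral_inequality[OF cs that c solve])
  qed (use R pos in auto)
qed

theorem theorem1p2:
  fixes D :: "(complex^'n::{finite,linorder}) set"
    and E :: "complex^'n::{finite,linorder} \<Rightarrow> 'v::complex_vector set"
    and T :: "('n, 'r::finite, 'v) atlas"
    and h :: "complex^'n::{finite,linorder} \<Rightarrow> 'v \<Rightarrow> 'v \<Rightarrow> complex"
    and c :: real
  assumes "open D" and "connected D" and "D \<noteq> {}" and "bounded D" and "pseudoconvex D"
    and "c \<ge> 0"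
    and "holomorphic_vector_bundle D E T"
    and "smooth_hermitian_metric D E T h"
    and "\<And>\<psi> f. smooth_strictly_psh_on D \<psi> \<Longrightarrow>
           smooth_compact_pq_form D E T CARD('n) CARD('n) f \<Longrightarrow>
           \<exists>u. L2loc_pq_form D E T CARD('n) (CARD('n) - 1) u \<and>
               weak_dbar T u f \<and> L2_estimate D E h \<psi> c f u"
  shows "(\<forall>x\<in>D. \<forall>a\<in>E x. trace_curvature D E T h x a \<ge> c * Re (h x a a)) \<and>
         (c > 0 \<longrightarrow> RC_positive D E T h) \<and>
         (c = 0 \<longrightarrow> RC_semi_positive D E T h)"
proof -
  have hb: "hermitian_bundle D E T h"
    using assms by (simp add: hermitian_bundle_def)
  interpret hermitian_bundle D E T h by (rule hb)
  have bound: "c * Re (h x a a) \<le> trace_curvature D E T h x a" if "x \<in> D" "a \<in> E x" for x a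
    by (rule trace_lower_bound[OF hb assms(6) assms(9) that])
  have trace: "trace_curvature D E T h x a = (\<Sum>j\<in>UNIV. curvature_form D E T h x (axis j 1) a)" for x a
  proof -
    have "curvature_form D E T h x (axis j 1) a = Re (h x (chern_curvature D E T h x j j a) a)" for j
    proof -
      have "(\<Sum>i\<in>UNIV. \<Sum>k\<in>UNIV. h x (chern_curvature D E T h x i k a) a * axis j 1 $ i * cnj (axis j 1 $ k))
        = (\<Sum>i\<in>UNIV. if i = j then h x (chern_curvature D E T h x i j a) a else 0)"
      proof (intro sum.cong refl)
        fix i
        show "(\<Sum>k\<in>UNIV. h x (chern_curvature D E T h x i k a) a * axis j 1 $ i * cnj (axis j 1 $ k))
          = (if i = j then h x (chern_curvature D E T h x i j a) a else 0)"
        proof (cases "i = j")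
          case True
          then show ?thesis
            by (subst sum.remove[of UNIV j]) (auto intro!: sum.neutral simp: axis_def)
        qed (simp add: axis_def)
      qed
      then show ?thesis by (simp add: curvature_form_def)
    qed
    then show ?thesis by (simp add: trace_curvature_def)
  qed
  have "RC_positive D E T h" if "c > 0"
    unfolding RC_positive_def
  proof (intro ballI impI)
    fix x a assume x: "x \<in> D" "a \<in> E x" "a \<noteq> 0"
    then have "0 < c * Re (h x a a)" using that metric_pos[OF x(1,2,2)] by simp
    also have "\<dots> \<le> (\<Sum>j\<in>UNIV. curvature_form D E T h x (axis j 1) a)" using bound[OF x(1,2)] trace by simp
    finally have "\<not> (\<forall>j\<in>UNIV. curvature_form D E T h x (axis j 1) a \<le> 0)"
      using sum_nonpos[of UNIV "\<lambda>j. curvature_form D E T h x (axis j 1) a"] by auto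
    then show "\<exists>v. curvature_form D E T h x v a > 0" by (meson not_le)
  qed
  moreover have "RC_semi_positive D E T h" if "c = 0"
    unfolding RC_semi_positive_def
  proof (intro ballI impI)
    fix x a assume x: "x \<in> D" "a \<in> E x" "a \<noteq> 0"
    have "0 \<le> (\<Sum>j\<in>UNIV. curvature_form D E T h x (axis j 1) a)" using bound[OF x(1,2)] that trace by simp
    then obtain j where "0 \<le> curvature_form D E T h x (axis j 1) a"
      using sum_strict_mono[of UNIV "\<lambda>j. curvature_form D E T h x (axis j 1) a" "\<lambda>_. 0"]
      by (metis finite_class.finite_UNIV UNIV_not_empty not_le sum.neutral_const)
    then show "\<exists>v. v \<noteq> 0 \<and> curvature_form D E T h x v a \<ge> 0"
      by (intro exI[of _ "axis j 1"]) (simp add: axis_eq_0_iff)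
  qed
  ultimately show ?thesis using bound by blast
qed

end
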